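(* Let $(b_1,b_2)\in\mathbb{C}^2\setminus\{(0,0)\}$ and $$\mathcal{G}=\left\{(z_2,z_3,w_1,w_2,w_3)\in\mathbb{C}^5:\begin{pmatrix} w_1 & w_2 \\ w_2 & w_3 \end{pmatrix}\begin{pmatrix} z_2 \\ z_3 \end{pmatrix}=\begin{pmatrix} b_1 \\ b_2 \end{pmatrix}\right\}.$$ Then there is a compatible $3$-tuple on $\mathcal{G}$, and $\mathcal{G}$ has the density property.
   Context: For a Stein manifold $X$, $\mathcal{O}(X)$ is the ring of holomorphic functions with the compact-open topology. A holomorphic vector field is called complete if its flow is defined for all complex times and all initial points. Density property: $\overline{\mathrm{Lie}(X)}=\mathrm{VF}(X)$, where $\mathrm{VF}(X)$ is the Lie algebra of all holomorphic vector fields on $X$, $\mathrm{Lie}(X)$ is the Lie algebra generated by the complete holomorphic vector fields on $X$, and the closure is in the compact-open topology. For a vector field $\theta$, $\ker\theta=\{f\in\mathcal{O}(X):\theta(f)=0\}$ and $\ker\theta^2=\{f:\theta(\theta(f))=0\}$. Compatible $n$-tuple: an ordered $n$-tuple $(\theta_1,\dots,\theta_n)$ of complete holomorphic vector fields on $X$ such that (1) there is a non-zero ideal $I\subset\mathcal{O}(X)$ contained in the closure of the linear span of $\prod_{i=1}^n\ker\theta_i=\{f_1\cdots f_n: f_i\in\ker\theta_i\}$; (2) there is a triple $(G,\pi,\epsilon)$ where (i) $G$ is a rooted directed tree with edges oriented towards the root; (ii) $\pi:\mathrm{Vert}(G)\to\{\theta_1,\dots,\theta_n\}$ is a bijection with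 $\pi(\mathrm{root})=\theta_1$; (iii) $\epsilon:\mathrm{Edges}(G)\to\mathcal{O}(X)$ satisfies $\epsilon(v,w)\in(\ker\pi(v)^2\setminus\ker\pi(v))\cap\ker\pi(w)$ for every edge $(v,w)$ from $v$ to $w$. *)

theory Defs
  imports
    "HOL-Algebra.Ideal"
    "Graph_Theory.Arc_Walk"
    "HOL-Library.Function_Algebras"
    "HOL-Analysis.Analysis"
    "HOL-Complex_Analysis.Complex_Analysis"
begin

text \<open>
  A Stein manifold is given as a closed complex submanifold \<open>X\<close> of some \<open>\<complex>\<^sup>n\<close>. Functions
  and vector fields on \<open>X\<close> are represented by total functions on the ambient space that vanish
  outside \<open>X\<close>, so that HOL equality is equality on \<open>X\<close>; the ring operations, scalar
  multiplication and bracket are the pointwise ones and preserve this convention.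
\<close>

definition holomorphic_several :: "(complex^'n \<Rightarrow> complex) \<Rightarrow> (complex^'n) set \<Rightarrow> bool" where
  "holomorphic_several F U \<longleftrightarrow>
     (\<forall>p\<in>U. \<exists>L. (F has_derivative L) (at p) \<and> (\<forall>c v. L (c *s v) = c * L v))"

text \<open>A function on \<open>X\<close> is holomorphic iff it extends holomorphically to the ambient space
  near each point of \<open>X\<close>.\<close>

definition hol_functions :: "(complex^'n) set \<Rightarrow> (complex^'n \<Rightarrow> complex) set" where
  "hol_functions X = {f. (\<forall>p. p \<notin> X \<longrightarrow> f p = 0) \<and>
     (\<forall>p\<in>X. \<exists>U F. open U \<and> p \<in> U \<and> holomorphic_several F U \<and> (\<forall>x\<in>U \<inter> X. F x = f x))}"

definition hol_ring :: "(complex^'n) set \<Rightarrow> (complex^'n \<Rightarrow> complex) ring" where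
  "hol_ring X = \<lparr>carrier = hol_functions X,
     monoid.mult = (\<lambda>f g p. f p * g p), one = indicator X,
     zero = (\<lambda>p. 0), add = (\<lambda>f g p. f p + g p)\<rparr>"

text \<open>The compact-open topology on a set \<open>C\<close> of maps defined on \<open>X\<close>. For vector fields it is
  used with the ambient \<open>\<complex>\<^sup>n\<close> as target: since the tangent bundle is a subspace of
  \<open>X \<times> \<complex>\<^sup>n\<close>, this is the compact-open topology on sections.\<close>

definition compact_open ::
    "'a::topological_space set \<Rightarrow> ('a \<Rightarrow> 'b::topological_space) set \<Rightarrow> ('a \<Rightarrow> 'b) topology" where
  "compact_open X C =
     topology_generated_by {{f \<in> C. f ` K \<subseteq> U} | K U. compact K \<and> K \<subseteq> X \<and> open U}"

definition tangent_vectors :: "(complex^'n) set \<Rightarrow> complex^'n \<Rightarrow> (complex^'n) set" where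
  "tangent_vectors X p = {v. \<exists>\<gamma> r. r > 0 \<and> \<gamma> 0 = p \<and> \<gamma> ` ball 0 r \<subseteq> X \<and>
     (\<forall>i. (\<lambda>t. \<gamma> t $ i) holomorphic_on ball 0 r \<and>
          ((\<lambda>t. \<gamma> t $ i) has_field_derivative v $ i) (at 0))}"

definition vector_fields :: "(complex^'n) set \<Rightarrow> (complex^'n \<Rightarrow> complex^'n) set" where
  "vector_fields X = {V. (\<forall>i. (\<lambda>p. V p $ i) \<in> hol_functions X) \<and>
     (\<forall>p\<in>X. V p \<in> tangent_vectors X p)}"

text \<open>The action of a vector field as a derivation: \<open>V(f)(p) = dF\<^sub>p(V(p))\<close> for any local
  holomorphic extension \<open>F\<close> of \<open>f\<close>. Writing \<open>V(p) = \<gamma>'(0)\<close> with \<open>\<gamma>\<close> in \<open>X\<close>, the value is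
  \<open>(f \<circ> \<gamma>)'(0)\<close>, hence independent of \<open>F\<close>.\<close>

definition apply_field ::
    "(complex^'n) set \<Rightarrow> (complex^'n \<Rightarrow> complex^'n) \<Rightarrow> (complex^'n \<Rightarrow> complex) \<Rightarrow>
     complex^'n \<Rightarrow> complex" where
  "apply_field X V f p = (if p \<in> X then
     THE c. \<exists>U F L. open U \<and> p \<in> U \<and> holomorphic_several F U \<and> (\<forall>x\<in>U \<inter> X. F x = f x) \<and>
       (F has_derivative L) (at p) \<and> c = L (V p)
     else 0)"

text \<open>The bracket is determined by \<open>[V,W](x\<^sub>i) = V(W(x\<^sub>i)) - W(V(x\<^sub>i))\<close> on the coordinate
  functions \<open>x\<^sub>i\<close> of the ambient space, where \<open>W(x\<^sub>i)\<close> is the \<open>i\<close>-th component of \<open>W\<close>.\<close>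

definition lie_bracket ::
    "(complex^'n) set \<Rightarrow> (complex^'n \<Rightarrow> complex^'n) \<Rightarrow> (complex^'n \<Rightarrow> complex^'n) \<Rightarrow>
     complex^'n \<Rightarrow> complex^'n" where
  "lie_bracket X V W p =
     (\<chi> i. apply_field X V (\<lambda>q. W q $ i) p - apply_field X W (\<lambda>q. V q $ i) p)"

definition complete_fields :: "(complex^'n) set \<Rightarrow> (complex^'n \<Rightarrow> complex^'n) set" where
  "complete_fields X = {V \<in> vector_fields X. \<forall>p\<in>X. \<exists>\<gamma>::complex \<Rightarrow> complex^'n.
     \<gamma> 0 = p \<and> (\<forall>t. \<gamma> t \<in> X) \<and>
     (\<forall>t i. ((\<lambda>s. \<gamma> s $ i) has_field_derivative V (\<gamma> t) $ i) (at t))}"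

inductive_set lie_generated ::
    "(complex^'n) set \<Rightarrow> (complex^'n \<Rightarrow> complex^'n) set \<Rightarrow> (complex^'n \<Rightarrow> complex^'n) set"
  for X :: "(complex^'n) set" and S :: "(complex^'n \<Rightarrow> complex^'n) set" where
  base: "V \<in> S \<Longrightarrow> V \<in> lie_generated X S"
| zero: "(\<lambda>p. 0) \<in> lie_generated X S"
| add: "V \<in> lie_generated X S \<Longrightarrow> W \<in> lie_generated X S \<Longrightarrow>
    (\<lambda>p. V p + W p) \<in> lie_generated X S"
| scale: "V \<in> lie_generated X S \<Longrightarrow> (\<lambda>p. c *s V p) \<in> lie_generated X S"
| bracket: "V \<in> lie_generated X S \<Longrightarrow> W \<in> lie_generated X S \<Longrightarrow>
    lie_bracket X V W \<in> lie_generated X S"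

definition density_property :: "(complex^'n) set \<Rightarrow> bool" where
  "density_property X \<longleftrightarrow>
     compact_open X (vector_fields X) closure_of lie_generated X (complete_fields X)
       = vector_fields X"

definition field_kernel ::
    "(complex^'n) set \<Rightarrow> (complex^'n \<Rightarrow> complex^'n) \<Rightarrow> (complex^'n \<Rightarrow> complex) set" where
  "field_kernel X \<theta> = {f \<in> hol_functions X. apply_field X \<theta> f = (\<lambda>p. 0)}"

definition field_kernel2 ::
    "(complex^'n) set \<Rightarrow> (complex^'n \<Rightarrow> complex^'n) \<Rightarrow> (complex^'n \<Rightarrow> complex) set" where
  "field_kernel2 X \<theta> = {f \<in> hol_functions X. apply_field X \<theta> (apply_field X \<theta> f) = (\<lambda>p. 0)}"

definition kernel_products ::
    "(complex^'n) set \<Rightarrow> (complex^'n \<Rightarrow> complex^'n) list \<Rightarrow> (complex^'n \<Rightarrow> complex) set" where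
  "kernel_products X \<theta>s = {(\<lambda>p. \<Prod>i<length \<theta>s. f i p) | f.
     \<forall>i<length \<theta>s. f i \<in> field_kernel X (\<theta>s ! i)}"

text \<open>Uniqueness of the walk to the root excludes loops, cycles and parallel arcs, since each
  of these would yield a second walk.\<close>

definition rooted_in_tree :: "('v, 'e) pre_digraph \<Rightarrow> 'v \<Rightarrow> bool" where
  "rooted_in_tree G r \<longleftrightarrow> fin_digraph G \<and> r \<in> verts G \<and>
     (\<forall>v\<in>verts G. \<exists>!p. pre_digraph.awalk G v p r)"

text \<open>A tuple is a list of distinct fields, so that the bijection onto \<open>{\<theta>\<^sub>1, \<dots>, \<theta>\<^sub>n}\<close> forces
  the tree to have \<open>n\<close> vertices. As the tree is finite, taking its vertices and arcs to be
  natural numbers is no restriction.\<close>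

definition compatible_tuple ::
    "(complex^'n) set \<Rightarrow> (complex^'n \<Rightarrow> complex^'n) list \<Rightarrow> bool" where
  "compatible_tuple X \<theta>s \<longleftrightarrow>
     distinct \<theta>s \<and> set \<theta>s \<subseteq> complete_fields X \<and>
     (\<exists>I. ideal I (hol_ring X) \<and> I \<noteq> {\<lambda>p. 0} \<and>
        I \<subseteq> compact_open X (hol_functions X) closure_of
              module.span (\<lambda>(c::complex) f p. c * f p) (kernel_products X \<theta>s)) \<and>
     (\<exists>(G :: (nat, nat) pre_digraph) r \<pi> \<epsilon>.
        rooted_in_tree G r \<and>
        bij_betw \<pi> (verts G) (set \<theta>s) \<and> \<pi> r = \<theta>s ! 0 \<and>
        (\<forall>e\<in>arcs G. \<epsilon> e \<in> (field_kernel2 X (\<pi> (tail G e)) - field_kernel X (\<pi> (tail G e)))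
                           \<inter> field_kernel X (\<pi> (head G e))))"

text \<open>The coordinates \<open>(z\<^sub>2, z\<^sub>3, w\<^sub>1, w\<^sub>2, w\<^sub>3)\<close> are \<open>p $ 1, \<dots>, p $ 5\<close>. As \<open>(b\<^sub>1, b\<^sub>2) \<noteq> 0\<close> forces
  \<open>(z\<^sub>2, z\<^sub>3) \<noteq> 0\<close>, the two equations have independent differentials along the set, which is
  thus a closed complex submanifold.\<close>

definition variety_G :: "complex \<Rightarrow> complex \<Rightarrow> (complex^5) set" where
  "variety_G b\<^sub>1 b\<^sub>2 = {p.
     (vector [vector [p $ 3, p $ 4], vector [p $ 4, p $ 5]] :: complex^2^2) *v vector [p $ 1, p $ 2]
       = vector [b\<^sub>1, b\<^sub>2]}"

end

theory Submission
  imports Defs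
begin

text \<open>
  Let \<open>b = (b\<^sub>1, b\<^sub>2)\<close> and choose \<open>d\<close> with \<open>det (b, d) = 1\<close>. Since the equations are equivariant under
  \<open>GL\<^sub>2\<close>, the functions \<open>x = \<langle>b, z\<rangle>\<close>, \<open>y = \<langle>d, z\<rangle>\<close>, \<open>s = - det w\<close> and a suitable linear form \<open>a\<close> in \<open>w\<close>
  identify the variety with the hypersurface \<open>x a + s y\<^sup>2 = 1\<close> in \<open>\<complex>\<^sup>4\<close>. On it there are the locally
  nilpotent fields \<open>D1 = x \<partial>\<^sub>y - 2sy \<partial>\<^sub>a\<close>, \<open>D2 = x \<partial>\<^sub>s - y\<^sup>2 \<partial>\<^sub>a\<close>, \<open>D3 = a \<partial>\<^sub>y - 2sy \<partial>\<^sub>x\<close>,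
  \<open>D4 = a \<partial>\<^sub>s - y\<^sup>2 \<partial>\<^sub>x\<close> and the semisimple fields \<open>E1 = x \<partial>\<^sub>x - a \<partial>\<^sub>a\<close>, \<open>E2 = y \<partial>\<^sub>y - 2s \<partial>\<^sub>s\<close>.

  The kernels of \<open>D2\<close> and \<open>D3\<close> contain \<open>\<complex>[x, y]\<close> and \<open>\<complex>[a, s]\<close>, so the products of their elements
  span all polynomials, and \<open>y\<close> serves as the edge function of the star with root \<open>D2\<close> and leaves
  \<open>D3\<close>, \<open>D1\<close>. The brackets \<open>[f D2, h g D3] - [h f D2, g D3] = f g D2(h) D3\<close> for \<open>h = s\<close> and \<open>h = a\<close>
  put all polynomial multiples of \<open>x D3\<close> and \<open>y\<^sup>2 D3\<close> into the Lie algebra, hence those of \<open>D3\<close>, as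
  \<open>1 = a x + s y\<^sup>2\<close>. The fields all of whose polynomial multiples lie in the Lie algebra are stable
  under brackets with its elements that preserve polynomials; this yields in turn \<open>y E1\<close>, \<open>y E2\<close>, \<open>E1\<close>, \<open>E2\<close>, \<open>D2\<close>, \<open>D4\<close>.
  Every vector field is a combination of these fields with holomorphic coefficients.

  It remains to approximate holomorphic functions by polynomials. Cauchy's formula on an annulus
  in the fibre \<open>x a = u\<close> of \<open>(y, s)\<close> represents \<open>f\<close> as a mean of products of Cauchy kernels in \<open>x\<close> or \<open>a\<close>
  and entire functions of \<open>(y, s)\<close>.
\<close>

no_notation fps_nth (infixl \<open>$\<close> 75)

section \<open>Holomorphic functions and derivations on a subset of affine space\<close>

text \<open>The extension condition of \<open>hol_functions\<close> without the convention of
  vanishing off \<open>X\<close>, so that coordinates and polynomials on the ambient space qualify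
  as they stand.\<close>

definition locally_holomorphic :: "(complex^'n) set \<Rightarrow> (complex^'n \<Rightarrow> complex) \<Rightarrow> bool" where
  "locally_holomorphic X f \<longleftrightarrow>
     (\<forall>p\<in>X. \<exists>U F. open U \<and> p \<in> U \<and> holomorphic_several F U \<and> (\<forall>x\<in>U \<inter> X. F x = f x))"

text \<open>The relation under the definite description in \<open>apply_field\<close>, for an
  arbitrary vector \<open>v\<close>. As a relation it obeys the sum and product rules for every
  \<open>v\<close>; tangency of \<open>v\<close> enters only in the uniqueness of the value.\<close>

definition derivative_along ::
    "(complex^'n) set \<Rightarrow> (complex^'n \<Rightarrow> complex) \<Rightarrow> complex^'n \<Rightarrow> complex^'n \<Rightarrow> complex \<Rightarrow> bool" where
  "derivative_along X f p v c \<longleftrightarrow>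
     (\<exists>U F L. open U \<and> p \<in> U \<and> holomorphic_several F U \<and> (\<forall>x\<in>U \<inter> X. F x = f x) \<and>
       (F has_derivative L) (at p) \<and> c = L v)"

definition scale_field :: "(complex^'n \<Rightarrow> complex) \<Rightarrow> (complex^'n \<Rightarrow> complex^'n) \<Rightarrow> complex^'n \<Rightarrow> complex^'n" where
  "scale_field f V = (\<lambda>p. f p *s V p)"

lemma hol_functions_iff:
  "f \<in> hol_functions X \<longleftrightarrow> (\<forall>p. p \<notin> X \<longrightarrow> f p = 0) \<and> locally_holomorphic X f"
  by (simp add: hol_functions_def locally_holomorphic_def)

lemma holomorphic_several_add:
  assumes "holomorphic_several F U" "holomorphic_several G U"
  shows "holomorphic_several (\<lambda>x. F x + G x) U"
  unfolding holomorphic_several_def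
proof
  fix p assume "p \<in> U"
  then obtain L M where "(F has_derivative L) (at p)" "\<forall>c v. L (c *s v) = c * L v"
    "(G has_derivative M) (at p)" "\<forall>c v. M (c *s v) = c * M v"
    using assms unfolding holomorphic_several_def by meson
  then show "\<exists>L. ((\<lambda>x. F x + G x) has_derivative L) (at p) \<and> (\<forall>c v. L (c *s v) = c * L v)"
    by (intro exI[of _ "\<lambda>v. L v + M v"]) (auto intro!: derivative_eq_intros simp: algebra_simps)
qed

lemma holomorphic_several_mult:
  assumes "holomorphic_several F U" "holomorphic_several G U"
  shows "holomorphic_several (\<lambda>x. F x * G x) U"
  unfolding holomorphic_several_def
proof
  fix p assume "p \<in> U"
  then obtain L M where "(F has_derivative L) (at p)" "\<forall>c v. L (c *s v) = c * L v"
    "(G has_derivative M) (at p)" "\<forall>c v. M (c *s v) = c * M v"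
    using assms unfolding holomorphic_several_def by meson
  then show "\<exists>L. ((\<lambda>x. F x * G x) has_derivative L) (at p) \<and> (\<forall>c v. L (c *s v) = c * L v)"
    by (intro exI[of _ "\<lambda>v. F p * M v + L v * G p"]) (auto intro!: derivative_eq_intros simp: algebra_simps)
qed

lemma holomorphic_several_const: "holomorphic_several (\<lambda>x. c) U"
  unfolding holomorphic_several_def by (auto intro!: exI[of _ "\<lambda>v. 0"])

lemma has_derivative_component: "((\<lambda>x::complex^'n. x $ i) has_derivative (\<lambda>v. v $ i)) (at p)"
  by (rule bounded_linear_imp_has_derivative) (rule bounded_linear_vec_nth)

lemma holomorphic_several_component: "holomorphic_several (\<lambda>x. x $ i) U"
  unfolding holomorphic_several_def
  using has_derivative_component by (auto intro!: exI[of _ "\<lambda>v. v $ i"])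

lemma holomorphic_several_subset:
  "holomorphic_several F U \<Longrightarrow> V \<subseteq> U \<Longrightarrow> holomorphic_several F V"
  by (auto simp: holomorphic_several_def)

lemma derivative_along_const: "derivative_along X (\<lambda>x. c) p v 0"
  unfolding derivative_along_def
  by (rule exI[of _ UNIV], rule exI[of _ "\<lambda>x. c"], rule exI[of _ "\<lambda>x. 0"])
     (auto simp: holomorphic_several_const)

lemma derivative_along_component: "derivative_along X (\<lambda>x. x $ i) p v (v $ i)"
  unfolding derivative_along_def
  by (rule exI[of _ UNIV], rule exI[of _ "\<lambda>x. x $ i"], rule exI[of _ "\<lambda>x. x $ i"])
     (auto simp: holomorphic_several_component has_derivative_component)

lemma derivative_along_add:
  assumes "derivative_along X f p v c" "derivative_along X g p v d"
  shows "derivative_along X (\<lambda>x. f x + g x) p v (c + d)"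
proof -
  obtain U F L where 1: "open U" "p \<in> U" "holomorphic_several F U" "\<forall>x\<in>U \<inter> X. F x = f x"
    "(F has_derivative L) (at p)" "c = L v"
    using assms(1) unfolding derivative_along_def by blast
  obtain V G M where 2: "open V" "p \<in> V" "holomorphic_several G V" "\<forall>x\<in>V \<inter> X. G x = g x"
    "(G has_derivative M) (at p)" "d = M v"
    using assms(2) unfolding derivative_along_def by blast
  have "holomorphic_several F (U \<inter> V)" "holomorphic_several G (U \<inter> V)"
    using 1 2 holomorphic_several_subset by blast+
  then have "holomorphic_several (\<lambda>x. F x + G x) (U \<inter> V)"
    by (rule holomorphic_several_add)
  then show ?thesis unfolding derivative_along_def
    using 1 2 by (intro exI[of _ "U \<inter> V"] exI[of _ "\<lambda>x. F x + G x"] exI[of _ "\<lambda>v. L v + M v"])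
      (auto intro!: derivative_eq_intros)
qed

lemma derivative_along_mult:
  assumes "derivative_along X f p v c" "derivative_along X g p v d" "p \<in> X"
  shows "derivative_along X (\<lambda>x. f x * g x) p v (f p * d + c * g p)"
proof -
  obtain U F L where 1: "open U" "p \<in> U" "holomorphic_several F U" "\<forall>x\<in>U \<inter> X. F x = f x"
    "(F has_derivative L) (at p)" "c = L v"
    using assms(1) unfolding derivative_along_def by blast
  obtain V G M where 2: "open V" "p \<in> V" "holomorphic_several G V" "\<forall>x\<in>V \<inter> X. G x = g x"
    "(G has_derivative M) (at p)" "d = M v"
    using assms(2) unfolding derivative_along_def by blast
  have "holomorphic_several F (U \<inter> V)" "holomorphic_several G (U \<inter> V)"
    using 1 2 holomorphic_several_subset by blast+
  then have "holomorphic_several (\<lambda>x. F x * G x) (U \<inter> V)"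
    by (rule holomorphic_several_mult)
  then show ?thesis unfolding derivative_along_def
    using 1 2 assms(3)
    by (intro exI[of _ "U \<inter> V"] exI[of _ "\<lambda>x. F x * G x"] exI[of _ "\<lambda>v. F p * M v + L v * G p"])
      (auto intro!: derivative_eq_intros)
qed

lemma derivative_along_cmult:
  assumes "derivative_along X f p v c" "p \<in> X"
  shows "derivative_along X (\<lambda>x. k * f x) p v (k * c)"
  using derivative_along_mult[OF derivative_along_const assms] by simp

lemma derivative_along_uminus:
  assumes "derivative_along X f p v c" "p \<in> X"
  shows "derivative_along X (\<lambda>x. - f x) p v (- c)"
  using derivative_along_cmult[OF assms, of "-1"] by simp

lemma derivative_along_diff:
  assumes "derivative_along X f p v c" "derivative_along X g p v d" "p \<in> X"
  shows "derivative_along X (\<lambda>x. f x - g x) p v (c - d)"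
  using derivative_along_add[OF assms(1) derivative_along_uminus[OF assms(2,3)]] by simp

lemma derivative_along_power:
  assumes "derivative_along X f p v c" "p \<in> X"
  shows "derivative_along X (\<lambda>x. f x ^ n) p v (of_nat n * f p ^ (n - 1) * c)"
proof (induction n)
  case 0
  then show ?case using derivative_along_const[of X 1] by simp
next
  case (Suc n)
  have "f p * (of_nat n * f p ^ (n - 1) * c) + c * f p ^ n = of_nat (Suc n) * f p ^ (Suc n - 1) * c"
    by (cases n) (simp_all add: algebra_simps)
  then show ?case
    using derivative_along_mult[OF assms(1) Suc assms(2)] by simp
qed

lemma derivative_along_cong:
  assumes "derivative_along X f p v c" "\<And>x. x \<in> X \<Longrightarrow> f x = g x"
  shows "derivative_along X g p v c"
  using assms unfolding derivative_along_def by (metis Int_iff)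

text \<open>Lets the differentiation rules build up the value \<open>c\<close> first and leaves its
  comparison with the intended \<open>d\<close> as a final algebraic goal.\<close>

lemma derivative_along_eq:
  assumes "derivative_along X f p v c" "c = d"
  shows "derivative_along X f p v d"
  using assms by simp

lemma locally_holomorphic_derivative:
  assumes "locally_holomorphic X f" "p \<in> X"
  obtains L where "bounded_linear L" "\<And>c v. L (c *s v) = c * L v" "\<And>v. derivative_along X f p v (L v)"
proof -
  obtain U F where U: "open U" "p \<in> U" "holomorphic_several F U" "\<forall>x\<in>U \<inter> X. F x = f x"
    using assms unfolding locally_holomorphic_def by blast
  then obtain L where L: "(F has_derivative L) (at p)" "\<And>c v. L (c *s v) = c * L v"
    unfolding holomorphic_several_def by blast
  have "derivative_along X f p v (L v)" for v
    unfolding derivative_along_def using U L by blast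
  then show ?thesis
    using that L has_derivative_bounded_linear by blast
qed

lemma derivative_along_exists:
  assumes "locally_holomorphic X f" "p \<in> X"
  obtains c where "derivative_along X f p v c"
  using locally_holomorphic_derivative[OF assms] by metis

lemma locally_holomorphic_const: "locally_holomorphic X (\<lambda>x. c)"
  unfolding locally_holomorphic_def using holomorphic_several_const open_UNIV by blast

lemma locally_holomorphic_component: "locally_holomorphic X (\<lambda>x. x $ i)"
  unfolding locally_holomorphic_def using holomorphic_several_component open_UNIV by blast

lemma locally_holomorphic_add:
  assumes "locally_holomorphic X f" "locally_holomorphic X g"
  shows "locally_holomorphic X (\<lambda>x. f x + g x)"
  unfolding locally_holomorphic_def
proof
  fix p assume "p \<in> X"
  then obtain U F V G where "open U" "p \<in> U" "holomorphic_several F U" "\<forall>x\<in>U \<inter> X. F x = f x"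
    and "open V" "p \<in> V" "holomorphic_several G V" "\<forall>x\<in>V \<inter> X. G x = g x"
    using assms unfolding locally_holomorphic_def by metis
  then show "\<exists>U F. open U \<and> p \<in> U \<and> holomorphic_several F U \<and> (\<forall>x\<in>U \<inter> X. F x = f x + g x)"
    by (intro exI[of _ "U \<inter> V"] exI[of _ "\<lambda>x. F x + G x"])
      (auto intro!: holomorphic_several_add intro: holomorphic_several_subset)
qed

lemma locally_holomorphic_mult:
  assumes "locally_holomorphic X f" "locally_holomorphic X g"
  shows "locally_holomorphic X (\<lambda>x. f x * g x)"
  unfolding locally_holomorphic_def
proof
  fix p assume "p \<in> X"
  then obtain U F V G where "open U" "p \<in> U" "holomorphic_several F U" "\<forall>x\<in>U \<inter> X. F x = f x"
    and "open V" "p \<in> V" "holomorphic_several G V" "\<forall>x\<in>V \<inter> X. G x = g x"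
    using assms unfolding locally_holomorphic_def by metis
  then show "\<exists>U F. open U \<and> p \<in> U \<and> holomorphic_several F U \<and> (\<forall>x\<in>U \<inter> X. F x = f x * g x)"
    by (intro exI[of _ "U \<inter> V"] exI[of _ "\<lambda>x. F x * G x"])
      (auto intro!: holomorphic_several_mult intro: holomorphic_several_subset)
qed

lemma locally_holomorphic_uminus:
  "locally_holomorphic X f \<Longrightarrow> locally_holomorphic X (\<lambda>x. - f x)"
  using locally_holomorphic_mult[OF locally_holomorphic_const[of X "-1"]] by simp

lemma locally_holomorphic_diff:
  "locally_holomorphic X f \<Longrightarrow> locally_holomorphic X g \<Longrightarrow> locally_holomorphic X (\<lambda>x. f x - g x)"
  using locally_holomorphic_add[OF _ locally_holomorphic_uminus] by simp

lemma locally_holomorphic_power: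
  "locally_holomorphic X f \<Longrightarrow> locally_holomorphic X (\<lambda>x. f x ^ n)"
proof (induction n)
  case 0
  then show ?case using locally_holomorphic_const[of X 1] by simp
next
  case (Suc n)
  then show ?case using locally_holomorphic_mult[of X f "\<lambda>x. f x ^ n"] by simp
qed

lemma locally_holomorphic_cong:
  "locally_holomorphic X f \<Longrightarrow> (\<And>x. x \<in> X \<Longrightarrow> f x = g x) \<Longrightarrow> locally_holomorphic X g"
  unfolding locally_holomorphic_def by (metis Int_iff)

lemmas locally_holomorphic_intros = locally_holomorphic_const locally_holomorphic_component
  locally_holomorphic_add locally_holomorphic_mult locally_holomorphic_uminus
  locally_holomorphic_diff locally_holomorphic_power

lemma locally_holomorphic_continuous_on:
  assumes "locally_holomorphic X f"
  shows "continuous_on X f"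
  unfolding continuous_on_eq_continuous_within
proof
  fix p assume p: "p \<in> X"
  obtain U F where U: "open U" "p \<in> U" "holomorphic_several F U" "\<forall>x\<in>U \<inter> X. F x = f x"
    using assms p unfolding locally_holomorphic_def by blast
  then have "isCont F p"
    unfolding holomorphic_several_def using has_derivative_continuous by blast
  then have "continuous (at p within X) F"
    using continuous_at_imp_continuous_at_within by blast
  moreover have "eventually (\<lambda>x. F x = f x) (at p within X)"
    using U unfolding eventually_at_topological by blast
  moreover have "F p = f p" using U p by blast
  ultimately show "continuous (at p within X) f"
    unfolding continuous_within using Lim_transform_eventually by fastforce
qed

section \<open>Composition with holomorphic curves\<close>

lemma has_derivative_curve:
  fixes \<gamma> :: "complex \<Rightarrow> complex^'n"
  assumes "\<And>i. ((\<lambda>t. \<gamma> t $ i) has_field_derivative v $ i) (at t)"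
  shows "(\<gamma> has_derivative (\<lambda>h. h *s v)) (at t)"
  unfolding has_derivative_def
proof
  show "bounded_linear (\<lambda>h::complex. h *s v)"
    by (intro linear_conv_bounded_linear[THEN iffD1] linearI) (simp_all add: vec_eq_iff algebra_simps)
  show "((\<lambda>y. ((\<gamma> y - \<gamma> (Lim (at t) (\<lambda>x. x))) - (y - Lim (at t) (\<lambda>x. x)) *s v) /\<^sub>R
      norm (y - Lim (at t) (\<lambda>x. x))) \<longlongrightarrow> 0) (at t)"
  proof (rule vec_tendstoI)
    fix i
    show "((\<lambda>y. (((\<gamma> y - \<gamma> (Lim (at t) (\<lambda>x. x))) - (y - Lim (at t) (\<lambda>x. x)) *s v) /\<^sub>R
      norm (y - Lim (at t) (\<lambda>x. x))) $ i) \<longlongrightarrow> 0 $ i) (at t)"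
      using assms[of i] unfolding has_field_derivative_def has_derivative_def
      by (simp add: algebra_simps)
  qed
qed

lemma continuous_on_components:
  fixes \<gamma> :: "'a::topological_space \<Rightarrow> complex^'n"
  assumes "\<And>i. continuous_on S (\<lambda>t. \<gamma> t $ i)"
  shows "continuous_on S \<gamma>"
  using continuous_on_vec_lambda[of S "\<lambda>i t. \<gamma> t $ i"] assms by simp

text \<open>The chain rule along a curve in \<open>X\<close> is what makes the local extensions irrelevant.\<close>

lemma derivative_along_curve:
  fixes \<gamma> :: "complex \<Rightarrow> complex^'n"
  assumes "derivative_along X f (\<gamma> t) v c" "open S" "t \<in> S" "\<gamma> ` S \<subseteq> X"
    and \<gamma>: "\<And>i. ((\<lambda>t. \<gamma> t $ i) has_field_derivative v $ i) (at t)"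
    and cont: "continuous_on S \<gamma>"
  shows "((\<lambda>t. f (\<gamma> t)) has_field_derivative c) (at t)"
proof -
  obtain U F L where U: "open U" "\<gamma> t \<in> U" "holomorphic_several F U" "\<forall>x\<in>U \<inter> X. F x = f x"
    and L: "(F has_derivative L) (at (\<gamma> t))" "c = L v"
    using assms(1) unfolding derivative_along_def by blast
  \<comment> \<open>\<open>L\<close> is given only as a real derivative; its complex homogeneity is
    borrowed from the derivative \<open>M\<close> granted by
    \<open>holomorphic_several\<close>.\<close>
  obtain M where M: "(F has_derivative M) (at (\<gamma> t))" "\<forall>c v. M (c *s v) = c * M v"
    using U unfolding holomorphic_several_def by meson
  have "L = M" using L(1) M(1) by (rule has_derivative_unique)
  have "(F \<circ> \<gamma> has_derivative L \<circ> (\<lambda>h. h *s v)) (at t)"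
    using has_derivative_curve[OF \<gamma>] L by (intro diff_chain_at) auto
  moreover have "L \<circ> (\<lambda>h. h *s v) = (*) c"
    using M(2) L(2) \<open>L = M\<close> by (simp add: fun_eq_iff mult.commute)
  ultimately have D: "(F \<circ> \<gamma> has_field_derivative c) (at t)"
    unfolding has_field_derivative_def by simp
  show ?thesis
  proof (rule has_field_derivative_transform_within_open[OF D])
    show "open (S \<inter> \<gamma> -` U)"
      using cont assms(2) U(1) by (rule continuous_open_preimage)
    show "t \<in> S \<inter> \<gamma> -` U" using assms(3) U(2) by simp
    show "(F \<circ> \<gamma>) s = f (\<gamma> s)" if "s \<in> S \<inter> \<gamma> -` U" for s
      using that U(4) assms(4) by auto
  qed
qed

lemma holomorphic_on_curve:
  fixes \<gamma> :: "complex \<Rightarrow> complex^'n"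
  assumes "locally_holomorphic X f" "open S" "\<gamma> ` S \<subseteq> X"
    and "\<And>i. (\<lambda>t. \<gamma> t $ i) holomorphic_on S"
  shows "(\<lambda>t. f (\<gamma> t)) holomorphic_on S"
proof -
  have cont: "continuous_on S \<gamma>"
    using holomorphic_on_imp_continuous_on[OF assms(4)] by (rule continuous_on_components)
  have "(\<lambda>t. f (\<gamma> t)) field_differentiable at t" if t: "t \<in> S" for t
  proof -
    define v where "v = (\<chi> i. deriv (\<lambda>t. \<gamma> t $ i) t)"
    have v: "((\<lambda>t. \<gamma> t $ i) has_field_derivative v $ i) (at t)" for i
      using holomorphic_derivI[OF assms(4,2) t] by (simp add: v_def)
    have "\<gamma> t \<in> X" using t assms(3) by blast
    with assms(1) obtain c where "derivative_along X f (\<gamma> t) v c"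
      by (rule derivative_along_exists)
    then have "((\<lambda>t. f (\<gamma> t)) has_field_derivative c) (at t)"
      using assms(2) t assms(3) v cont by (rule derivative_along_curve)
    then show ?thesis unfolding field_differentiable_def by blast
  qed
  then show ?thesis
    unfolding holomorphic_on_def by (simp add: field_differentiable_at_within)
qed

text \<open>A tangent vector is the velocity of a curve in \<open>X\<close>, and by the chain rule
  both values are the derivative at \<open>0\<close> of \<open>f\<close> along this curve.\<close>

lemma derivative_along_unique:
  fixes p :: "complex^'n"
  assumes "v \<in> tangent_vectors X p" "derivative_along X f p v c" "derivative_along X f p v d"
  shows "c = d"
proof -
  obtain \<gamma> :: "complex \<Rightarrow> complex^'n" and r where r: "r > 0" "\<gamma> 0 = p" "\<gamma> ` ball 0 r \<subseteq> X"
    and \<gamma>: "\<And>i. (\<lambda>t. \<gamma> t $ i) holomorphic_on ball 0 r"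
      "\<And>i. ((\<lambda>t. \<gamma> t $ i) has_field_derivative v $ i) (at 0)"
    using assms(1) unfolding tangent_vectors_def by blast
  have "continuous_on (ball 0 r) \<gamma>"
    using holomorphic_on_imp_continuous_on[OF \<gamma>(1)] by (rule continuous_on_components)
  then have "((\<lambda>t. f (\<gamma> t)) has_field_derivative c) (at 0)" "((\<lambda>t. f (\<gamma> t)) has_field_derivative d) (at 0)"
    using derivative_along_curve[of X f \<gamma> 0 v _ "ball 0 r"] assms(2,3) r \<gamma>(2) by auto
  then show ?thesis using DERIV_unique by blast
qed

section \<open>Vector fields as derivations\<close>

lemma apply_field_eq:
  assumes "derivative_along X f p (V p) c" "V p \<in> tangent_vectors X p" "p \<in> X"
  shows "apply_field X V f p = c"
proof -
  have "apply_field X V f p = (THE c. derivative_along X f p (V p) c)"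
    unfolding apply_field_def derivative_along_def using assms(3) by simp
  also have "\<dots> = c"
    using assms derivative_along_unique by (intro the_equality) blast+
  finally show ?thesis .
qed

lemma apply_field_outside: "p \<notin> X \<Longrightarrow> apply_field X V f p = 0"
  by (simp add: apply_field_def)

lemma derivative_along_apply_field:
  assumes "locally_holomorphic X f" "V \<in> vector_fields X" "p \<in> X"
  shows "derivative_along X f p (V p) (apply_field X V f p)"
proof -
  have V: "V p \<in> tangent_vectors X p"
    using assms(2,3) unfolding vector_fields_def by simp
  obtain c where c: "derivative_along X f p (V p) c"
    using assms(1,3) by (rule derivative_along_exists)
  show ?thesis
    unfolding apply_field_eq[where V=V, OF c V assms(3)] by (rule c)
qed

lemma derivative_along_scale:
  assumes "derivative_along X f p v c"
  shows "derivative_along X f p (k *s v) (k * c)"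
proof -
  obtain U F L where U: "open U" "p \<in> U" "holomorphic_several F U" "\<forall>x\<in>U \<inter> X. F x = f x"
    and L: "(F has_derivative L) (at p)" "c = L v"
    using assms unfolding derivative_along_def by blast
  obtain M where M: "(F has_derivative M) (at p)" "\<forall>c v. M (c *s v) = c * M v"
    using U unfolding holomorphic_several_def by meson
  have "L = M" using L(1) M(1) by (rule has_derivative_unique)
  then have "L (k *s v) = k * c" using L(2) M(2) by simp
  then show ?thesis unfolding derivative_along_def using U L by metis
qed

text \<open>For nonzero \<open>c\<close> the curve is run through at speed \<open>c\<close>, on a
  disc of radius \<open>r / norm c\<close>; for \<open>c = 0\<close> a constant curve
  serves.\<close>

lemma tangent_vectors_scale:
  fixes p :: "complex^'n"
  assumes "v \<in> tangent_vectors X p" "p \<in> X"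
  shows "c *s v \<in> tangent_vectors X p"
proof (cases "c = 0")
  case True
  then show ?thesis using assms unfolding tangent_vectors_def
    by (auto intro!: exI[of _ "\<lambda>t. p"] exI[of _ "1::real"])
next
  case False
  obtain \<gamma> :: "complex \<Rightarrow> complex^'n" and r where r: "r > 0" "\<gamma> 0 = p" "\<gamma> ` ball 0 r \<subseteq> X"
    and \<gamma>: "\<And>i. (\<lambda>t. \<gamma> t $ i) holomorphic_on ball 0 r"
      "\<And>i. ((\<lambda>t. \<gamma> t $ i) has_field_derivative v $ i) (at 0)"
    using assms(1) unfolding tangent_vectors_def by blast
  have sub: "(\<lambda>t. c * t) ` ball 0 (r / norm c) \<subseteq> ball 0 r"
    using False by (auto simp: norm_mult field_simps)
  have "(\<lambda>t. \<gamma> (c * t) $ i) holomorphic_on ball 0 (r / norm c)" for i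
    using holomorphic_on_compose_gen[OF _ \<gamma>(1) sub] by (auto simp: o_def intro!: holomorphic_intros)
  moreover have "((\<lambda>t. \<gamma> (c * t) $ i) has_field_derivative (c *s v) $ i) (at 0)" for i
  proof -
    have "((\<lambda>t. c * t) has_field_derivative c) (at 0)"
      by (auto intro!: derivative_eq_intros)
    then show ?thesis
      using DERIV_chain2[of "\<lambda>t. \<gamma> t $ i" "v $ i" "\<lambda>t. c * t" 0 c UNIV] \<gamma>(2)[of i]
      by (simp add: mult.commute)
  qed
  moreover have "(\<lambda>t. \<gamma> (c * t)) ` ball 0 (r / norm c) \<subseteq> X"
    using sub r(3) by (auto simp: image_subset_iff)
  ultimately show ?thesis unfolding tangent_vectors_def
    using r False by (auto intro!: exI[of _ "\<lambda>t. \<gamma> (c * t)"] exI[of _ "r / norm c"])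
qed

lemma vector_fields_component:
  fixes V :: "complex^'n \<Rightarrow> complex^'n"
  assumes "V \<in> vector_fields X"
  shows "locally_holomorphic X (\<lambda>p. V p $ i)"
  using assms unfolding vector_fields_def by (auto simp: hol_functions_iff)

lemma vector_fields_outside:
  assumes "V \<in> vector_fields X" "p \<notin> X"
  shows "V p = 0"
  using assms unfolding vector_fields_def by (auto simp: hol_functions_iff vec_eq_iff)

lemma vector_fields_tangent: "V \<in> vector_fields X \<Longrightarrow> p \<in> X \<Longrightarrow> V p \<in> tangent_vectors X p"
  unfolding vector_fields_def by auto

lemma scale_field_in_vector_fields:
  assumes "locally_holomorphic X f" "V \<in> vector_fields X"
  shows "scale_field f V \<in> vector_fields X"
  unfolding vector_fields_def
proof (intro CollectI conjI allI ballI)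
  fix i
  show "(\<lambda>p. scale_field f V p $ i) \<in> hol_functions X"
    using locally_holomorphic_mult[OF assms(1) vector_fields_component[OF assms(2), of i]]
      vector_fields_outside[OF assms(2)]
    by (simp add: hol_functions_iff scale_field_def)
next
  fix p assume "p \<in> X"
  then show "scale_field f V p \<in> tangent_vectors X p"
    using vector_fields_tangent[OF assms(2)] by (simp add: scale_field_def tangent_vectors_scale)
qed

lemma apply_field_scale_field:
  assumes "locally_holomorphic X g" "V \<in> vector_fields X" "p \<in> X"
  shows "apply_field X (scale_field f V) g p = f p * apply_field X V g p"
proof -
  have "derivative_along X g p (scale_field f V p) (f p * apply_field X V g p)"
    unfolding scale_field_def by (rule derivative_along_scale[OF derivative_along_apply_field[OF assms]])
  moreover have "scale_field f V p \<in> tangent_vectors X p"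
    unfolding scale_field_def by (rule tangent_vectors_scale[OF vector_fields_tangent[OF assms(2,3)] assms(3)])
  ultimately show ?thesis
    using assms(3) by (rule apply_field_eq)
qed

lemma apply_field_mult:
  assumes "locally_holomorphic X f" "locally_holomorphic X g" "V \<in> vector_fields X" "p \<in> X"
  shows "apply_field X V (\<lambda>x. f x * g x) p = f p * apply_field X V g p + apply_field X V f p * g p"
  by (rule apply_field_eq[where V=V, OF derivative_along_mult[OF derivative_along_apply_field
      derivative_along_apply_field] vector_fields_tangent]) (use assms in blast)+

lemma scale_field_component: "scale_field f V p $ i = f p * V p $ i"
  by (simp add: scale_field_def)

text \<open>The Leibniz rule for the bracket, from which the later bracket identities with function
  coefficients are derived. Off \<open>X\<close> both sides vanish because
  \<open>apply_field\<close> does.\<close>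

lemma lie_bracket_scale_field:
  fixes V W :: "complex^'n \<Rightarrow> complex^'n"
  assumes "locally_holomorphic X f" "locally_holomorphic X g"
    and V: "V \<in> vector_fields X" and W: "W \<in> vector_fields X"
  shows "lie_bracket X (scale_field f V) (scale_field g W) =
    (\<lambda>p. (f p * apply_field X V g p) *s W p - (g p * apply_field X W f p) *s V p
       + (f p * g p) *s lie_bracket X V W p)"
proof
  fix p
  show "lie_bracket X (scale_field f V) (scale_field g W) p =
    (f p * apply_field X V g p) *s W p - (g p * apply_field X W f p) *s V p
       + (f p * g p) *s lie_bracket X V W p"
  proof (cases "p \<in> X")
    case True
    have 1: "apply_field X (scale_field f V) (\<lambda>q. g q * W q $ i) p =
        f p * (g p * apply_field X V (\<lambda>q. W q $ i) p + apply_field X V g p * W p $ i)" for i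
      unfolding apply_field_scale_field[OF locally_holomorphic_mult[OF assms(2) vector_fields_component[OF W]] V True]
        apply_field_mult[OF assms(2) vector_fields_component[OF W] V True] ..
    have 2: "apply_field X (scale_field g W) (\<lambda>q. f q * V q $ i) p =
        g p * (f p * apply_field X W (\<lambda>q. V q $ i) p + apply_field X W f p * V p $ i)" for i
      unfolding apply_field_scale_field[OF locally_holomorphic_mult[OF assms(1) vector_fields_component[OF V]] W True]
        apply_field_mult[OF assms(1) vector_fields_component[OF V] W True] ..
    show ?thesis
    proof (rule vec_eq_iff[THEN iffD2], rule allI)
      fix i :: 'n
      have "f p * (g p * A + B * w) - g p * (f p * C + D * v)
          = f p * B * w - g p * D * v + f p * g p * (A - C)" for A B C D v w
        by (simp add: algebra_simps)
      with 1[of i] 2[of i]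
      show "lie_bracket X (scale_field f V) (scale_field g W) p $ i =
          ((f p * apply_field X V g p) *s W p - (g p * apply_field X W f p) *s V p
             + (f p * g p) *s lie_bracket X V W p) $ i"
        by (simp only: lie_bracket_def vec_lambda_beta vector_add_component vector_minus_component
            vector_smult_component scale_field_component)
    qed
  next
    case False
    then show ?thesis
      by (simp add: lie_bracket_def apply_field_outside vec_eq_iff)
  qed
qed

section \<open>Uniform approximation on compact sets\<close>

lemma topspace_compact_open: "topspace (compact_open X C) = C"
proof -
  \<comment> \<open>The empty compact set makes \<open>C\<close> itself one of the generating
    sets.\<close>
  have "C \<in> {{f \<in> C. f ` K \<subseteq> U} | K U. compact K \<and> K \<subseteq> X \<and> open U}"
    by (rule CollectI, rule exI[of _ "{}"], rule exI[of _ UNIV]) auto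
  then show ?thesis
    unfolding compact_open_def topology_generated_by_topspace by blast
qed

text \<open>Induction over the generation of the open set. For a generating set, the image of
  \<open>K\<close> under \<open>V\<close> is compact in \<open>U\<close>, hence has a uniform
  margin; for an intersection, the compact sets are united and the smaller radius is taken.\<close>

lemma openin_compact_open_imp_uniform:
  fixes V :: "'a::t2_space \<Rightarrow> 'b::metric_space"
  assumes "openin (compact_open X C) T" "V \<in> T" "continuous_on X V"
  shows "\<exists>K e. compact K \<and> K \<subseteq> X \<and> e > 0 \<and> (\<forall>W\<in>C. (\<forall>p\<in>K. dist (W p) (V p) < e) \<longrightarrow> W \<in> T)"
proof -
  have "generate_topology_on {{f \<in> C. f ` K \<subseteq> U} | K U. compact K \<and> K \<subseteq> X \<and> open U} T"
    using assms(1) unfolding compact_open_def by (rule openin_topology_generated_by)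
  then show ?thesis
    using assms(2)
  proof induction
    case Empty
    then show ?case by simp
  next
    case (Int A B)
    obtain K e where A: "compact K" "K \<subseteq> X" "e > 0" "\<forall>W\<in>C. (\<forall>p\<in>K. dist (W p) (V p) < e) \<longrightarrow> W \<in> A"
      using Int by blast
    obtain L d where B: "compact L" "L \<subseteq> X" "d > 0" "\<forall>W\<in>C. (\<forall>p\<in>L. dist (W p) (V p) < d) \<longrightarrow> W \<in> B"
      using Int by blast
    show ?case
      using A B by (intro exI[of _ "K \<union> L"] exI[of _ "min e d"]) auto
  next
    case (UN \<K>)
    then obtain k where "k \<in> \<K>" "V \<in> k" by blast
    with UN.IH[of k] show ?case by blast
  next
    case (Basis s)
    then obtain K U where s: "s = {f \<in> C. f ` K \<subseteq> U}" "compact K" "K \<subseteq> X" "open U"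
      by blast
    have "compact (V ` K)"
      using s assms(3) by (intro compact_continuous_image) (auto intro: continuous_on_subset)
    then obtain e where e: "e > 0" "(\<Union>x\<in>V ` K. ball x e) \<subseteq> U"
      using s Basis.prems by (auto elim: compact_subset_open_imp_ball_epsilon_subset[of "V ` K" U])
    have "W \<in> s" if "W \<in> C" "\<forall>p\<in>K. dist (W p) (V p) < e" for W
      using that s e by (force simp: dist_commute)
    then show ?case using s e by blast
  qed
qed

text \<open>Reduces membership in the closure to uniform approximation on compact sets, the form in
  which both density statements below are proved.\<close>

lemma in_closure_compact_open:
  fixes V :: "'a::t2_space \<Rightarrow> 'b::metric_space"
  assumes "V \<in> C" "continuous_on X V"
    and "\<And>K e. compact K \<Longrightarrow> K \<subseteq> X \<Longrightarrow> e > 0 \<Longrightarrow> \<exists>W\<in>S \<inter> C. \<forall>p\<in>K. dist (W p) (V p) < e"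
  shows "V \<in> compact_open X C closure_of S"
  unfolding in_closure_of topspace_compact_open
proof (intro conjI allI impI)
  fix T assume "V \<in> T \<and> openin (compact_open X C) T"
  then obtain K e where "compact K" "K \<subseteq> X" "e > 0"
    and *: "\<forall>W\<in>C. (\<forall>p\<in>K. dist (W p) (V p) < e) \<longrightarrow> W \<in> T"
    using openin_compact_open_imp_uniform[OF _ _ assms(2)] by meson
  then obtain W where "W \<in> S \<inter> C" "\<forall>p\<in>K. dist (W p) (V p) < e"
    using assms(3) by meson
  then show "\<exists>y. y \<in> S \<and> y \<in> T" using * by blast
qed (rule assms(1))

section \<open>Cauchy integrals over circles, written as means\<close>

lemma circlepath_nonzero: "\<rho> > 0 \<Longrightarrow> circlepath 0 \<rho> t \<noteq> 0"
  by (simp add: circlepath)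

lemma norm_circlepath: "\<rho> > 0 \<Longrightarrow> norm (circlepath 0 \<rho> t) = \<rho>"
  by (simp add: circlepath norm_mult)

lemma continuous_on_circlepath [continuous_intros]:
  "continuous_on S f \<Longrightarrow> continuous_on S (\<lambda>x. circlepath z \<rho> (f x))"
  unfolding circlepath by (intro continuous_intros)

text \<open>On the circle, \<open>du = 2 * pi * \<i> * u * dt\<close>; substituting this in Cauchy's
  formula cancels the constant and leaves the kernel \<open>u / (u - w)\<close>.\<close>

lemma has_integral_Cauchy_circle:
  assumes "f holomorphic_on UNIV" "norm w < \<rho>"
  shows "((\<lambda>t. f (circlepath 0 \<rho> t) * (circlepath 0 \<rho> t / (circlepath 0 \<rho> t - w))) has_integral f w) {0..1}"
proof -
  have "((\<lambda>u. f u / (u - w)) has_contour_integral (2 * of_real pi * \<i> * f w)) (circlepath 0 \<rho>)"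
    using assms by (intro Cauchy_integral_circlepath_simple) (auto intro: holomorphic_on_subset)
  then have "((\<lambda>t. f (circlepath 0 \<rho> t) / (circlepath 0 \<rho> t - w) *
      ((2 * of_real pi * \<i>) * circlepath 0 \<rho> t)) has_integral (2 * of_real pi * \<i>) * f w) {0..1}"
    unfolding has_contour_integral_def
    by (rule has_integral_cong[THEN iffD1, rotated])
      (clarsimp simp: vector_derivative_circlepath01, simp add: circlepath mult_ac)
  then have "((\<lambda>t. f (circlepath 0 \<rho> t) / (circlepath 0 \<rho> t - w) *
      ((2 * of_real pi * \<i>) * circlepath 0 \<rho> t) / (2 * of_real pi * \<i>))
      has_integral ((2 * of_real pi * \<i>) * f w) / (2 * of_real pi * \<i>)) {0..1}"
    by (rule has_integral_divide)
  moreover have "c / d * (T * e) / T = c * (e / d)" "(T * c) / T = c" if "T \<noteq> 0" for c d e T :: complex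
    using that by simp_all
  ultimately show ?thesis by simp
qed

text \<open>Pulled back along \<open>exp\<close>, \<open>g\<close> becomes a \<open>2\<pi>i\<close>-periodic entire function with a primitive
  \<open>\<Gamma>\<close>; the mean over a circle is a difference \<open>\<Gamma>(w + 2\<pi>i) - \<Gamma>(w)\<close>, whose derivative in \<open>w\<close>
  vanishes.\<close>

lemma circle_mean_punctured_plane:
  fixes g :: "complex \<Rightarrow> complex"
  assumes "g holomorphic_on - {0}" "c \<noteq> 0" "d \<noteq> 0"
  obtains I where "((\<lambda>t. g (c * exp (2 * of_real pi * \<i> * of_real t))) has_integral I) {0..1}"
    "((\<lambda>t. g (d / exp (2 * of_real pi * \<i> * of_real t))) has_integral I) {0..1}"
proof -
  define T where "T = 2 * of_real pi * \<i>"
  have exp_T: "exp (w + T) = exp w" for w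
    by (simp add: T_def exp_add)
  have hol: "(\<lambda>w. g (exp w)) holomorphic_on UNIV"
  proof -
    have "range exp \<subseteq> - {0 :: complex}" using exp_not_eq_zero by (metis ComplI image_iff singletonD subsetI)
    then show ?thesis
      using holomorphic_on_compose_gen[OF holomorphic_on_exp[of UNIV] assms(1)] unfolding o_def by simp
  qed
  obtain \<Gamma> where "\<And>w. w \<in> UNIV \<Longrightarrow> (\<Gamma> has_field_derivative g (exp w)) (at w within UNIV)"
    using holomorphic_convex_primitive'[OF convex_UNIV open_UNIV hol] by metis
  then have \<Gamma>: "(\<Gamma> has_field_derivative g (exp w)) (at w)" for w by simp
  have shift: "((\<lambda>w. \<Gamma> (w + T)) has_field_derivative g (exp w)) (at w)" for w
    using DERIV_shift[of \<Gamma> "g (exp w)" w T] \<Gamma>[of "w + T"] by (simp add: exp_T)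
  have "((\<lambda>w. \<Gamma> (w + T) - \<Gamma> w) has_field_derivative 0) (at w)" for w
    using DERIV_diff[OF shift \<Gamma>, of w] by simp
  then have const: "\<Gamma> (v + T) - \<Gamma> v = \<Gamma> (w + T) - \<Gamma> w" for v w
    using has_field_derivative_zero_constant[of UNIV "\<lambda>w. \<Gamma> (w + T) - \<Gamma> w"] by auto
  \<comment> \<open>The factor \<open>s\<close> is the direction of travel: it will be
    \<open>1\<close> for the circle through \<open>c\<close> and \<open>-1\<close> for the circle
    through \<open>d\<close>, which is traversed backwards.\<close>
  have path: "((\<lambda>t. g (exp (w + s * T * of_real t)) * (s * T)) has_integral \<Gamma> (w + s * T) - \<Gamma> w) {0..1}" for w s
  proof -
    have "((\<lambda>z. \<Gamma> (w + s * T * z)) has_field_derivative g (exp (w + s * T * z)) * (s * T)) (at z)" for z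
      by (rule DERIV_chain2[OF \<Gamma>]) (auto intro!: derivative_eq_intros)
    then have "((\<lambda>t. \<Gamma> (w + s * T * of_real t)) has_vector_derivative
        g (exp (w + s * T * of_real t)) * (s * T)) (at t within {0..1})" for t
      by (rule has_vector_derivative_real_field[where f = "\<lambda>z. \<Gamma> (w + s * T * z)"])
    then show ?thesis
      using fundamental_theorem_of_calculus[of 0 1 "\<lambda>t. \<Gamma> (w + s * T * of_real t)"] by simp
  qed
  have T: "T \<noteq> 0" by (simp add: T_def)
  \<comment> \<open>The common mean is \<open>(\<Gamma> T - \<Gamma> 0) / T\<close>, since the
    increment over one period is the same from every starting point, here \<open>ln c\<close> and
    \<open>ln d - T\<close>.\<close>
  show ?thesis
  proof
    have "((\<lambda>t. g (exp (ln c + T * of_real t)) * T / T) has_integral (\<Gamma> (ln c + T) - \<Gamma> (ln c)) / T) {0..1}"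
      using has_integral_divide[OF path[of "ln c" 1], of T] by simp
    then show "((\<lambda>t. g (c * exp (2 * of_real pi * \<i> * of_real t))) has_integral (\<Gamma> T - \<Gamma> 0) / T) {0..1}"
      using T assms(2) const[of "ln c" 0] by (simp add: exp_add T_def)
    have "((\<lambda>t. g (exp (ln d - T * of_real t)) * (- T) / (- T))
        has_integral (\<Gamma> (ln d - T) - \<Gamma> (ln d)) / (- T)) {0..1}"
      using has_integral_divide[OF path[of "ln d" "-1"], of "- T"] by simp
    moreover have "\<Gamma> (ln d - T) - \<Gamma> (ln d) = - (\<Gamma> T - \<Gamma> 0)"
      using const[of "ln d - T" 0] by (simp add: algebra_simps)
    then have "(\<Gamma> (ln d - T) - \<Gamma> (ln d)) / (- T) = (\<Gamma> T - \<Gamma> 0) / T"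
      by (simp only: minus_divide_divide)
    ultimately show "((\<lambda>t. g (d / exp (2 * of_real pi * \<i> * of_real t))) has_integral (\<Gamma> T - \<Gamma> 0) / T) {0..1}"
      using T assms(3) by (simp add: exp_diff T_def)
  qed
qed

text \<open>Cauchy's formula for the constant \<open>1\<close>; the second kernel is the first one
  minus \<open>1\<close>.\<close>

lemma circle_kernel_integral:
  assumes "norm w < \<rho>"
  shows "((\<lambda>t. circlepath 0 \<rho> t / (circlepath 0 \<rho> t - w)) has_integral 1) {0..1}"
    "((\<lambda>t. w / (circlepath 0 \<rho> t - w)) has_integral 0) {0..1}"
proof -
  show 1: "((\<lambda>t. circlepath 0 \<rho> t / (circlepath 0 \<rho> t - w)) has_integral 1) {0..1}"
    using has_integral_Cauchy_circle[of "\<lambda>_. 1" w \<rho>] assms by simp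
  have \<rho>: "\<rho> > 0" using assms norm_ge_zero le_less_trans by blast
  have "circlepath 0 \<rho> t \<noteq> w" for t
    using norm_circlepath[OF \<rho>, of t] assms by auto
  then have "circlepath 0 \<rho> t / (circlepath 0 \<rho> t - w) - 1 = w / (circlepath 0 \<rho> t - w)" for t
    by (simp add: field_simps)
  then show "((\<lambda>t. w / (circlepath 0 \<rho> t - w)) has_integral 0) {0..1}"
    using has_integral_diff[OF 1 has_integral_const_real[of 1 0 1]] by simp
qed

text \<open>The difference quotient of \<open>f\<close> at \<open>x\<close>, multiplied by the
  variable, is holomorphic on the punctured plane, so its means over the circle \<open>\<nu>\<close>
  and the circle \<open>x * a / \<nu>\<close> agree. Evaluating both means with the kernel integrals
  gives two expressions for \<open>I\<close>, whose comparison is the formula.\<close>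

lemma two_circle_formula:
  fixes f :: "complex \<Rightarrow> complex"
  assumes f: "f holomorphic_on - {0}" and nz: "x \<noteq> 0" "a \<noteq> 0" and less: "norm x < \<rho>" "norm a < \<rho>"
  shows "f x = integral {0..1} (\<lambda>t. f (circlepath 0 \<rho> t) * (circlepath 0 \<rho> t / (circlepath 0 \<rho> t - x)))
    + integral {0..1} (\<lambda>t. f (x * a / circlepath 0 \<rho> t) * (a / (circlepath 0 \<rho> t - a)))"
proof -
  define \<nu> where "\<nu> = circlepath 0 \<rho>"
  have \<rho>: "\<rho> > 0" using less norm_ge_zero le_less_trans by blast
  have \<nu>: "\<nu> t \<noteq> 0" "\<nu> t \<noteq> x" "\<nu> t \<noteq> a" for t
    using circlepath_nonzero[OF \<rho>] norm_circlepath[OF \<rho>, of t] less by (auto simp: \<nu>_def)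
  have \<nu>_eq: "\<nu> t = of_real \<rho> * exp (2 * of_real pi * \<i> * of_real t)" for t
    by (simp add: \<nu>_def circlepath)
  have cont_\<nu>: "continuous_on S \<nu>" for S
    unfolding \<nu>_def using continuous_on_circlepath[OF continuous_on_id] by simp
  have cont_f: "continuous_on (- {0}) f"
    using f holomorphic_on_imp_continuous_on by blast
  \<comment> \<open>The value at \<open>x\<close> removes the singularity of the quotient.\<close>
  define g where "g \<mu> = \<mu> * (if \<mu> = x then deriv f x else (f \<mu> - f x) / (\<mu> - x))" for \<mu>
  have "g holomorphic_on - {0}"
    unfolding g_def using f by (intro holomorphic_intros pole_lemma_open) auto
  then obtain I where I: "((\<lambda>t. g (of_real \<rho> * exp (2 * of_real pi * \<i> * of_real t))) has_integral I) {0..1}"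
    "((\<lambda>t. g ((x * a / of_real \<rho>) / exp (2 * of_real pi * \<i> * of_real t))) has_integral I) {0..1}"
    using circle_mean_punctured_plane[of g "of_real \<rho>" "x * a / of_real \<rho>"] \<rho> nz by auto
  have I1: "((\<lambda>t. g (\<nu> t)) has_integral I) {0..1}"
    using I(1) by (simp add: \<nu>_eq)
  have I2: "((\<lambda>t. g (x * a / \<nu> t)) has_integral I) {0..1}"
    using I(2) by (simp add: \<nu>_eq divide_divide_eq_left)
  have "continuous_on {0..1} (\<lambda>t. f (\<nu> t) * (\<nu> t / (\<nu> t - x)))"
    using \<nu> by (intro continuous_intros cont_\<nu> continuous_on_compose2[OF cont_f cont_\<nu>]) auto
  then have A: "((\<lambda>t. f (\<nu> t) * (\<nu> t / (\<nu> t - x))) has_integral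
      integral {0..1} (\<lambda>t. f (\<nu> t) * (\<nu> t / (\<nu> t - x)))) {0..1}"
    by (intro integrable_integral integrable_continuous_real)
  have "continuous_on {0..1} (\<lambda>t. f (x * a / \<nu> t) * (a / (\<nu> t - a)))"
    using \<nu> nz by (intro continuous_intros cont_\<nu> continuous_on_compose2[OF cont_f, where f = "\<lambda>t. x * a / \<nu> t"]) auto
  then have B: "((\<lambda>t. f (x * a / \<nu> t) * (a / (\<nu> t - a))) has_integral
      integral {0..1} (\<lambda>t. f (x * a / \<nu> t) * (a / (\<nu> t - a)))) {0..1}"
    by (intro integrable_integral integrable_continuous_real)
  have g1: "g (\<nu> t) = f (\<nu> t) * (\<nu> t / (\<nu> t - x)) - f x * (\<nu> t / (\<nu> t - x))" for t
    using \<nu>[of t] by (simp add: g_def diff_divide_distrib right_diff_distrib mult.commute)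
  have "((\<lambda>t. g (\<nu> t)) has_integral
      integral {0..1} (\<lambda>t. f (\<nu> t) * (\<nu> t / (\<nu> t - x))) - f x * 1) {0..1}"
    unfolding g1 using A
    by (rule has_integral_diff) (rule has_integral_mult_right[OF circle_kernel_integral(1)[OF less(1), folded \<nu>_def]])
  from has_integral_unique[OF I1 this]
  have 1: "I = integral {0..1} (\<lambda>t. f (\<nu> t) * (\<nu> t / (\<nu> t - x))) - f x"
    by simp
  have g2: "g (x * a / \<nu> t) = f x * (a / (\<nu> t - a)) - f (x * a / \<nu> t) * (a / (\<nu> t - a))" for t
  proof -
    \<comment> \<open>On the inner circle this factorization turns the Cauchy kernel at
      \<open>x\<close> into the kernel \<open>a / (\<nu> t - a)\<close> on the outer circle.\<close>
    have eq: "x * a / \<nu> t - x = - (x * (\<nu> t - a) / \<nu> t)"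
      using \<nu>(1)[of t] by (simp add: diff_divide_distrib right_diff_distrib)
    have "x * (\<nu> t - a) / \<nu> t \<noteq> 0"
      using \<nu>[of t] nz by simp
    with eq have "x * a / \<nu> t \<noteq> x" by auto
    then have "g (x * a / \<nu> t) = (x * a / \<nu> t) * ((f (x * a / \<nu> t) - f x) / (- (x * (\<nu> t - a) / \<nu> t)))"
      unfolding g_def eq[symmetric] by simp
    also have "\<dots> = (f x - f (x * a / \<nu> t)) * (a / (\<nu> t - a))"
    proof -
      have "(x * a / n) * (D / (- (x * m / n))) = - D * (a / m)" if "n \<noteq> 0" "m \<noteq> 0" for n m D
        using that nz by simp
      from this[of "\<nu> t" "\<nu> t - a" "f (x * a / \<nu> t) - f x"] show ?thesis
        using \<nu>[of t] by simp
    qed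
    also have "\<dots> = f x * (a / (\<nu> t - a)) - f (x * a / \<nu> t) * (a / (\<nu> t - a))"
      by (rule left_diff_distrib)
    finally show ?thesis .
  qed
  have "((\<lambda>t. g (x * a / \<nu> t)) has_integral
      f x * 0 - integral {0..1} (\<lambda>t. f (x * a / \<nu> t) * (a / (\<nu> t - a)))) {0..1}"
    unfolding g2
    by (rule has_integral_diff[OF has_integral_mult_right[OF circle_kernel_integral(2)[OF less(2), folded \<nu>_def]] B])
  from has_integral_unique[OF I2 this]
  have "I = - integral {0..1} (\<lambda>t. f (x * a / \<nu> t) * (a / (\<nu> t - a)))"
    by simp
  with 1 show ?thesis by (simp add: \<nu>_def algebra_simps)
qed

section \<open>The uniform closure of an algebra of functions on a compact set\<close>

locale approximation_algebra =
  fixes K :: "'a::metric_space set" and R :: "('a \<Rightarrow> complex) set"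
  assumes compact: "compact K"
    and cont: "f \<in> R \<Longrightarrow> continuous_on K f"
    and const: "(\<lambda>p. c) \<in> R"
    and add: "f \<in> R \<Longrightarrow> g \<in> R \<Longrightarrow> (\<lambda>p. f p + g p) \<in> R"
    and mult: "f \<in> R \<Longrightarrow> g \<in> R \<Longrightarrow> (\<lambda>p. f p * g p) \<in> R"
begin

text \<open>Membership in the uniform closure of \<open>R\<close> on \<open>K\<close>. The lemmas
  that follow make it an algebra closed under uniform limits, integrals over a parameter and
  composition with entire functions.\<close>

definition approximable :: "('a \<Rightarrow> complex) \<Rightarrow> bool" where
  "approximable f \<longleftrightarrow> (\<forall>e>0. \<exists>g\<in>R. \<forall>p\<in>K. norm (f p - g p) < e)"

lemma approximable_member: "f \<in> R \<Longrightarrow> approximable f"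
  unfolding approximable_def by (intro allI impI bexI[of _ f]) auto

lemma approximable_add:
  assumes "approximable f" "approximable g"
  shows "approximable (\<lambda>p. f p + g p)"
  unfolding approximable_def
proof (intro allI impI)
  fix e :: real assume "e > 0"
  then have "e / 2 > 0" by simp
  then have "\<exists>F\<in>R. \<forall>p\<in>K. norm (f p - F p) < e / 2" "\<exists>G\<in>R. \<forall>p\<in>K. norm (g p - G p) < e / 2"
    by (rule assms[unfolded approximable_def, rule_format])+
  then obtain F G where FG: "F \<in> R" "\<forall>p\<in>K. norm (f p - F p) < e / 2"
    "G \<in> R" "\<forall>p\<in>K. norm (g p - G p) < e / 2"
    by blast
  have "norm (f p + g p - (F p + G p)) < e" if "p \<in> K" for p
    using FG(2,4)[THEN bspec, OF that] norm_diff_triangle_ineq[of "f p" "g p" "F p" "G p"] by linarith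
  then show "\<exists>h\<in>R. \<forall>p\<in>K. norm (f p + g p - h p) < e"
    using add[OF FG(1,3)] by (intro bexI[of _ "\<lambda>p. F p + G p"]) auto
qed

lemma bounded_member:
  assumes "f \<in> R"
  obtains B where "B > 0" "\<And>p. p \<in> K \<Longrightarrow> norm (f p) \<le> B"
proof -
  have "bounded (f ` K)"
    using compact_continuous_image[OF cont[OF assms] compact] compact_imp_bounded by blast
  then show ?thesis using that unfolding bounded_pos by blast
qed

lemma approximable_bounded:
  assumes "approximable f"
  obtains B where "B > 0" "\<And>p. p \<in> K \<Longrightarrow> norm (f p) \<le> B"
proof -
  obtain F where F: "F \<in> R" "\<forall>p\<in>K. norm (f p - F p) < 1"
    using assms[unfolded approximable_def, rule_format, of 1] by auto
  obtain B where B: "B > 0" "\<And>p. p \<in> K \<Longrightarrow> norm (F p) \<le> B"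
    using F(1) by (rule bounded_member) blast
  have "norm (f p) \<le> B + 1" if "p \<in> K" for p
    using F(2)[THEN bspec, OF that] B(2)[OF that] norm_triangle_sub[of "f p" "F p"] by linarith
  moreover have "B + 1 > 0" using B(1) by simp
  ultimately show ?thesis using that by blast
qed

lemma approximable_mult:
  assumes "approximable f" "approximable g"
  shows "approximable (\<lambda>p. f p * g p)"
  unfolding approximable_def
proof (intro allI impI)
  fix e :: real assume e: "e > 0"
  obtain A where A: "A > 0" "\<And>p. p \<in> K \<Longrightarrow> norm (f p) \<le> A"
    using assms(1) by (rule approximable_bounded) blast
  \<comment> \<open>\<open>G\<close> is chosen before \<open>F\<close>, because the tolerance for
    \<open>F\<close> depends on the bound \<open>B\<close> of \<open>G\<close>; the error splits as
    \<open>f (g - G) + (f - F) G\<close>.\<close>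
  obtain G where G: "G \<in> R" "\<forall>p\<in>K. norm (g p - G p) < e / (2 * A)"
    using assms(2)[unfolded approximable_def, rule_format, of "e / (2 * A)"] e A(1) by auto
  obtain B where B: "B > 0" "\<And>p. p \<in> K \<Longrightarrow> norm (G p) \<le> B"
    using G(1) by (rule bounded_member) blast
  obtain F where F: "F \<in> R" "\<forall>p\<in>K. norm (f p - F p) < e / (2 * B)"
    using assms(1)[unfolded approximable_def, rule_format, of "e / (2 * B)"] e B(1) by auto
  have "norm (f p * g p - F p * G p) < e" if p: "p \<in> K" for p
  proof -
    have "norm (f p * g p - F p * G p) = norm (f p * (g p - G p) + (f p - F p) * G p)"
      by (simp add: algebra_simps)
    also have "\<dots> \<le> norm (f p) * norm (g p - G p) + norm (f p - F p) * norm (G p)"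
      by (metis norm_mult norm_triangle_ineq)
    also have "norm (f p) * norm (g p - G p) \<le> A * norm (g p - G p)"
      using A(2)[OF p] by (simp add: mult_right_mono)
    also have "A * norm (g p - G p) < A * (e / (2 * A))"
      using G(2)[THEN bspec, OF p] A(1) by (intro mult_strict_left_mono)
    also have "norm (f p - F p) * norm (G p) \<le> e / (2 * B) * B"
      using F(2)[THEN bspec, OF p] B(2)[OF p] e B(1) by (intro mult_mono) auto
    finally show ?thesis using A(1) B(1) by (simp add: field_simps)
  qed
  then show "\<exists>h\<in>R. \<forall>p\<in>K. norm (f p * g p - h p) < e"
    using mult[OF F(1) G(1)] by (intro bexI[of _ "\<lambda>p. F p * G p"]) auto
qed

lemma approximable_limit:
  assumes "\<And>e. e > 0 \<Longrightarrow> \<exists>g. approximable g \<and> (\<forall>p\<in>K. norm (f p - g p) < e)"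
  shows "approximable f"
  unfolding approximable_def
proof (intro allI impI)
  fix e :: real assume "e > 0"
  then have e2: "e / 2 > 0" by simp
  from assms[OF e2] obtain g where g: "approximable g" "\<forall>p\<in>K. norm (f p - g p) < e / 2"
    by auto
  from g(1)[unfolded approximable_def, rule_format, OF e2]
  obtain h where h: "h \<in> R" "\<forall>p\<in>K. norm (g p - h p) < e / 2"
    by auto
  have "norm (f p - h p) < e" if "p \<in> K" for p
    using g(2)[THEN bspec, OF that] h(2)[THEN bspec, OF that]
      norm_triangle_ineq[of "f p - g p" "g p - h p"] by simp
  then show "\<exists>h\<in>R. \<forall>p\<in>K. norm (f p - h p) < e" using h(1) by blast
qed

lemma approximable_sum:
  "(\<And>i. i \<in> A \<Longrightarrow> approximable (f i)) \<Longrightarrow> approximable (\<lambda>p. \<Sum>i\<in>A. f i p)"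
  by (induction A rule: infinite_finite_induct)
    (auto intro: approximable_add approximable_member[OF const])

lemma approximable_cmult: "approximable f \<Longrightarrow> approximable (\<lambda>p. c * f p)"
  using approximable_mult[OF approximable_member[OF const]] by blast

lemma approximable_power: "approximable f \<Longrightarrow> approximable (\<lambda>p. f p ^ n)"
proof (induction n)
  case 0
  then show ?case using approximable_member[OF const[of 1]] by simp
next
  case (Suc n)
  then show ?case using approximable_mult[of f "\<lambda>p. f p ^ n"] by simp
qed

text \<open>Riemann sums of a jointly continuous integrand converge uniformly in the parameter.\<close>

lemma approximable_integral:
  assumes cont: "continuous_on ({0..1} \<times> K) (\<lambda>(t, p). k t p)"
    and k: "\<And>t. t \<in> {0..1} \<Longrightarrow> approximable (k t)"
  shows "approximable (\<lambda>p. integral {0..1::real} (\<lambda>t. k t p))"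
proof (rule approximable_limit)
  fix e :: real assume e: "e > 0"
  have "uniformly_continuous_on ({0..1} \<times> K) (\<lambda>(t, p). k t p)"
    using cont compact by (intro compact_uniformly_continuous compact_Times) auto
  then obtain d where d: "d > 0" and
    "\<forall>x\<in>{0..1} \<times> K. \<forall>x'\<in>{0..1} \<times> K. dist x' x < d \<longrightarrow> dist (case x' of (t, p) \<Rightarrow> k t p) (case x of (t, p) \<Rightarrow> k t p) < e / 2"
    unfolding uniformly_continuous_on_def using e half_gt_zero by meson
  then have close: "norm (k t p - k s p) < e / 2" if "t \<in> {0..1}" "s \<in> {0..1}" "p \<in> K" "\<bar>t - s\<bar> < d" for s t p
    using that by (force simp: dist_Pair_Pair dist_norm)
  obtain n where n: "n > 0" "1 / real n < d"
    using d by (metis inverse_eq_divide ex_inverse_of_nat_less)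
  have cont_t: "continuous_on {0..1} (\<lambda>t. k t p)" if "p \<in> K" for p
  proof -
    have "continuous_on {0..1} (\<lambda>t. case (t, p) of (t, p) \<Rightarrow> k t p)"
      by (rule continuous_on_compose2[OF cont]) (use that in \<open>auto intro!: continuous_intros\<close>)
    then show ?thesis by simp
  qed
  \<comment> \<open>Induction on the number \<open>j\<close> of subintervals: each contributes at
    most \<open>e / 2 / n\<close>, as the mesh \<open>1 / n\<close> lies below the modulus of
    continuity \<open>d\<close>.\<close>
  have bound: "norm (integral {0..real j / n} (\<lambda>t. k t p) - (\<Sum>i<j. (1 / n) * k (real i / n) p)) \<le> j * (e / 2 / n)"
    if p: "p \<in> K" and "j \<le> n" for p j
    using \<open>j \<le> n\<close>
  proof (induction j)
    case 0
    then show ?case by simp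
  next
    case (Suc j)
    let ?a = "real j / n" and ?b = "real (Suc j) / n"
    have ab: "0 \<le> ?a" "?a \<le> ?b" "?b \<le> 1" "?b - ?a = 1 / n"
      using Suc.prems n(1) by (auto simp: field_simps)
    have int: "(\<lambda>t. k t p) integrable_on {u..v}" if "0 \<le> u" "v \<le> 1" for u v
      using that by (intro integrable_continuous_real continuous_on_subset[OF cont_t[OF p]]) simp
    have "norm (integral {?a..?b} (\<lambda>t. k t p - k ?a p)) \<le> e / 2 * (?b - ?a)"
    proof (rule integral_bound)
      show "continuous_on {?a..?b} (\<lambda>t. k t p - k ?a p)"
      proof (intro continuous_on_diff continuous_on_const continuous_on_subset[OF cont_t[OF p]])
        show "{?a..?b} \<subseteq> {0..1}" using ab(1,3) by (simp only: atLeastatMost_subset_iff simp_thms)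
      qed
      show "norm (k t p - k ?a p) \<le> e / 2" if "t \<in> {?a..?b}" for t
      proof -
        from that have t: "?a \<le> t" "t \<le> ?b" by (simp_all only: atLeastAtMost_iff)
        have "\<bar>t - ?a\<bar> < d" "0 \<le> t" "t \<le> 1" "?a \<le> 1" using t ab n(2) by linarith+
        then show "norm (k t p - k ?a p) \<le> e / 2"
          using close[of t ?a p] ab(1) p by simp
      qed
    qed (use ab in simp)
    also have "integral {?a..?b} (\<lambda>t. k t p - k ?a p) = integral {?a..?b} (\<lambda>t. k t p) - (1 / n) * k ?a p"
      using int[of ?a ?b] ab by (subst integral_diff) (auto simp: scaleR_conv_of_real)
    finally have "norm (integral {?a..?b} (\<lambda>t. k t p) - (1 / n) * k ?a p) \<le> e / 2 / n"
      using ab(4) by simp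
    moreover have "integral {0..?b} (\<lambda>t. k t p) = integral {0..?a} (\<lambda>t. k t p) + integral {?a..?b} (\<lambda>t. k t p)"
      using ab int[of 0 ?b] Henstock_Kurzweil_Integration.integral_combine[of 0 ?a ?b "\<lambda>t. k t p"] by simp
    moreover have "norm (integral {0..?a} (\<lambda>t. k t p) - (\<Sum>i<j. (1 / n) * k (real i / n) p)) \<le> j * (e / 2 / n)"
      using Suc by simp
    ultimately have "norm ((integral {0..?a} (\<lambda>t. k t p) - (\<Sum>i<j. (1 / n) * k (real i / n) p)) +
        (integral {?a..?b} (\<lambda>t. k t p) - (1 / n) * k ?a p)) \<le> j * (e / 2 / n) + e / 2 / n"
      by (intro order_trans[OF norm_triangle_ineq] add_mono)
    then show ?case
      using \<open>integral {0..?b} _ = _\<close> by (simp add: algebra_simps add_divide_distrib)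
  qed
  have "approximable (\<lambda>p. \<Sum>i<n. (1 / n) * k (real i / n) p)"
    using n(1) by (intro approximable_sum approximable_cmult k) (auto simp: field_simps)
  moreover have "norm (integral {0..1} (\<lambda>t. k t p) - (\<Sum>i<n. (1 / n) * k (real i / n) p)) < e" if "p \<in> K" for p
    using bound[OF that, of n] n(1) e by simp
  ultimately show "\<exists>g. approximable g \<and> (\<forall>p\<in>K. norm (integral {0..1} (\<lambda>t. k t p) - g p) < e)"
    by blast
qed

text \<open>The kernel is a geometric series in \<open>s p / \<nu>\<close>, whose ratio has norm at
  most \<open>1/2\<close> on \<open>K\<close>, so its partial sums converge uniformly.\<close>

lemma approximable_Cauchy_kernel:
  assumes "s \<in> R" "\<And>p. p \<in> K \<Longrightarrow> norm (s p) \<le> r" "norm \<nu> = 2 * r" "r > 0"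
  shows "approximable (\<lambda>p. \<nu> / (\<nu> - s p))"
proof (rule approximable_limit)
  fix e :: real assume "e > 0"
  \<comment> \<open>The bound is \<open>e / 2\<close> because the remainder is divided by
    \<open>1 - z\<close>, of norm at least \<open>1/2\<close>.\<close>
  then obtain n where n: "(1/2) ^ n < e / 2"
    using real_arch_pow_inv[of "e / 2" "1/2"] by auto
  have "norm \<nu> > 0" using assms(3,4) by linarith
  then have \<nu>: "\<nu> \<noteq> 0" by simp
  have "norm (\<nu> / (\<nu> - s p) - (\<Sum>i<n. (inverse \<nu> * s p) ^ i)) < e" if p: "p \<in> K" for p
  proof -
    define z where "z = inverse \<nu> * s p"
    have "norm z = norm (s p) / (2 * r)"
      unfolding z_def norm_mult norm_inverse assms(3) by (simp only: divide_inverse mult.commute)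
    also have "\<dots> \<le> r / (2 * r)"
      using assms(2)[OF p] assms(4) by (intro divide_right_mono) simp_all
    finally have z: "norm z \<le> 1/2"
      using assms(4) by simp
    then have z1: "norm (1 - z) \<ge> 1/2"
      using norm_triangle_ineq2[of 1 z] by simp
    then have "z \<noteq> 1" by (intro notI) simp
    have "\<nu> - s p = \<nu> * (1 - z)"
      using \<nu> by (simp add: z_def right_diff_distrib)
    then have "\<nu> / (\<nu> - s p) = 1 / (1 - z)"
      using \<nu> by simp
    then have "\<nu> / (\<nu> - s p) - (\<Sum>i<n. z ^ i) = z ^ n / (1 - z)"
      using \<open>z \<noteq> 1\<close> by (simp add: sum_gp_strict diff_divide_distrib)
    also have "norm \<dots> = norm z ^ n / norm (1 - z)"
      by (simp add: norm_divide norm_power)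
    also have "\<dots> \<le> (1/2) ^ n / (1/2)"
      using z z1 by (intro frac_le power_mono) auto
    also have "\<dots> < e" using n by simp
    finally show ?thesis by (simp add: z_def)
  qed
  moreover have "approximable (\<lambda>p. \<Sum>i<n. (inverse \<nu> * s p) ^ i)"
    using assms(1) by (intro approximable_sum approximable_power approximable_cmult approximable_member)
  ultimately show "\<exists>g. approximable g \<and> (\<forall>p\<in>K. norm (\<nu> / (\<nu> - s p) - g p) < e)"
    by blast
qed

lemma continuous_on_Cauchy_kernel:
  assumes "s \<in> R" "\<And>p. p \<in> K \<Longrightarrow> norm (s p) \<le> r" "r > 0"
  shows "continuous_on ({0..1} \<times> K) (\<lambda>(t, p). circlepath 0 (2 * r) t / (circlepath 0 (2 * r) t - s p))"
proof -
  have "circlepath 0 (2 * r) t \<noteq> s p" if "p \<in> K" for t p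
    using assms(2)[OF that] assms(3) norm_circlepath[of "2 * r" t] by auto
  then show ?thesis
    unfolding split_beta
    by (intro continuous_intros continuous_on_compose2[OF cont[OF assms(1)] continuous_on_snd[OF continuous_on_id]]) auto
qed

text \<open>Cauchy's formula displays \<open>g (s p)\<close> as an integral of Cauchy kernels in
  \<open>s p\<close> with coefficients independent of \<open>p\<close>. The radius is twice a bound
  of \<open>s\<close>, as the geometric series requires.\<close>

lemma approximable_entire:
  assumes g: "g holomorphic_on UNIV" and s: "s \<in> R"
  shows "approximable (\<lambda>p. g (s p))"
proof -
  obtain r where r: "r > 0" "\<And>p. p \<in> K \<Longrightarrow> norm (s p) \<le> r"
    using s by (rule bounded_member) blast
  let ?\<nu> = "circlepath 0 (2 * r)"
  have "approximable (\<lambda>p. integral {0..1} (\<lambda>t. g (?\<nu> t) * (?\<nu> t / (?\<nu> t - s p))))"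
  proof (rule approximable_integral)
    have "continuous_on UNIV g" using g by (rule holomorphic_on_imp_continuous_on)
    then have "continuous_on ({0..1} \<times> K) (\<lambda>x. g (?\<nu> (fst x)))"
      by (rule continuous_on_compose2) (intro continuous_intros, simp)
    then show "continuous_on ({0..1} \<times> K) (\<lambda>(t, p). g (?\<nu> t) * (?\<nu> t / (?\<nu> t - s p)))"
      using continuous_on_mult[OF _ continuous_on_Cauchy_kernel[OF s r(2,1)]] by (simp add: split_beta)
    fix t
    show "approximable (\<lambda>p. g (?\<nu> t) * (?\<nu> t / (?\<nu> t - s p)))"
      using r norm_circlepath[of "2 * r" t]
      by (intro approximable_cmult approximable_Cauchy_kernel[OF s, of r]) auto
  qed
  moreover have "integral {0..1} (\<lambda>t. g (?\<nu> t) * (?\<nu> t / (?\<nu> t - s p))) = g (s p)" if "p \<in> K" for p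
    using has_integral_Cauchy_circle[OF g, of "s p" "2 * r"] r(2)[OF that] r(1)
    by (intro integral_unique) auto
  ultimately show ?thesis
    unfolding approximable_def by simp
qed

text \<open>Cauchy's formula in the first variable; for each \<open>t\<close> the coefficient of the
  kernel is an entire function of \<open>s p\<close>, covered by the one-variable case.\<close>

lemma approximable_entire2:
  fixes g :: "complex \<Rightarrow> complex \<Rightarrow> complex"
  assumes contg: "continuous_on UNIV (\<lambda>(z, w). g z w)"
    and g1: "\<And>w. (\<lambda>z. g z w) holomorphic_on UNIV" and g2: "\<And>z. (\<lambda>w. g z w) holomorphic_on UNIV"
    and y: "y \<in> R" and s: "s \<in> R"
  shows "approximable (\<lambda>p. g (y p) (s p))"
proof -
  obtain r where r: "r > 0" "\<And>p. p \<in> K \<Longrightarrow> norm (y p) \<le> r"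
    using y by (rule bounded_member) blast
  let ?\<nu> = "circlepath 0 (2 * r)"
  have "approximable (\<lambda>p. integral {0..1} (\<lambda>t. g (?\<nu> t) (s p) * (?\<nu> t / (?\<nu> t - y p))))"
  proof (rule approximable_integral)
    have "continuous_on ({0..1} \<times> K) (\<lambda>x. s (snd x))"
      by (rule continuous_on_compose2[OF cont[OF s] continuous_on_snd[OF continuous_on_id]]) auto
    then have "continuous_on ({0..1} \<times> K) (\<lambda>x. (?\<nu> (fst x), s (snd x)))"
      by (intro continuous_intros)
    from continuous_on_compose2[OF contg this]
    have "continuous_on ({0..1} \<times> K) (\<lambda>x. g (?\<nu> (fst x)) (s (snd x)))"
      by simp
    then show "continuous_on ({0..1} \<times> K) (\<lambda>(t, p). g (?\<nu> t) (s p) * (?\<nu> t / (?\<nu> t - y p)))"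
      using continuous_on_mult[OF _ continuous_on_Cauchy_kernel[OF y r(2,1)]] by (simp add: split_beta)
    fix t
    show "approximable (\<lambda>p. g (?\<nu> t) (s p) * (?\<nu> t / (?\<nu> t - y p)))"
      using r norm_circlepath[of "2 * r" t] g2
      by (intro approximable_mult approximable_entire[OF _ s] approximable_Cauchy_kernel[OF y, of r]) auto
  qed
  moreover have "integral {0..1} (\<lambda>t. g (?\<nu> t) (s p) * (?\<nu> t / (?\<nu> t - y p))) = g (y p) (s p)"
    if "p \<in> K" for p
    using has_integral_Cauchy_circle[OF g1[of "s p"], of "y p" "2 * r"] r(2)[OF that] r(1)
    by (intro integral_unique) auto
  ultimately show ?thesis
    unfolding approximable_def by simp
qed

end

section \<open>The variety as a hypersurface\<close>

definition vec5 :: "'a \<Rightarrow> 'a \<Rightarrow> 'a \<Rightarrow> 'a \<Rightarrow> 'a \<Rightarrow> 'a^5" where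
  "vec5 u1 u2 u3 u4 u5 = (\<chi> i. if i = 1 then u1 else if i = 2 then u2 else if i = 3 then u3
     else if i = 4 then u4 else u5)"

lemma vec5_nth [simp]:
  "vec5 u1 u2 u3 u4 u5 $ 1 = u1" "vec5 u1 u2 u3 u4 u5 $ 2 = u2" "vec5 u1 u2 u3 u4 u5 $ 3 = u3"
  "vec5 u1 u2 u3 u4 u5 $ 4 = u4" "vec5 u1 u2 u3 u4 u5 $ 5 = u5"
  by (simp_all add: vec5_def)

lemma exhaust_5:
  fixes i :: 5
  shows "i = 1 \<or> i = 2 \<or> i = 3 \<or> i = 4 \<or> i = 5"
proof (induct i)
  case (of_int z)
  then have "z = 0 \<or> z = 1 \<or> z = 2 \<or> z = 3 \<or> z = 4" by simp arith
  then show ?case by auto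
qed

lemma forall_5: "(\<forall>i::5. P i) \<longleftrightarrow> P 1 \<and> P 2 \<and> P 3 \<and> P 4 \<and> P 5"
  by (metis exhaust_5)

lemma variety_G_iff:
  "p \<in> variety_G b1 b2 \<longleftrightarrow> p $ 3 * p $ 1 + p $ 4 * p $ 2 = b1 \<and> p $ 4 * p $ 1 + p $ 5 * p $ 2 = b2"
  by (simp add: variety_G_def vec_eq_iff forall_2 matrix_vector_mult_def sum_2)

lemmas derivative_along_intros = derivative_along_const derivative_along_component
  derivative_along_add derivative_along_mult derivative_along_uminus derivative_along_diff
  derivative_along_power

text \<open>Meant for \<open>q\<close> in the kernel of the square of \<open>V\<close>: such
  functions are affine in time along orbits, so the equation for the change of time is linear and
  has a solution for all complex times.\<close>

lemma complete_scale_field: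
  assumes V: "V \<in> vector_fields X" and q: "locally_holomorphic X q"
    and orbit: "\<And>p. p \<in> X \<Longrightarrow> \<exists>\<gamma> \<alpha> \<beta>. \<gamma> 0 = p \<and> (\<forall>t. \<gamma> t \<in> X) \<and>
      (\<forall>t i. ((\<lambda>s. \<gamma> s $ i) has_field_derivative V (\<gamma> t) $ i) (at t)) \<and> (\<forall>t. q (\<gamma> t) = \<alpha> + \<beta> * t)"
  shows "scale_field q V \<in> complete_fields X"
  unfolding complete_fields_def
proof (intro CollectI conjI ballI scale_field_in_vector_fields V q)
  fix p assume "p \<in> X"
  then obtain \<gamma> \<alpha> \<beta> where \<gamma>: "\<gamma> 0 = p" "\<And>t. \<gamma> t \<in> X" "\<And>t. q (\<gamma> t) = \<alpha> + \<beta> * t"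
    "\<And>t i. ((\<lambda>s. \<gamma> s $ i) has_field_derivative V (\<gamma> t) $ i) (at t)"
    using orbit by blast
  text \<open>Along the orbit, \<open>q V\<close> is a time change of \<open>V\<close> governed by \<open>\<tau>' = \<alpha> + \<beta> \<tau>\<close>.\<close>
  define \<tau> where "\<tau> t = (if \<beta> = 0 then \<alpha> * t else \<alpha> / \<beta> * (exp (\<beta> * t) - 1))" for t
  have \<tau>0: "\<tau> 0 = 0" by (simp add: \<tau>_def)
  have \<tau>: "(\<tau> has_field_derivative \<alpha> + \<beta> * \<tau> t) (at t)" for t
  proof (cases "\<beta> = 0")
    case True
    then show ?thesis unfolding \<tau>_def by (auto intro!: derivative_eq_intros)
  next
    case False
    then show ?thesis unfolding \<tau>_def by (auto intro!: derivative_eq_intros simp: field_simps)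
  qed
  have "((\<lambda>s. \<gamma> (\<tau> s) $ i) has_field_derivative scale_field q V (\<gamma> (\<tau> t)) $ i) (at t)" for t i
    unfolding scale_field_component \<gamma>(3) mult.commute[of "\<alpha> + _"] by (rule DERIV_chain2[OF \<gamma>(4) \<tau>])
  then show "\<exists>\<delta>. \<delta> 0 = p \<and> (\<forall>t. \<delta> t \<in> X) \<and>
      (\<forall>t i. ((\<lambda>s. \<delta> s $ i) has_field_derivative scale_field q V (\<delta> t) $ i) (at t))"
    using \<gamma>(1,2) \<tau>0 by (intro exI[of _ "\<lambda>t. \<gamma> (\<tau> t)"]) simp
qed

locale variety_chart =
  fixes b1 b2 d1 d2 :: complex
  assumes det: "b1 * d2 - b2 * d1 = 1"
begin

abbreviation X :: "(complex^5) set" where "X \<equiv> variety_G b1 b2"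

text \<open>\<open>cx\<close>, \<open>cy\<close>, \<open>ca\<close>, \<open>cs\<close> are the coordinates \<open>x\<close>, \<open>y\<close>, \<open>a\<close>, \<open>s\<close>; their inverse \<open>emb\<close> comes from
  \<open>w = B\<^sup>T w' B\<close> with \<open>w' = ((a, ys), (ys, -xs))\<close>, where \<open>B\<close> has rows \<open>b\<close> and \<open>d\<close>. The differential
  of \<open>emb\<close> is \<open>dem\<close>; it does not involve \<open>a\<close>.\<close>

definition cx :: "complex^5 \<Rightarrow> complex" where "cx p = b1 * p $ 1 + b2 * p $ 2"
definition cy :: "complex^5 \<Rightarrow> complex" where "cy p = d1 * p $ 1 + d2 * p $ 2"
definition ca :: "complex^5 \<Rightarrow> complex" where
  "ca p = d2^2 * p $ 3 - 2 * d1 * d2 * p $ 4 + d1^2 * p $ 5"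
definition cs :: "complex^5 \<Rightarrow> complex" where "cs p = p $ 4 * p $ 4 - p $ 3 * p $ 5"

definition emb :: "complex \<Rightarrow> complex \<Rightarrow> complex \<Rightarrow> complex \<Rightarrow> complex^5" where
  "emb x a y s = vec5 (d2 * x - b2 * y) (b1 * y - d1 * x)
     (b1^2 * a + 2 * b1 * d1 * (y * s) - d1^2 * (x * s))
     (b1 * b2 * a + (b1 * d2 + b2 * d1) * (y * s) - d1 * d2 * (x * s))
     (b2^2 * a + 2 * b2 * d2 * (y * s) - d2^2 * (x * s))"

definition dem :: "complex \<Rightarrow> complex \<Rightarrow> complex \<Rightarrow> complex \<Rightarrow> complex \<Rightarrow> complex \<Rightarrow> complex \<Rightarrow> complex^5" where
  "dem x y s vx va vy vs = vec5 (d2 * vx - b2 * vy) (b1 * vy - d1 * vx)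
     (b1^2 * va + 2 * b1 * d1 * (y * vs + vy * s) - d1^2 * (x * vs + vx * s))
     (b1 * b2 * va + (b1 * d2 + b2 * d1) * (y * vs + vy * s) - d1 * d2 * (x * vs + vx * s))
     (b2^2 * va + 2 * b2 * d2 * (y * vs + vy * s) - d2^2 * (x * vs + vx * s))"

text \<open>Since \<open>B\<close> has determinant one, \<open>cs\<close> takes the value
  \<open>s * (x * a + s * y^2)\<close>, where the hypersurface equation enters.\<close>

lemma coords_emb:
  "cx (emb x a y s) = x" "cy (emb x a y s) = y" "ca (emb x a y s) = a"
  "x * a + s * y^2 = 1 \<Longrightarrow> cs (emb x a y s) = s"
proof -
  have "cx (emb x a y s) = (b1 * d2 - b2 * d1) * x"
    unfolding cx_def emb_def vec5_nth by (simp add: algebra_simps)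
  then show "cx (emb x a y s) = x" using det by simp
  have "cy (emb x a y s) = (b1 * d2 - b2 * d1) * y"
    unfolding cy_def emb_def vec5_nth by (simp add: algebra_simps)
  then show "cy (emb x a y s) = y" using det by simp
  have "ca (emb x a y s) = (b1 * d2 - b2 * d1)^2 * a"
    unfolding ca_def emb_def vec5_nth by (simp add: power2_eq_square algebra_simps)
  then show "ca (emb x a y s) = a" using det by simp
  have "cs (emb x a y s) = (b1 * d2 - b2 * d1)^2 * (s * (x * a + s * y^2))"
    unfolding cs_def emb_def vec5_nth by (simp add: power2_eq_square algebra_simps)
  then show "cs (emb x a y s) = s" if "x * a + s * y^2 = 1"
    using that det by simp
qed

text \<open>The matrix \<open>w'\<close> sends \<open>(x, y)\<close> to
  \<open>(x * a + s * y^2, 0) = (1, 0)\<close>, and the transpose of \<open>B\<close> sends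
  \<open>(1, 0)\<close> to \<open>b\<close>.\<close>

lemma emb_in_X:
  assumes "x * a + s * y^2 = 1"
  shows "emb x a y s \<in> X"
proof -
  have "(b1^2 * a + 2 * b1 * d1 * (y * s) - d1^2 * (x * s)) * (d2 * x - b2 * y) +
      (b1 * b2 * a + (b1 * d2 + b2 * d1) * (y * s) - d1 * d2 * (x * s)) * (b1 * y - d1 * x)
      = (b1 * d2 - b2 * d1) * (b1 * (x * a + s * y^2))" by (simp add: power2_eq_square algebra_simps)
  moreover have "(b1 * b2 * a + (b1 * d2 + b2 * d1) * (y * s) - d1 * d2 * (x * s)) * (d2 * x - b2 * y) +
      (b2^2 * a + 2 * b2 * d2 * (y * s) - d2^2 * (x * s)) * (b1 * y - d1 * x)
      = (b1 * d2 - b2 * d1) * (b2 * (x * a + s * y^2))" by (simp add: power2_eq_square algebra_simps)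
  ultimately show ?thesis
    unfolding variety_G_iff emb_def vec5_nth using assms det by simp
qed

text \<open>In the basis adapted to \<open>B\<close>, the symmetric matrix has entries
  \<open>a\<close>, \<open>q\<close>, \<open>r\<close>, and the defining equations become
  \<open>x a + q y = 1\<close> and \<open>q x + r y = 0\<close>. With \<open>s = q^2 - a r\<close>
  elimination gives \<open>q = y s\<close> and \<open>r = - x s\<close>, so the point is recovered
  from the four coordinates.\<close>

lemma X_coords:
  assumes "p \<in> X"
  shows "cx p * ca p + cs p * (cy p)^2 = 1" "emb (cx p) (ca p) (cy p) (cs p) = p"
proof -
  let ?x = "cx p" and ?y = "cy p" and ?a = "ca p" and ?s = "cs p"
  define q where "q = - b2 * d2 * p $ 3 + (b1 * d2 + b2 * d1) * p $ 4 - b1 * d1 * p $ 5"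
  define r where "r = b2^2 * p $ 3 - 2 * b1 * b2 * p $ 4 + b1^2 * p $ 5"
  have e: "p $ 3 * p $ 1 + p $ 4 * p $ 2 = b1" "p $ 4 * p $ 1 + p $ 5 * p $ 2 = b2"
    using assms by (simp_all add: variety_G_iff)
  have "?x * ?a + q * ?y = (b1 * d2 - b2 * d1) *
      (d2 * (p $ 3 * p $ 1 + p $ 4 * p $ 2) - d1 * (p $ 4 * p $ 1 + p $ 5 * p $ 2))"
    unfolding q_def cx_def cy_def ca_def by (simp add: power2_eq_square algebra_simps)
  then have 1: "?x * ?a + q * ?y = 1"
    using det e by (simp add: mult.commute)
  have "q * ?x + r * ?y = (b1 * d2 - b2 * d1) *
      (b1 * (p $ 4 * p $ 1 + p $ 5 * p $ 2) - b2 * (p $ 3 * p $ 1 + p $ 4 * p $ 2))"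
    unfolding q_def r_def cx_def cy_def ca_def by (simp add: power2_eq_square algebra_simps)
  then have 2: "q * ?x + r * ?y = 0"
    using det e by (simp add: mult.commute)
  have "q^2 - ?a * r = (b1 * d2 - b2 * d1)^2 * ?s"
    unfolding q_def r_def ca_def cs_def by (simp add: power2_eq_square algebra_simps)
  then have 3: "?s = q^2 - ?a * r" using det by simp
  have qy: "q * ?y = 1 - ?x * ?a" using 1 by (simp add: eq_diff_eq add.commute)
  have ry: "r * ?y = - (q * ?x)" using 2 by (simp add: eq_neg_iff_add_eq_0 add.commute)
  have "?y * ?s = q * (q * ?y) - ?a * (r * ?y)"
    unfolding 3 by (simp add: power2_eq_square algebra_simps)
  also have "\<dots> = q" unfolding qy ry by (simp add: algebra_simps)
  finally have q: "?y * ?s = q" .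
  have qx: "q * ?x = - (r * ?y)" using ry by simp
  have "- (?x * ?s) = ?x * ?a * r - q * (q * ?x)"
    unfolding 3 by (simp add: power2_eq_square algebra_simps)
  also have "\<dots> = r * (?x * ?a + q * ?y)" unfolding qx by (simp add: algebra_simps)
  finally have xs: "?x * ?s = - r" using 1 by (simp add: minus_equation_iff[of _ r])
  show "?x * ?a + ?s * ?y^2 = 1"
    using 1 unfolding q[symmetric] by (simp add: power2_eq_square algebra_simps)
  have det2: "(b1 * d2 - b2 * d1)^2 = 1" using det by simp
  have w: "b1^2 * ?a + 2 * b1 * d1 * q + d1^2 * r = (b1 * d2 - b2 * d1)^2 * p $ 3"
    "b1 * b2 * ?a + (b1 * d2 + b2 * d1) * q + d1 * d2 * r = (b1 * d2 - b2 * d1)^2 * p $ 4"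
    "b2^2 * ?a + 2 * b2 * d2 * q + d2^2 * r = (b1 * d2 - b2 * d1)^2 * p $ 5"
    unfolding q_def r_def ca_def by (simp_all add: power2_eq_square algebra_simps)
  have z: "d2 * ?x - b2 * ?y = (b1 * d2 - b2 * d1) * p $ 1" "b1 * ?y - d1 * ?x = (b1 * d2 - b2 * d1) * p $ 2"
    unfolding cx_def cy_def by (simp_all add: algebra_simps)
  show "emb ?x ?a ?y ?s = p"
    unfolding vec_eq_iff forall_5 emb_def vec5_nth
    using w z det det2 xs by (simp add: q)
qed

lemma locally_holomorphic_coords [intro, simp]:
  "locally_holomorphic X cx" "locally_holomorphic X cy" "locally_holomorphic X ca" "locally_holomorphic X cs"
  unfolding cx_def[abs_def] cy_def[abs_def] ca_def[abs_def] cs_def[abs_def]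
  by (intro locally_holomorphic_intros)+

section \<open>Tangent vectors in the four coordinates\<close>

definition dcx :: "complex^5 \<Rightarrow> complex" where "dcx v = b1 * v $ 1 + b2 * v $ 2"
definition dcy :: "complex^5 \<Rightarrow> complex" where "dcy v = d1 * v $ 1 + d2 * v $ 2"
definition dca :: "complex^5 \<Rightarrow> complex" where
  "dca v = d2^2 * v $ 3 - 2 * d1 * d2 * v $ 4 + d1^2 * v $ 5"
definition dcs :: "complex^5 \<Rightarrow> complex^5 \<Rightarrow> complex" where
  "dcs p v = 2 * p $ 4 * v $ 4 - p $ 3 * v $ 5 - v $ 3 * p $ 5"

lemma derivative_along_coords:
  assumes "p \<in> X"
  shows "derivative_along X cx p v (dcx v)" "derivative_along X cy p v (dcy v)"
    "derivative_along X ca p v (dca v)" "derivative_along X cs p v (dcs p v)"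
proof -
  show "derivative_along X cx p v (dcx v)"
    unfolding cx_def[abs_def]
    by (rule derivative_along_eq, (rule derivative_along_intros assms)+) (simp add: dcx_def)
  show "derivative_along X cy p v (dcy v)"
    unfolding cy_def[abs_def]
    by (rule derivative_along_eq, (rule derivative_along_intros assms)+) (simp add: dcy_def)
  show "derivative_along X ca p v (dca v)"
    unfolding ca_def[abs_def]
    by (rule derivative_along_eq, (rule derivative_along_intros assms)+) (simp add: dca_def)
  show "derivative_along X cs p v (dcs p v)"
    unfolding cs_def[abs_def]
    by (rule derivative_along_eq, (rule derivative_along_intros assms)+) (simp add: dcs_def)
qed

lemma derivative_along_emb:
  assumes "p \<in> X" "derivative_along X x p v vx" "derivative_along X a p v va"
    "derivative_along X y p v vy" "derivative_along X s p v vs"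
  shows "derivative_along X (\<lambda>q. emb (x q) (a q) (y q) (s q) $ i) p v (dem (x p) (y p) (s p) vx va vy vs $ i)"
proof -
  note D = assms(2-5) derivative_along_intros assms(1)
  have "derivative_along X (\<lambda>q. d2 * x q - b2 * y q) p v (d2 * vx - b2 * vy)"
    by (rule derivative_along_eq, (rule D)+) simp
  moreover have "derivative_along X (\<lambda>q. b1 * y q - d1 * x q) p v (b1 * vy - d1 * vx)"
    by (rule derivative_along_eq, (rule D)+) simp
  moreover have "derivative_along X (\<lambda>q. c * a q + d * (y q * s q) - e * (x q * s q)) p v
      (c * va + d * (y p * vs + vy * s p) - e * (x p * vs + vx * s p))" for c d e
    by (rule derivative_along_eq, (rule D)+) simp
  ultimately show ?thesis
    using exhaust_5[of i] unfolding emb_def dem_def by auto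
qed

text \<open>Both claims differentiate an identity on \<open>X\<close> along \<open>v\<close>: first
  that \<open>emb\<close> of the coordinates is the point itself, then the hypersurface equation.
  Uniqueness of derivatives along tangent vectors identifies the results.\<close>

lemma tangent_vectors_coords:
  assumes p: "p \<in> X" and v: "v \<in> tangent_vectors X p"
  shows "v = dem (cx p) (cy p) (cs p) (dcx v) (dca v) (dcy v) (dcs p v)"
    "ca p * dcx v + cx p * dca v + 2 * cs p * cy p * dcy v + (cy p)^2 * dcs p v = 0"
proof -
  note D = derivative_along_coords[OF p]
  have "v $ i = dem (cx p) (cy p) (cs p) (dcx v) (dca v) (dcy v) (dcs p v) $ i" for i
  proof (rule derivative_along_unique[OF v derivative_along_component])
    show "derivative_along X (\<lambda>q. q $ i) p v (dem (cx p) (cy p) (cs p) (dcx v) (dca v) (dcy v) (dcs p v) $ i)"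
      by (rule derivative_along_cong[OF derivative_along_emb[OF p D(1,3,2,4)]]) (simp add: X_coords)
  qed
  then show "v = dem (cx p) (cy p) (cs p) (dcx v) (dca v) (dcy v) (dcs p v)"
    by (simp add: vec_eq_iff)
  have "derivative_along X (\<lambda>q. cx q * ca q + cs q * (cy q)^2) p v
      (ca p * dcx v + cx p * dca v + 2 * cs p * cy p * dcy v + (cy p)^2 * dcs p v)"
    by (rule derivative_along_eq, (rule D derivative_along_intros p)+) (simp add: algebra_simps)
  moreover have "derivative_along X (\<lambda>q. cx q * ca q + cs q * (cy q)^2) p v 0"
    by (rule derivative_along_cong[OF derivative_along_const[of X 1]]) (simp add: X_coords)
  ultimately show "ca p * dcx v + cx p * dca v + 2 * cs p * cy p * dcy v + (cy p)^2 * dcs p v = 0"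
    by (rule derivative_along_unique[OF v])
qed

lemma emb_curve:
  assumes "(x has_field_derivative vx) (at t)" "(a has_field_derivative va) (at t)"
    "(y has_field_derivative vy) (at t)" "(s has_field_derivative vs) (at t)"
  shows "((\<lambda>t. emb (x t) (a t) (y t) (s t) $ i) has_field_derivative dem (x t) (y t) (s t) vx va vy vs $ i) (at t)"
proof -
  have "((\<lambda>t. d2 * x t - b2 * y t) has_field_derivative (d2 * vx - b2 * vy)) (at t)"
    "((\<lambda>t. b1 * y t - d1 * x t) has_field_derivative (b1 * vy - d1 * vx)) (at t)"
    by (auto intro!: derivative_eq_intros assms)
  moreover have "((\<lambda>t. c * a t + d * (y t * s t) - e * (x t * s t)) has_field_derivative
      (c * va + d * (y t * vs + vy * s t) - e * (x t * vs + vx * s t))) (at t)" for c d e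
    by (auto intro!: derivative_eq_intros assms simp: algebra_simps)
  ultimately show ?thesis
    using exhaust_5[of i] unfolding emb_def dem_def by auto
qed

lemma emb_holomorphic:
  assumes "x holomorphic_on S" "a holomorphic_on S" "y holomorphic_on S" "s holomorphic_on S"
  shows "(\<lambda>t. emb (x t) (a t) (y t) (s t) $ i) holomorphic_on S"
proof -
  have "(\<lambda>t. d2 * x t - b2 * y t) holomorphic_on S" "(\<lambda>t. b1 * y t - d1 * x t) holomorphic_on S"
    by (intro holomorphic_intros assms)+
  moreover have "(\<lambda>t. c * a t + d * (y t * s t) - e * (x t * s t)) holomorphic_on S" for c d e
    by (intro holomorphic_intros assms)
  ultimately show ?thesis
    using exhaust_5[of i] unfolding emb_def by auto
qed

lemma emb_continuous_on:
  assumes "continuous_on S x" "continuous_on S a" "continuous_on S y" "continuous_on S s"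
  shows "continuous_on S (\<lambda>t. emb (x t) (a t) (y t) (s t))"
proof (rule continuous_on_components)
  fix i
  have "continuous_on S (\<lambda>t. d2 * x t - b2 * y t)" "continuous_on S (\<lambda>t. b1 * y t - d1 * x t)"
    by (intro continuous_intros assms)+
  moreover have "continuous_on S (\<lambda>t. c * a t + d * (y t * s t) - e * (x t * s t))" for c d e
    by (intro continuous_intros assms)
  ultimately show "continuous_on S (\<lambda>t. emb (x t) (a t) (y t) (s t) $ i)"
    using exhaust_5[of i] unfolding emb_def by auto
qed

lemma tangent_curve:
  assumes p: "p \<in> X" and r: "r > 0"
    and start: "x 0 = cx p" "a 0 = ca p" "y 0 = cy p" "s 0 = cs p"
    and hol: "x holomorphic_on ball 0 r" "a holomorphic_on ball 0 r" "y holomorphic_on ball 0 r"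
      "s holomorphic_on ball 0 r"
    and der: "(x has_field_derivative vx) (at 0)" "(a has_field_derivative va) (at 0)"
      "(y has_field_derivative vy) (at 0)" "(s has_field_derivative vs) (at 0)"
    and rel: "\<And>t. t \<in> ball 0 r \<Longrightarrow> x t * a t + s t * (y t)^2 = 1"
  shows "dem (cx p) (cy p) (cs p) vx va vy vs \<in> tangent_vectors X p"
  unfolding tangent_vectors_def
proof (intro CollectI exI conjI allI)
  show "emb (x 0) (a 0) (y 0) (s 0) = p"
    using X_coords(2)[OF p] by (simp add: start)
  show "(\<lambda>t. emb (x t) (a t) (y t) (s t)) ` ball 0 r \<subseteq> X"
    using emb_in_X[OF rel] by blast
  show "(\<lambda>t. emb (x t) (a t) (y t) (s t) $ i) holomorphic_on ball 0 r" for i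
    by (rule emb_holomorphic[OF hol])
  show "((\<lambda>t. emb (x t) (a t) (y t) (s t) $ i) has_field_derivative
      dem (cx p) (cy p) (cs p) vx va vy vs $ i) (at 0)" for i
    using emb_curve[OF der, of i] by (simp add: start)
qed (rule r)

text \<open>The \<open>1\<close> added in the denominator keeps the radius positive for
  \<open>v = 0\<close> and the inequality strict.\<close>

lemma nonzero_on_ball:
  fixes c v t :: complex
  assumes "c \<noteq> 0" "t \<in> ball 0 (norm c / (norm v + 1))"
  shows "c + v * t \<noteq> 0"
proof
  assume "c + v * t = 0"
  then have "norm c = norm v * norm t" by (metis add_eq_0_iff norm_minus_cancel norm_mult)
  also have "\<dots> \<le> (norm v + 1) * norm t" by (simp add: distrib_right)
  also have "\<dots> < norm c" using assms(2) by (simp add: pos_less_divide_eq mult.commute add_nonneg_pos)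
  finally show False by simp
qed

text \<open>The equation \<open>x a + s y^2 = 1\<close> forces \<open>x\<close> or \<open>y\<close>
  to be nonzero. In the first case \<open>x\<close>, \<open>y\<close>, \<open>s\<close> move
  linearly and \<open>a\<close> is solved for; in the second \<open>x\<close>, \<open>a\<close>,
  \<open>y\<close> move linearly and \<open>s\<close> is solved for. The linear condition gives the
  solved coordinate the prescribed velocity.\<close>

lemma dem_tangent:
  assumes p: "p \<in> X" and tan: "ca p * vx + cx p * va + 2 * cs p * cy p * vy + (cy p)^2 * vs = 0"
  shows "dem (cx p) (cy p) (cs p) vx va vy vs \<in> tangent_vectors X p"
proof -
  have rel: "cx p * ca p + cs p * (cy p)^2 = 1" by (rule X_coords(1)[OF p])
  consider "cx p \<noteq> 0" | "cy p \<noteq> 0" using rel by fastforce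
  then show ?thesis
  proof cases
    case 1
    let ?r = "norm (cx p) / (norm vx + 1)"
    have r: "?r > 0" using 1 by (simp add: add_nonneg_pos)
    have nz: "cx p + vx * t \<noteq> 0" if "t \<in> ball 0 ?r" for t
      using nonzero_on_ball[OF 1 that] .
    show ?thesis
    proof (rule tangent_curve[OF p r, where x = "\<lambda>t. cx p + vx * t" and y = "\<lambda>t. cy p + vy * t"
          and s = "\<lambda>t. cs p + vs * t"])
      let ?a = "\<lambda>t. (1 - (cs p + vs * t) * (cy p + vy * t)^2) / (cx p + vx * t)"
      show "?a holomorphic_on ball 0 ?r"
        using nz by (intro holomorphic_intros) auto
      show "?a 0 = ca p"
        using 1 rel by (simp add: field_simps) algebra
      have "(?a has_field_derivative ((- (vs * (cy p)^2 + cs p * (2 * cy p * vy))) * cx p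
          - (1 - cs p * (cy p)^2) * vx) / (cx p * cx p)) (at 0)"
        using 1 by (auto intro!: derivative_eq_intros)
      moreover have "((- (vs * (cy p)^2 + cs p * (2 * cy p * vy))) * cx p
          - (1 - cs p * (cy p)^2) * vx) = va * (cx p * cx p)"
      proof -
        have e1: "1 - cs p * (cy p)^2 = cx p * ca p" using rel by (simp add: diff_eq_eq)
        have e2: "vs * (cy p)^2 + cs p * (2 * cy p * vy) = - (ca p * vx + cx p * va)"
          using tan by (simp add: eq_neg_iff_add_eq_0 algebra_simps)
        show ?thesis unfolding e1 e2 by (simp add: algebra_simps)
      qed
      ultimately show "(?a has_field_derivative va) (at 0)" using 1 by simp
      show "(cx p + vx * t) * ?a t + (cs p + vs * t) * (cy p + vy * t)^2 = 1" if "t \<in> ball 0 ?r" for t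
        using nz[OF that] by simp
    qed (auto intro!: holomorphic_intros derivative_eq_intros)
  next
    case 2
    let ?r = "norm (cy p) / (norm vy + 1)"
    have r: "?r > 0" using 2 by (simp add: add_nonneg_pos)
    have nz: "cy p + vy * t \<noteq> 0" if "t \<in> ball 0 ?r" for t
      using nonzero_on_ball[OF 2 that] .
    show ?thesis
    proof (rule tangent_curve[OF p r, where x = "\<lambda>t. cx p + vx * t" and y = "\<lambda>t. cy p + vy * t"
          and a = "\<lambda>t. ca p + va * t"])
      let ?s = "\<lambda>t. (1 - (cx p + vx * t) * (ca p + va * t)) / (cy p + vy * t)^2"
      show "?s holomorphic_on ball 0 ?r"
        using nz by (intro holomorphic_intros) auto
      show "?s 0 = cs p"
        using 2 rel by (simp add: field_simps) algebra
      have "(?s has_field_derivative ((- (vx * ca p + cx p * va)) * (cy p)^2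
          - (1 - cx p * ca p) * (2 * cy p * vy)) / ((cy p)^2 * (cy p)^2)) (at 0)"
        using 2 by (auto intro!: derivative_eq_intros)
      moreover have "((- (vx * ca p + cx p * va)) * (cy p)^2
          - (1 - cx p * ca p) * (2 * cy p * vy)) = vs * ((cy p)^2 * (cy p)^2)"
      proof -
        have e1: "1 - cx p * ca p = cs p * (cy p)^2" using rel by (simp add: diff_eq_eq add.commute)
        have e2: "vx * ca p + cx p * va = - (cs p * (2 * cy p * vy) + (cy p)^2 * vs)"
          using tan by (simp add: eq_neg_iff_add_eq_0 algebra_simps)
        show ?thesis unfolding e1 e2 by (simp add: algebra_simps)
      qed
      ultimately show "(?s has_field_derivative vs) (at 0)" using 2 by simp
      show "(cx p + vx * t) * (ca p + va * t) + ?s t * (cy p + vy * t)^2 = 1" if "t \<in> ball 0 ?r" for t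
        using nz[OF that] by simp
    qed (auto intro!: holomorphic_intros derivative_eq_intros)
  qed
qed

end

section \<open>The six generating fields\<close>

context variety_chart
begin

text \<open>The field with \<open>V(x) = v\<^sub>x\<close>, \<open>V(a) = v\<^sub>a\<close>, \<open>V(y) = v\<^sub>y\<close>, \<open>V(s) = v\<^sub>s\<close>.\<close>

definition fld :: "(complex^5 \<Rightarrow> complex) \<Rightarrow> (complex^5 \<Rightarrow> complex) \<Rightarrow> (complex^5 \<Rightarrow> complex) \<Rightarrow>
    (complex^5 \<Rightarrow> complex) \<Rightarrow> complex^5 \<Rightarrow> complex^5" where
  "fld vx va vy vs = (\<lambda>p. if p \<in> X then dem (cx p) (cy p) (cs p) (vx p) (va p) (vy p) (vs p) else 0)"

text \<open>The derivative of the hypersurface equation \<open>x * a + s * y^2 = 1\<close> along the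
  field.\<close>

definition tangential :: "(complex^5 \<Rightarrow> complex) \<Rightarrow> (complex^5 \<Rightarrow> complex) \<Rightarrow> (complex^5 \<Rightarrow> complex) \<Rightarrow>
    (complex^5 \<Rightarrow> complex) \<Rightarrow> bool" where
  "tangential vx va vy vs \<longleftrightarrow>
     (\<forall>p\<in>X. ca p * vx p + cx p * va p + 2 * cs p * cy p * vy p + (cy p)^2 * vs p = 0)"

text \<open>The three linear coordinates are inverted by the determinant. The differential of
  \<open>s\<close> comes out as \<open>s\<close> times the tangency expression plus
  \<open>(x * a + s * y^2) * vs\<close>.\<close>

lemma dcoords_dem:
  assumes "p \<in> X" and tan: "ca p * vx + cx p * va + 2 * cs p * cy p * vy + (cy p)^2 * vs = 0"
  defines "v \<equiv> dem (cx p) (cy p) (cs p) vx va vy vs"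
  shows "dcx v = vx" "dca v = va" "dcy v = vy" "dcs p v = vs"
proof -
  have "dcx v = (b1 * d2 - b2 * d1) * vx"
    unfolding dcx_def v_def dem_def vec5_nth by (simp add: algebra_simps)
  then show "dcx v = vx" using det by simp
  have "dcy v = (b1 * d2 - b2 * d1) * vy"
    unfolding dcy_def v_def dem_def vec5_nth by (simp add: algebra_simps)
  then show "dcy v = vy" using det by simp
  have "dca v = (b1 * d2 - b2 * d1)^2 * va"
    unfolding dca_def v_def dem_def vec5_nth by (simp add: power2_eq_square algebra_simps)
  then show "dca v = va" using det by simp
  define x a y s where xs: "x = cx p" "a = ca p" "y = cy p" "s = cs p"
  have p: "p = emb x a y s" using X_coords(2)[OF assms(1)] by (simp add: xs)
  have P: "p $ 3 = b1^2 * a + 2 * b1 * d1 * (y * s) - d1^2 * (x * s)"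
    "p $ 4 = b1 * b2 * a + (b1 * d2 + b2 * d1) * (y * s) - d1 * d2 * (x * s)"
    "p $ 5 = b2^2 * a + 2 * b2 * d2 * (y * s) - d2^2 * (x * s)"
    by (subst p, simp add: emb_def)+
  have "dcs p v = (b1 * d2 - b2 * d1)^2 *
      (2 * (y * s) * (y * vs + vy * s) + a * (x * vs + vx * s) + va * (x * s))"
    unfolding dcs_def P v_def dem_def xs[symmetric] vec5_nth
    by (simp add: power2_eq_square algebra_simps)
  also have "\<dots> = 2 * (y * s) * (y * vs + vy * s) + a * (x * vs + vx * s) + va * (x * s)"
    using det by simp
  also have "\<dots> = s * (a * vx + x * va + 2 * s * y * vy + y^2 * vs) + (x * a + s * y^2) * vs"
    by (simp add: power2_eq_square algebra_simps)
  also have "\<dots> = vs"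
    using tan X_coords(1)[OF assms(1)] by (simp add: xs)
  finally show "dcs p v = vs" .
qed

lemma fld_in_vector_fields:
  assumes "tangential vx va vy vs"
    and hol: "locally_holomorphic X vx" "locally_holomorphic X va" "locally_holomorphic X vy" "locally_holomorphic X vs"
  shows "fld vx va vy vs \<in> vector_fields X"
  unfolding vector_fields_def
proof (intro CollectI conjI allI ballI)
  fix i
  note H = hol locally_holomorphic_coords
  have "locally_holomorphic X (\<lambda>p. d2 * vx p - b2 * vy p)" "locally_holomorphic X (\<lambda>p. b1 * vy p - d1 * vx p)"
    by (rule H locally_holomorphic_intros)+
  moreover have "locally_holomorphic X (\<lambda>p. c * va p + d * (cy p * vs p + vy p * cs p) - e * (cx p * vs p + vx p * cs p))" for c d e
    by (rule H locally_holomorphic_intros)+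
  ultimately have "locally_holomorphic X (\<lambda>p. dem (cx p) (cy p) (cs p) (vx p) (va p) (vy p) (vs p) $ i)"
    using exhaust_5[of i] unfolding dem_def by auto
  then have "locally_holomorphic X (\<lambda>p. fld vx va vy vs p $ i)"
    by (rule locally_holomorphic_cong) (simp add: fld_def)
  then show "(\<lambda>p. fld vx va vy vs p $ i) \<in> hol_functions X"
    by (simp add: hol_functions_iff fld_def)
next
  fix p assume "p \<in> X"
  then show "fld vx va vy vs p \<in> tangent_vectors X p"
    using assms(1) by (simp add: fld_def tangential_def dem_tangent)
qed

lemma derivative_along_fld:
  assumes "V = fld vx va vy vs" "tangential vx va vy vs" and p: "p \<in> X"
  shows "derivative_along X cx p (V p) (vx p)" "derivative_along X ca p (V p) (va p)"
    "derivative_along X cy p (V p) (vy p)" "derivative_along X cs p (V p) (vs p)"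
proof -
  have V: "V p = dem (cx p) (cy p) (cs p) (vx p) (va p) (vy p) (vs p)"
    using assms(1) p by (simp add: fld_def)
  have tan: "ca p * vx p + cx p * va p + 2 * cs p * cy p * vy p + (cy p)^2 * vs p = 0"
    using assms(2) p by (simp add: tangential_def)
  note D = derivative_along_coords[OF p, of "V p"]
  show "derivative_along X cx p (V p) (vx p)" "derivative_along X ca p (V p) (va p)"
    "derivative_along X cy p (V p) (vy p)" "derivative_along X cs p (V p) (vs p)"
    using D dcoords_dem[OF p tan] unfolding V by simp_all
qed

text \<open>Product rule: the first term differentiates the coefficients of \<open>W\<close>, the
  other two together form the second derivative of \<open>emb\<close> on the two vectors.
  Subtracting \<open>dem 0 0 0\<close> removes the part that is linear in \<open>W\<close>
  alone.\<close>

lemma derivative_along_fld_component: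
  assumes W: "W = fld wx wa wy ws" and p: "p \<in> X"
    and V: "derivative_along X cx p v vx" "derivative_along X cy p v vy" "derivative_along X cs p v vs"
    and D: "derivative_along X wx p v ex" "derivative_along X wa p v ea"
      "derivative_along X wy p v ey" "derivative_along X ws p v es"
  shows "derivative_along X (\<lambda>q. W q $ i) p v
    ((dem (cx p) (cy p) (cs p) ex ea ey es + dem vx vy vs (wx p) 0 (wy p) (ws p) - dem 0 0 0 (wx p) 0 (wy p) 0) $ i)"
proof (rule derivative_along_cong)
  note R = V D derivative_along_intros p
  have "derivative_along X (\<lambda>q. d2 * wx q - b2 * wy q) p v (d2 * ex - b2 * ey)"
    by (rule derivative_along_eq, (rule R)+) simp
  moreover have "derivative_along X (\<lambda>q. b1 * wy q - d1 * wx q) p v (b1 * ey - d1 * ex)"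
    by (rule derivative_along_eq, (rule R)+) simp
  moreover have "derivative_along X (\<lambda>q. c * wa q + d * (cy q * ws q + wy q * cs q) - e * (cx q * ws q + wx q * cs q)) p v
      (c * ea + d * (cy p * es + ey * cs p) - e * (cx p * es + ex * cs p)
       + (d * (vy * ws p + wy p * vs) - e * (vx * ws p + wx p * vs)))" for c d e
    by (rule derivative_along_eq, (rule R)+) (simp add: algebra_simps)
  ultimately show "derivative_along X (\<lambda>q. dem (cx q) (cy q) (cs q) (wx q) (wa q) (wy q) (ws q) $ i) p v
    ((dem (cx p) (cy p) (cs p) ex ea ey es + dem vx vy vs (wx p) 0 (wy p) (ws p) - dem 0 0 0 (wx p) 0 (wy p) 0) $ i)"
    using exhaust_5[of i] unfolding dem_def by (auto simp: add_diff_eq)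
  show "dem (cx q) (cy q) (cs q) (wx q) (wa q) (wy q) (ws q) $ i = W q $ i" if "q \<in> X" for q
    using that by (simp add: W fld_def)
qed

text \<open>The second derivative of \<open>emb\<close> is symmetric and cancels in the bracket,
  leaving the differences of the derivatives of the coefficients.\<close>

lemma lie_bracket_fld:
  assumes V: "V = fld vx va vy vs" "tangential vx va vy vs"
    and W: "W = fld wx wa wy ws" "tangential wx wa wy ws"
    and p: "p \<in> X"
    and D: "derivative_along X wx p (V p) ex" "derivative_along X wa p (V p) ea"
      "derivative_along X wy p (V p) ey" "derivative_along X ws p (V p) es"
    and E: "derivative_along X vx p (W p) fx" "derivative_along X va p (W p) fa"
      "derivative_along X vy p (W p) fy" "derivative_along X vs p (W p) fs"
  shows "lie_bracket X V W p = dem (cx p) (cy p) (cs p) (ex - fx) (ea - fa) (ey - fy) (es - fs)"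
proof -
  have tV: "V p \<in> tangent_vectors X p"
    using V p by (simp add: fld_def tangential_def dem_tangent)
  have tW: "W p \<in> tangent_vectors X p"
    using W p by (simp add: fld_def tangential_def dem_tangent)
  note dV = derivative_along_fld[OF V p] and dW = derivative_along_fld[OF W p]
  have 1: "apply_field X V (\<lambda>q. W q $ i) p =
    (dem (cx p) (cy p) (cs p) ex ea ey es + dem (vx p) (vy p) (vs p) (wx p) 0 (wy p) (ws p) - dem 0 0 0 (wx p) 0 (wy p) 0) $ i" for i
    by (rule apply_field_eq[where V=V, OF derivative_along_fld_component[OF W(1) p dV(1,3,4) D] tV p])
  have 2: "apply_field X W (\<lambda>q. V q $ i) p =
    (dem (cx p) (cy p) (cs p) fx fa fy fs + dem (wx p) (wy p) (ws p) (vx p) 0 (vy p) (vs p) - dem 0 0 0 (vx p) 0 (vy p) 0) $ i" for i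
    by (rule apply_field_eq[where V=W, OF derivative_along_fld_component[OF V(1) p dW(1,3,4) E] tW p])
  show ?thesis
    unfolding lie_bracket_def 1 2 unfolding vec_eq_iff forall_5
    by (simp add: dem_def algebra_simps)
qed

definition D1 :: "complex^5 \<Rightarrow> complex^5" where
  "D1 = fld (\<lambda>p. 0) (\<lambda>p. - 2 * cs p * cy p) cx (\<lambda>p. 0)"
definition D2 :: "complex^5 \<Rightarrow> complex^5" where
  "D2 = fld (\<lambda>p. 0) (\<lambda>p. - (cy p * cy p)) (\<lambda>p. 0) cx"
definition D3 :: "complex^5 \<Rightarrow> complex^5" where
  "D3 = fld (\<lambda>p. - 2 * cs p * cy p) (\<lambda>p. 0) ca (\<lambda>p. 0)"
definition D4 :: "complex^5 \<Rightarrow> complex^5" where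
  "D4 = fld (\<lambda>p. - (cy p * cy p)) (\<lambda>p. 0) (\<lambda>p. 0) ca"
definition E1 :: "complex^5 \<Rightarrow> complex^5" where
  "E1 = fld cx (\<lambda>p. - ca p) (\<lambda>p. 0) (\<lambda>p. 0)"
definition E2 :: "complex^5 \<Rightarrow> complex^5" where
  "E2 = fld (\<lambda>p. 0) (\<lambda>p. 0) cy (\<lambda>p. - 2 * cs p)"

lemma tangential_fields:
  "tangential (\<lambda>p. 0) (\<lambda>p. - 2 * cs p * cy p) cx (\<lambda>p. 0)"
  "tangential (\<lambda>p. 0) (\<lambda>p. - (cy p * cy p)) (\<lambda>p. 0) cx"
  "tangential (\<lambda>p. - 2 * cs p * cy p) (\<lambda>p. 0) ca (\<lambda>p. 0)"
  "tangential (\<lambda>p. - (cy p * cy p)) (\<lambda>p. 0) (\<lambda>p. 0) ca"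
  "tangential cx (\<lambda>p. - ca p) (\<lambda>p. 0) (\<lambda>p. 0)"
  "tangential (\<lambda>p. 0) (\<lambda>p. 0) cy (\<lambda>p. - 2 * cs p)"
  by (simp_all add: tangential_def power2_eq_square)

lemma fields_in_vector_fields:
  "D1 \<in> vector_fields X" "D2 \<in> vector_fields X" "D3 \<in> vector_fields X" "D4 \<in> vector_fields X"
  "E1 \<in> vector_fields X" "E2 \<in> vector_fields X"
  unfolding D1_def D2_def D3_def D4_def E1_def E2_def
  by (rule fld_in_vector_fields tangential_fields locally_holomorphic_coords locally_holomorphic_intros)+

text \<open>Four facts per field, on \<open>cx\<close>, \<open>ca\<close>, \<open>cy\<close>,
  \<open>cs\<close> in this order, for \<open>D1\<close> to \<open>D4\<close>, \<open>E1\<close>,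
  \<open>E2\<close>; later references go by position.\<close>

lemmas fields_derivs =
  derivative_along_fld[OF D1_def tangential_fields(1)] derivative_along_fld[OF D2_def tangential_fields(2)]
  derivative_along_fld[OF D3_def tangential_fields(3)] derivative_along_fld[OF D4_def tangential_fields(4)]
  derivative_along_fld[OF E1_def tangential_fields(5)] derivative_along_fld[OF E2_def tangential_fields(6)]

lemma dem_linear:
  "c *s dem x y s vx va vy vs = dem x y s (c * vx) (c * va) (c * vy) (c * vs)"
  "dem x y s vx va vy vs + dem x y s wx wa wy ws = dem x y s (vx + wx) (va + wa) (vy + wy) (vs + ws)"
  unfolding vec_eq_iff forall_5 by (simp_all add: dem_def algebra_simps)

section \<open>Brackets of the generating fields\<close>

lemma bracket_D3_D2: "lie_bracket X D3 D2 = (\<lambda>p. (2 * cy p) *s E1 p + cy p *s E2 p)"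
proof
  fix p
  show "lie_bracket X D3 D2 p = (2 * cy p) *s E1 p + cy p *s E2 p"
  proof (cases "p \<in> X")
    case p: True
    \<comment> \<open>Each difference applies \<open>D3\<close> to a coefficient of
      \<open>D2\<close> and subtracts \<open>D2\<close> of the matching coefficient of
      \<open>D3\<close>.\<close>
    have "lie_bracket X D3 D2 p = dem (cx p) (cy p) (cs p)
        (0 - (- 2 * cx p * cy p)) (- (2 * cy p * ca p) - 0) (0 - (- (cy p * cy p))) (- 2 * cs p * cy p - 0)"
      by (rule lie_bracket_fld[OF D3_def tangential_fields(3) D2_def tangential_fields(2) p];
          rule derivative_along_eq, (rule fields_derivs derivative_along_intros p)+, simp)
    then show ?thesis
      using p by (simp add: E1_def E2_def fld_def dem_linear mult_ac)
  qed (simp add: lie_bracket_def apply_field_outside E1_def E2_def fld_def vec_eq_iff)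
qed

text \<open>Mirror image of the preceding bracket: exchanging \<open>x\<close> and \<open>a\<close>
  swaps \<open>D1\<close> with \<open>D3\<close> and \<open>D2\<close> with \<open>D4\<close>,
  changes the sign of \<open>E1\<close> and fixes \<open>E2\<close>.\<close>

lemma bracket_D1_D4: "lie_bracket X D1 D4 = (\<lambda>p. (- 2 * cy p) *s E1 p + cy p *s E2 p)"
proof
  fix p
  show "lie_bracket X D1 D4 p = (- 2 * cy p) *s E1 p + cy p *s E2 p"
  proof (cases "p \<in> X")
    case p: True
    have "lie_bracket X D1 D4 p = dem (cx p) (cy p) (cs p)
        (- (2 * cy p * cx p) - 0) (0 - (- 2 * ca p * cy p)) (0 - (- (cy p * cy p))) (- 2 * cs p * cy p - 0)"
      by (rule lie_bracket_fld[OF D1_def tangential_fields(1) D4_def tangential_fields(4) p];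
          rule derivative_along_eq, (rule fields_derivs derivative_along_intros p)+, simp)
    then show ?thesis
      using p by (simp add: E1_def E2_def fld_def dem_linear mult_ac)
  qed (simp add: lie_bracket_def apply_field_outside E1_def E2_def fld_def vec_eq_iff)
qed

text \<open>\<open>E1\<close> gives \<open>x\<close> and \<open>a\<close> the weights
  \<open>1\<close> and \<open>-1\<close>, and \<open>E2\<close> gives \<open>y\<close> and
  \<open>s\<close> the weights \<open>1\<close> and \<open>-2\<close>. The fields \<open>D1\<close>,
  \<open>D2\<close>, \<open>D4\<close> are homogeneous, and this and the following three brackets
  read off their weights.\<close>

lemma bracket_E1_D1: "lie_bracket X E1 D1 = D1"
proof
  fix p
  show "lie_bracket X E1 D1 p = D1 p"
  proof (cases "p \<in> X")
    case p: True
    have "lie_bracket X E1 D1 p = dem (cx p) (cy p) (cs p)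
        (0 - 0) (0 - 2 * cs p * cy p) (cx p - 0) (0 - 0)"
      by (rule lie_bracket_fld[OF E1_def tangential_fields(5) D1_def tangential_fields(1) p];
          rule derivative_along_eq, (rule fields_derivs derivative_along_intros p)+, simp)
    then show ?thesis
      using p by (simp add: D1_def fld_def)
  qed (simp add: lie_bracket_def apply_field_outside D1_def fld_def vec_eq_iff)
qed

lemma bracket_E2_D1: "lie_bracket X E2 D1 = (\<lambda>p. - D1 p)"
proof
  fix p
  show "lie_bracket X E2 D1 p = - D1 p"
  proof (cases "p \<in> X")
    case p: True
    have "lie_bracket X E2 D1 p = dem (cx p) (cy p) (cs p)
        (0 - 0) (2 * cs p * cy p - 0) (0 - cx p) (0 - 0)"
      by (rule lie_bracket_fld[OF E2_def tangential_fields(6) D1_def tangential_fields(1) p];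
          rule derivative_along_eq, (rule fields_derivs derivative_along_intros p)+, simp)
    then show ?thesis
      using p dem_linear(1)[of "-1" "cx p" "cy p" "cs p"] by (simp add: D1_def fld_def)
  qed (simp add: lie_bracket_def apply_field_outside D1_def fld_def vec_eq_iff)
qed

lemma bracket_E2_D2: "lie_bracket X E2 D2 = (\<lambda>p. 2 *s D2 p)"
proof
  fix p
  show "lie_bracket X E2 D2 p = 2 *s D2 p"
  proof (cases "p \<in> X")
    case p: True
    have "lie_bracket X E2 D2 p = dem (cx p) (cy p) (cs p)
        (0 - 0) (- (2 * cy p * cy p) - 0) (0 - 0) (0 - (- 2 * cx p))"
      by (rule lie_bracket_fld[OF E2_def tangential_fields(6) D2_def tangential_fields(2) p];
          rule derivative_along_eq, (rule fields_derivs derivative_along_intros p)+, simp)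
    then show ?thesis
      using p by (simp add: D2_def fld_def dem_linear mult_ac)
  qed (simp add: lie_bracket_def apply_field_outside D2_def fld_def vec_eq_iff)
qed

lemma bracket_E2_D4: "lie_bracket X E2 D4 = (\<lambda>p. 2 *s D4 p)"
proof
  fix p
  show "lie_bracket X E2 D4 p = 2 *s D4 p"
  proof (cases "p \<in> X")
    case p: True
    have "lie_bracket X E2 D4 p = dem (cx p) (cy p) (cs p)
        (- (2 * cy p * cy p) - 0) (0 - 0) (0 - 0) (0 - (- 2 * ca p))"
      by (rule lie_bracket_fld[OF E2_def tangential_fields(6) D4_def tangential_fields(4) p];
          rule derivative_along_eq, (rule fields_derivs derivative_along_intros p)+, simp)
    then show ?thesis
      using p by (simp add: D4_def fld_def dem_linear mult_ac)
  qed (simp add: lie_bracket_def apply_field_outside D4_def fld_def vec_eq_iff)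
qed

section \<open>Complete multiples of the locally nilpotent fields\<close>

lemma complete_fld:
  assumes V: "V = fld vx va vy vs" "V \<in> vector_fields X" and q: "locally_holomorphic X q"
    and p0: "\<And>p. p \<in> X \<Longrightarrow> x p 0 = cx p \<and> a p 0 = ca p \<and> y p 0 = cy p \<and> s p 0 = cs p"
    and rel: "\<And>p t. p \<in> X \<Longrightarrow> x p t * a p t + s p t * (y p t)^2 = 1"
    and der: "\<And>p t \<gamma>. p \<in> X \<Longrightarrow> \<gamma> = emb (x p t) (a p t) (y p t) (s p t) \<Longrightarrow>
      cx \<gamma> = x p t \<Longrightarrow> ca \<gamma> = a p t \<Longrightarrow> cy \<gamma> = y p t \<Longrightarrow> cs \<gamma> = s p t \<Longrightarrow>
      (x p has_field_derivative vx \<gamma>) (at t) \<and> (a p has_field_derivative va \<gamma>) (at t) \<and>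
      (y p has_field_derivative vy \<gamma>) (at t) \<and> (s p has_field_derivative vs \<gamma>) (at t)"
    and affine: "\<And>p. p \<in> X \<Longrightarrow> \<exists>\<beta>. \<forall>t. q (emb (x p t) (a p t) (y p t) (s p t)) = q p + \<beta> * t"
  shows "scale_field q V \<in> complete_fields X"
proof (rule complete_scale_field[OF V(2) q])
  fix p assume p: "p \<in> X"
  let ?\<gamma> = "\<lambda>t. emb (x p t) (a p t) (y p t) (s p t)"
  obtain \<beta> where \<beta>: "\<forall>t. q (?\<gamma> t) = q p + \<beta> * t" using affine[OF p] by blast
  have X: "?\<gamma> t \<in> X" for t by (rule emb_in_X[OF rel[OF p]])
  note C = coords_emb(1-3) coords_emb(4)[OF rel[OF p]]
  have "((\<lambda>t. ?\<gamma> t $ i) has_field_derivative V (?\<gamma> t) $ i) (at t)" for t i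
    using emb_curve[of "x p" _ t "a p" _ "y p" _ "s p"] der[OF p refl, of t, OF C(1,3,2,4)] X[of t]
    unfolding V(1) fld_def by (simp add: C)
  moreover have "?\<gamma> 0 = p" using p0[OF p] X_coords(2)[OF p] by simp
  ultimately show "\<exists>\<gamma> \<alpha> \<beta>. \<gamma> 0 = p \<and> (\<forall>t. \<gamma> t \<in> X) \<and>
      (\<forall>t i. ((\<lambda>s. \<gamma> s $ i) has_field_derivative V (\<gamma> t) $ i) (at t)) \<and> (\<forall>t. q (\<gamma> t) = \<alpha> + \<beta> * t)"
    using X \<beta> by (intro exI[of _ ?\<gamma>] exI[of _ "q p"] exI[of _ \<beta>]) simp
qed

text \<open>The flow is polynomial in time: \<open>x\<close> and \<open>s\<close> are fixed,
  \<open>y\<close> is linear and \<open>a\<close> quadratic. Its four coordinate functions are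
  passed to \<open>complete_fld\<close> by unification with the second assumption; the same is done
  for the other three fields.\<close>

lemma complete_D1:
  assumes "locally_holomorphic X q"
    and "\<And>p. p \<in> X \<Longrightarrow> \<exists>\<beta>. \<forall>t. q (emb (cx p) (ca p - cs p * (2 * cy p * t + cx p * t^2)) (cy p + cx p * t) (cs p)) = q p + \<beta> * t"
  shows "scale_field q D1 \<in> complete_fields X"
proof (rule complete_fld[OF D1_def fields_in_vector_fields(1) assms(1) _ _ _ assms(2)])
  fix p t assume "p \<in> X"
  from X_coords(1)[OF this]
  show "cx p * (ca p - cs p * (2 * cy p * t + cx p * t^2)) + cs p * (cy p + cx p * t)^2 = 1"
    by (simp add: power2_eq_square algebra_simps)
qed (auto intro!: derivative_eq_intros simp: algebra_simps)

lemma complete_D2: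
  assumes "locally_holomorphic X q"
    and "\<And>p. p \<in> X \<Longrightarrow> \<exists>\<beta>. \<forall>t. q (emb (cx p) (ca p - (cy p)^2 * t) (cy p) (cs p + cx p * t)) = q p + \<beta> * t"
  shows "scale_field q D2 \<in> complete_fields X"
proof (rule complete_fld[OF D2_def fields_in_vector_fields(2) assms(1) _ _ _ assms(2)])
  fix p t assume "p \<in> X"
  from X_coords(1)[OF this]
  show "cx p * (ca p - (cy p)^2 * t) + (cs p + cx p * t) * (cy p)^2 = 1"
    by (simp add: power2_eq_square algebra_simps)
qed (auto intro!: derivative_eq_intros simp: power2_eq_square)

lemma complete_D3:
  assumes "locally_holomorphic X q"
    and "\<And>p. p \<in> X \<Longrightarrow> \<exists>\<beta>. \<forall>t. q (emb (cx p - cs p * (2 * cy p * t + ca p * t^2)) (ca p) (cy p + ca p * t) (cs p)) = q p + \<beta> * t"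
  shows "scale_field q D3 \<in> complete_fields X"
proof (rule complete_fld[OF D3_def fields_in_vector_fields(3) assms(1) _ _ _ assms(2)])
  fix p t assume "p \<in> X"
  from X_coords(1)[OF this]
  show "(cx p - cs p * (2 * cy p * t + ca p * t^2)) * ca p + cs p * (cy p + ca p * t)^2 = 1"
    by (simp add: power2_eq_square algebra_simps)
qed (auto intro!: derivative_eq_intros simp: algebra_simps)

lemma complete_D4:
  assumes "locally_holomorphic X q"
    and "\<And>p. p \<in> X \<Longrightarrow> \<exists>\<beta>. \<forall>t. q (emb (cx p - (cy p)^2 * t) (ca p) (cy p) (cs p + ca p * t)) = q p + \<beta> * t"
  shows "scale_field q D4 \<in> complete_fields X"
proof (rule complete_fld[OF D4_def fields_in_vector_fields(4) assms(1) _ _ _ assms(2)])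
  fix p t assume "p \<in> X"
  from X_coords(1)[OF this]
  show "(cx p - (cy p)^2 * t) * ca p + (cs p + ca p * t) * (cy p)^2 = 1"
    by (simp add: power2_eq_square algebra_simps)
qed (auto intro!: derivative_eq_intros simp: power2_eq_square)

end

section \<open>Polynomial vector fields in the Lie algebra\<close>

context variety_chart
begin

abbreviation Lie :: "(complex^5 \<Rightarrow> complex^5) set" where
  "Lie \<equiv> lie_generated X (complete_fields X)"

text \<open>Grouped so that the first factor is annihilated by \<open>D2\<close> and the second by
  \<open>D3\<close>. The exponents \<open>i\<close>, \<open>j\<close>, \<open>k\<close>,
  \<open>l\<close> belong to \<open>x\<close>, \<open>a\<close>, \<open>y\<close>,
  \<open>s\<close>.\<close>

definition monomial :: "nat \<Rightarrow> nat \<Rightarrow> nat \<Rightarrow> nat \<Rightarrow> complex^5 \<Rightarrow> complex" where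
  "monomial i j k l p = (cx p ^ i * cy p ^ k) * (ca p ^ j * cs p ^ l)"

inductive_set polys :: "(complex^5 \<Rightarrow> complex) set" where
  monomial: "(\<lambda>p. c * monomial i j k l p) \<in> polys"
| add: "f \<in> polys \<Longrightarrow> g \<in> polys \<Longrightarrow> (\<lambda>p. f p + g p) \<in> polys"

lemma polys_const: "(\<lambda>p. c) \<in> polys"
  using polys.monomial[of c 0 0 0 0] by (simp add: monomial_def)

lemma polys_coords: "cx \<in> polys" "ca \<in> polys" "cy \<in> polys" "cs \<in> polys"
  using polys.monomial[of 1 1 0 0 0] polys.monomial[of 1 0 1 0 0] polys.monomial[of 1 0 0 1 0]
    polys.monomial[of 1 0 0 0 1]
  by (simp_all add: monomial_def)

lemma monomial_mult:
  "monomial i j k l p * monomial i' j' k' l' p = monomial (i + i') (j + j') (k + k') (l + l') p"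
  by (simp add: monomial_def power_add)

lemma polys_mult:
  assumes "f \<in> polys" "g \<in> polys"
  shows "(\<lambda>p. f p * g p) \<in> polys"
  using assms(1)
proof induction
  case f: (monomial c i j k l)
  show ?case using assms(2)
  proof induction
    case (monomial d i' j' k' l')
    have "(\<lambda>p. c * monomial i j k l p * (d * monomial i' j' k' l' p))
        = (\<lambda>p. (c * d) * monomial (i + i') (j + j') (k + k') (l + l') p)"
      by (simp add: monomial_mult[symmetric] mult_ac)
    then show ?case using polys.monomial by simp
  next
    case (add f g)
    then show ?case by (simp add: distrib_left polys.add)
  qed
next
  case (add f f')
  then show ?case by (simp add: distrib_right polys.add)
qed

lemma polys_uminus: "f \<in> polys \<Longrightarrow> (\<lambda>p. - f p) \<in> polys"
  using polys_mult[OF polys_const[of "-1"]] by simp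

lemma polys_locally_holomorphic: "f \<in> polys \<Longrightarrow> locally_holomorphic X f"
proof (induction rule: polys.induct)
  case (monomial c i j k l)
  show ?case unfolding monomial_def
    by (rule locally_holomorphic_coords locally_holomorphic_intros)+
qed (rule locally_holomorphic_add)

section \<open>Derivations that preserve polynomials\<close>

definition poly_derivative :: "(complex^5 \<Rightarrow> complex^5) \<Rightarrow> (complex^5 \<Rightarrow> complex) \<Rightarrow> bool" where
  "poly_derivative W f \<longleftrightarrow> f \<in> polys \<and> (\<exists>g\<in>polys. \<forall>p\<in>X. derivative_along X f p (W p) (g p))"

lemma poly_derivative_mult:
  assumes "poly_derivative W f" "poly_derivative W g"
  shows "poly_derivative W (\<lambda>p. f p * g p)"
proof -
  obtain f' where f: "f \<in> polys" "f' \<in> polys" "\<And>p. p \<in> X \<Longrightarrow> derivative_along X f p (W p) (f' p)"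
    using assms(1) unfolding poly_derivative_def by auto
  obtain g' where g: "g \<in> polys" "g' \<in> polys" "\<And>p. p \<in> X \<Longrightarrow> derivative_along X g p (W p) (g' p)"
    using assms(2) unfolding poly_derivative_def by auto
  have "derivative_along X (\<lambda>p. f p * g p) p (W p) (f p * g' p + f' p * g p)" if "p \<in> X" for p
    by (rule derivative_along_mult[OF f(3)[OF that] g(3)[OF that] that])
  then show ?thesis
    unfolding poly_derivative_def
    using polys_mult[OF f(1) g(1)] polys.add[OF polys_mult[OF f(1) g(2)] polys_mult[OF f(2) g(1)]]
    by (intro conjI bexI[of _ "\<lambda>p. f p * g' p + f' p * g p"]) auto
qed

lemma poly_derivative_const: "poly_derivative W (\<lambda>p. c)"
  unfolding poly_derivative_def using polys_const derivative_along_const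
  by (intro conjI bexI[of _ "\<lambda>p. 0"]) auto

lemma poly_derivative_power: "poly_derivative W f \<Longrightarrow> poly_derivative W (\<lambda>p. f p ^ n)"
proof (induction n)
  case 0
  then show ?case using poly_derivative_const[of W 1] by simp
next
  case (Suc n)
  then show ?case using poly_derivative_mult[of W f "\<lambda>p. f p ^ n"] by simp
qed

lemma poly_derivative_polys:
  assumes "poly_derivative W cx" "poly_derivative W ca" "poly_derivative W cy" "poly_derivative W cs"
    and "f \<in> polys"
  shows "poly_derivative W f"
  using assms(5)
proof induction
  case (monomial c i j k l)
  show ?case unfolding monomial_def
    by (intro poly_derivative_mult poly_derivative_const poly_derivative_power assms(1-4))
next
  case (add f g)
  obtain f' where f: "f \<in> polys" "f' \<in> polys" "\<And>p. p \<in> X \<Longrightarrow> derivative_along X f p (W p) (f' p)"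
    using add.IH(1) unfolding poly_derivative_def by auto
  obtain g' where g: "g \<in> polys" "g' \<in> polys" "\<And>p. p \<in> X \<Longrightarrow> derivative_along X g p (W p) (g' p)"
    using add.IH(2) unfolding poly_derivative_def by auto
  have "derivative_along X (\<lambda>p. f p + g p) p (W p) (f' p + g' p)" if "p \<in> X" for p
    by (rule derivative_along_add[OF f(3)[OF that] g(3)[OF that]])
  then show ?case
    unfolding poly_derivative_def using polys.add[OF f(1) g(1)] polys.add[OF f(2) g(2)]
    by (intro conjI bexI[of _ "\<lambda>p. f' p + g' p"]) auto
qed

lemma poly_derivativeI:
  "f \<in> polys \<Longrightarrow> g \<in> polys \<Longrightarrow> (\<And>p. p \<in> X \<Longrightarrow> derivative_along X f p (W p) (g p)) \<Longrightarrow> poly_derivative W f"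
  unfolding poly_derivative_def by blast

lemma poly_derivative_fields:
  assumes "f \<in> polys"
  shows "poly_derivative D1 f" "poly_derivative D2 f" "poly_derivative D4 f"
proof -
  have yy: "(\<lambda>p. - (cy p * cy p)) \<in> polys" "(\<lambda>p. - 2 * cs p * cy p) \<in> polys"
    by (intro polys_uminus polys_mult polys_coords polys_const)+
  note P = polys_coords polys_const yy
  show "poly_derivative D1 f"
    by (rule poly_derivative_polys[OF poly_derivativeI[OF polys_coords(1) _ fields_derivs(1)]
        poly_derivativeI[OF polys_coords(2) _ fields_derivs(2)]
        poly_derivativeI[OF polys_coords(3) _ fields_derivs(3)]
        poly_derivativeI[OF polys_coords(4) _ fields_derivs(4)] assms]) (simp_all only: P)
  show "poly_derivative D2 f"
    by (rule poly_derivative_polys[OF poly_derivativeI[OF polys_coords(1) _ fields_derivs(5)]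
        poly_derivativeI[OF polys_coords(2) _ fields_derivs(6)]
        poly_derivativeI[OF polys_coords(3) _ fields_derivs(7)]
        poly_derivativeI[OF polys_coords(4) _ fields_derivs(8)] assms]) (simp_all only: P)
  show "poly_derivative D4 f"
    by (rule poly_derivative_polys[OF poly_derivativeI[OF polys_coords(1) _ fields_derivs(13)]
        poly_derivativeI[OF polys_coords(2) _ fields_derivs(14)]
        poly_derivativeI[OF polys_coords(3) _ fields_derivs(15)]
        poly_derivativeI[OF polys_coords(4) _ fields_derivs(16)] assms]) (simp_all only: P)
qed

section \<open>Fields with all polynomial multiples in the Lie algebra\<close>

definition absorbs :: "(complex^5 \<Rightarrow> complex^5) \<Rightarrow> bool" where
  "absorbs V \<longleftrightarrow> (\<forall>f\<in>polys. scale_field f V \<in> Lie)"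

text \<open>Together with a multiplier \<open>h\<close>, the coefficients \<open>h f\<close> and
  \<open>h g\<close> are again polynomials. Hence the absorbed fields form a module over the
  polynomials.\<close>

lemma absorbs_combination:
  assumes "absorbs V" "absorbs W" "f \<in> polys" "g \<in> polys" "\<And>p. U p = f p *s V p + g p *s W p"
  shows "absorbs U"
  unfolding absorbs_def
proof
  fix h assume h: "h \<in> polys"
  have "scale_field (\<lambda>p. h p * f p) V \<in> Lie" "scale_field (\<lambda>p. h p * g p) W \<in> Lie"
    using assms(1-4) h polys_mult unfolding absorbs_def by blast+
  then have "(\<lambda>p. scale_field (\<lambda>p. h p * f p) V p + scale_field (\<lambda>p. h p * g p) W p) \<in> Lie"
    by (rule lie_generated.add)
  moreover have "(\<lambda>p. scale_field (\<lambda>p. h p * f p) V p + scale_field (\<lambda>p. h p * g p) W p) = scale_field h U"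
    by (rule ext) (simp add: scale_field_def assms(5) vector_add_ldistrib vector_smult_assoc)
  ultimately show "scale_field h U \<in> Lie" by simp
qed

lemma absorbs_monomials:
  assumes "\<And>i j k l. scale_field (monomial i j k l) V \<in> Lie"
  shows "absorbs V"
  unfolding absorbs_def
proof
  fix f assume "f \<in> polys"
  then show "scale_field f V \<in> Lie"
  proof induction
    case (monomial c i j k l)
    have "(\<lambda>p. c *s scale_field (monomial i j k l) V p) \<in> Lie"
      using assms by (rule lie_generated.scale)
    then show ?case by (simp add: scale_field_def vector_smult_assoc)
  next
    case (add f g)
    from lie_generated.add[OF add.IH]
    show ?case by (simp add: scale_field_def vector_sadd_rdistrib)
  qed
qed

lemma apply_field_derivative:
  assumes "V \<in> vector_fields X" "p \<in> X" "derivative_along X f p (V p) c"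
  shows "apply_field X V f p = c"
  using apply_field_eq[where V=V, OF assms(3) vector_fields_tangent[OF assms(1,2)] assms(2)] .

lemma lie_bracket_scale_field_left:
  assumes "locally_holomorphic X f" "V \<in> vector_fields X" "W \<in> vector_fields X"
  shows "lie_bracket X (scale_field f V) W p = f p *s lie_bracket X V W p - apply_field X W f p *s V p"
proof -
  \<comment> \<open>Writing \<open>W\<close> as \<open>1\<close> times \<open>W\<close> makes the
    Leibniz rule applicable on both sides.\<close>
  have W: "W = scale_field (\<lambda>p. 1) W" by (simp add: scale_field_def)
  have "apply_field X V (\<lambda>p. 1) p = 0"
  proof (cases "p \<in> X")
    case True
    then show ?thesis
      using apply_field_derivative[OF assms(2) True derivative_along_const] by blast
  qed (simp add: apply_field_outside)
  then show ?thesis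
    by (subst W) (simp add: lie_bracket_scale_field[OF assms(1) locally_holomorphic_const assms(2,3)])
qed

text \<open>By the Leibniz rule, \<open>f [V, W] = [f V, W] + W(f) V\<close>, and both terms lie in
  the Lie algebra because \<open>W(f)\<close> is a polynomial on \<open>X\<close>.\<close>

lemma absorbs_lie_bracket:
  assumes V: "V \<in> vector_fields X" "absorbs V" and W: "W \<in> vector_fields X" "W \<in> Lie"
    and poly: "\<And>f. f \<in> polys \<Longrightarrow> poly_derivative W f"
  shows "absorbs (lie_bracket X V W)"
  unfolding absorbs_def
proof
  fix f assume f: "f \<in> polys"
  obtain g where g: "g \<in> polys" "\<And>p. p \<in> X \<Longrightarrow> derivative_along X f p (W p) (g p)"
    using poly[OF f] unfolding poly_derivative_def by auto
  have "scale_field f V \<in> Lie" "scale_field g V \<in> Lie"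
    using V(2) f g(1) unfolding absorbs_def by blast+
  then have "(\<lambda>p. lie_bracket X (scale_field f V) W p + scale_field g V p) \<in> Lie"
    using W(2) by (intro lie_generated.add lie_generated.bracket)
  moreover have "lie_bracket X (scale_field f V) W p + scale_field g V p = scale_field f (lie_bracket X V W) p" for p
  proof (cases "p \<in> X")
    case True
    then show ?thesis
      using lie_bracket_scale_field_left[OF polys_locally_holomorphic[OF f] V(1) W(1), of p]
        apply_field_derivative[OF W(1) True g(2)[OF True]]
      by (simp add: scale_field_def)
  next
    case False
    then show ?thesis
      using vector_fields_outside[OF V(1) False]
      by (simp add: scale_field_def lie_bracket_def apply_field_outside vec_eq_iff)
  qed
  ultimately show "scale_field f (lie_bracket X V W) \<in> Lie" by simp
qed

text \<open>The identity \<open>[fV, hgW] - [hfV, gW] = f g V(h) W\<close> for \<open>W(h) = 0\<close> behind the notion of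
  compatible pair.\<close>

lemma compatible_bracket:
  assumes V: "V \<in> vector_fields X" and W: "W \<in> vector_fields X"
    and f: "locally_holomorphic X f" and g: "locally_holomorphic X g" and h: "locally_holomorphic X h"
    and Wh: "\<And>p. p \<in> X \<Longrightarrow> derivative_along X h p (W p) 0"
    and Vh: "\<And>p. p \<in> X \<Longrightarrow> derivative_along X h p (V p) (k p)"
    and Lie: "scale_field f V \<in> Lie" "scale_field (\<lambda>p. h p * f p) V \<in> Lie"
      "scale_field g W \<in> Lie" "scale_field (\<lambda>p. h p * g p) W \<in> Lie"
  shows "scale_field (\<lambda>p. f p * g p) (scale_field k W) \<in> Lie"
proof -
  let ?B = "lie_bracket X (scale_field f V) (scale_field (\<lambda>p. h p * g p) W)"
  let ?C = "lie_bracket X (scale_field (\<lambda>p. h p * f p) V) (scale_field g W)"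
  have "(\<lambda>p. ?B p + (-1) *s ?C p) \<in> Lie"
    using Lie by (intro lie_generated.add lie_generated.scale lie_generated.bracket)
  moreover have "?B p + (-1) *s ?C p = scale_field (\<lambda>p. f p * g p) (scale_field k W) p" for p
  proof (cases "p \<in> X")
    case True
    have "apply_field X V (\<lambda>p. h p * g p) p = h p * apply_field X V g p + k p * g p"
      using apply_field_mult[OF h g V True] apply_field_derivative[OF V True Vh[OF True]] by simp
    moreover have "apply_field X W (\<lambda>p. h p * f p) p = h p * apply_field X W f p"
      using apply_field_mult[OF h f W True] apply_field_derivative[OF W True Wh[OF True]] by simp
    ultimately show ?thesis
      unfolding lie_bracket_scale_field[OF f locally_holomorphic_mult[OF h g] V W]
        lie_bracket_scale_field[OF locally_holomorphic_mult[OF h f] g V W]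
      by (simp add: scale_field_def vec_eq_iff algebra_simps)
  next
    case False
    then show ?thesis
      using vector_fields_outside[OF W False]
      by (simp add: scale_field_def lie_bracket_def apply_field_outside vec_eq_iff)
  qed
  ultimately show ?thesis by simp
qed

text \<open>Each coefficient is a product of coordinates fixed by the flow, times at most one
  coordinate that is linear in time. It is therefore affine along every orbit.\<close>

lemma complete_multiples:
  shows "scale_field (\<lambda>p. cx p ^ i * cs p ^ l) D1 \<in> complete_fields X"
    and "scale_field (\<lambda>p. ca p ^ i * cs p ^ l) D3 \<in> complete_fields X"
    and "scale_field (\<lambda>p. cx p ^ i * cy p ^ l) D2 \<in> complete_fields X"
    and "scale_field (\<lambda>p. ca p * (cx p ^ i * cy p ^ l)) D2 \<in> complete_fields X"
    and "scale_field (\<lambda>p. cs p * (cx p ^ i * cy p ^ l)) D2 \<in> complete_fields X"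
    and "scale_field (\<lambda>p. ca p ^ i * cy p ^ l) D4 \<in> complete_fields X"
    and "scale_field (\<lambda>p. cx p * (ca p ^ i * cy p ^ l)) D4 \<in> complete_fields X"
    and "scale_field (\<lambda>p. cs p * (ca p ^ i * cy p ^ l)) D4 \<in> complete_fields X"
proof -
  note hol = locally_holomorphic_coords locally_holomorphic_intros
  \<comment> \<open>The flows stay on the hypersurface, which is what evaluates \<open>cs\<close>
    along them.\<close>
  have rel: "cx p * (ca p - cs p * (2 * cy p * t + cx p * t^2)) + cs p * (cy p + cx p * t)^2 = 1"
    "(cx p - cs p * (2 * cy p * t + ca p * t^2)) * ca p + cs p * (cy p + ca p * t)^2 = 1"
    "cx p * (ca p - (cy p)^2 * t) + (cs p + cx p * t) * (cy p)^2 = 1"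
    "(cx p - (cy p)^2 * t) * ca p + (cs p + ca p * t) * (cy p)^2 = 1" if "p \<in> X" for p t
    using X_coords(1)[OF that] by (simp_all add: power2_eq_square algebra_simps)
  show "scale_field (\<lambda>p. cx p ^ i * cs p ^ l) D1 \<in> complete_fields X"
    by (rule complete_D1, (rule hol)+, rule exI[of _ 0]) (simp add: coords_emb rel)
  show "scale_field (\<lambda>p. ca p ^ i * cs p ^ l) D3 \<in> complete_fields X"
    by (rule complete_D3, (rule hol)+, rule exI[of _ 0]) (simp add: coords_emb rel)
  show "scale_field (\<lambda>p. cx p ^ i * cy p ^ l) D2 \<in> complete_fields X"
    by (rule complete_D2, (rule hol)+, rule exI[of _ 0]) (simp add: coords_emb rel)
  show "scale_field (\<lambda>p. ca p * (cx p ^ i * cy p ^ l)) D2 \<in> complete_fields X"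
  proof (rule complete_D2, (rule hol)+, rule exI, rule allI)
    fix p t assume "p \<in> X"
    show "ca (emb (cx p) (ca p - (cy p)^2 * t) (cy p) (cs p + cx p * t)) *
        (cx (emb (cx p) (ca p - (cy p)^2 * t) (cy p) (cs p + cx p * t)) ^ i *
         cy (emb (cx p) (ca p - (cy p)^2 * t) (cy p) (cs p + cx p * t)) ^ l)
        = ca p * (cx p ^ i * cy p ^ l) + - ((cy p)^2 * (cx p ^ i * cy p ^ l)) * t"
      by (simp add: coords_emb algebra_simps)
  qed
  show "scale_field (\<lambda>p. cs p * (cx p ^ i * cy p ^ l)) D2 \<in> complete_fields X"
  proof (rule complete_D2, (rule hol)+, rule exI, rule allI)
    fix p t assume "p \<in> X"
    then show "cs (emb (cx p) (ca p - (cy p)^2 * t) (cy p) (cs p + cx p * t)) *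
        (cx (emb (cx p) (ca p - (cy p)^2 * t) (cy p) (cs p + cx p * t)) ^ i *
         cy (emb (cx p) (ca p - (cy p)^2 * t) (cy p) (cs p + cx p * t)) ^ l)
        = cs p * (cx p ^ i * cy p ^ l) + (cx p * (cx p ^ i * cy p ^ l)) * t"
      by (simp add: coords_emb rel) (simp add: algebra_simps)
  qed
  show "scale_field (\<lambda>p. ca p ^ i * cy p ^ l) D4 \<in> complete_fields X"
    by (rule complete_D4, (rule hol)+, rule exI[of _ 0]) (simp add: coords_emb rel)
  show "scale_field (\<lambda>p. cx p * (ca p ^ i * cy p ^ l)) D4 \<in> complete_fields X"
  proof (rule complete_D4, (rule hol)+, rule exI, rule allI)
    fix p t assume "p \<in> X"
    show "cx (emb (cx p - (cy p)^2 * t) (ca p) (cy p) (cs p + ca p * t)) *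
        (ca (emb (cx p - (cy p)^2 * t) (ca p) (cy p) (cs p + ca p * t)) ^ i *
         cy (emb (cx p - (cy p)^2 * t) (ca p) (cy p) (cs p + ca p * t)) ^ l)
        = cx p * (ca p ^ i * cy p ^ l) + - ((cy p)^2 * (ca p ^ i * cy p ^ l)) * t"
      by (simp add: coords_emb algebra_simps)
  qed
  show "scale_field (\<lambda>p. cs p * (ca p ^ i * cy p ^ l)) D4 \<in> complete_fields X"
  proof (rule complete_D4, (rule hol)+, rule exI, rule allI)
    fix p t assume "p \<in> X"
    then show "cs (emb (cx p - (cy p)^2 * t) (ca p) (cy p) (cs p + ca p * t)) *
        (ca (emb (cx p - (cy p)^2 * t) (ca p) (cy p) (cs p + ca p * t)) ^ i *
         cy (emb (cx p - (cy p)^2 * t) (ca p) (cy p) (cs p + ca p * t)) ^ l)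
        = cs p * (ca p ^ i * cy p ^ l) + (ca p * (ca p ^ i * cy p ^ l)) * t"
      by (simp add: coords_emb rel) (simp add: algebra_simps)
  qed
qed

lemma fields_complete:
  "D1 \<in> complete_fields X" "D2 \<in> complete_fields X" "D3 \<in> complete_fields X" "D4 \<in> complete_fields X"
  using complete_multiples(1,3,2,6)[of 0 0] by (simp_all add: scale_field_def)

lemma absorbs_D3: "absorbs D3"
proof -
  note base = lie_generated.base[of _ "complete_fields X" X]
  note hol = locally_holomorphic_coords locally_holomorphic_intros
  have "absorbs (scale_field cx D3)"
  proof (rule absorbs_monomials)
    fix i j k l
    have "scale_field (\<lambda>p. (cx p ^ i * cy p ^ k) * (ca p ^ j * cs p ^ l)) (scale_field cx D3) \<in> Lie"
    \<comment> \<open>Here \<open>f\<close> is the factor in \<open>x\<close>, \<open>y\<close> and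
      \<open>g\<close> the factor in \<open>a\<close>, \<open>s\<close>. \<open>D3\<close>
      annihilates \<open>s\<close>, and \<open>D2\<close> sends it to \<open>x\<close>; the choice
      \<open>h = ca\<close> below gives \<open>- y^2\<close> instead.\<close>
    proof (rule compatible_bracket[where V=D2 and h=cs])
      show "scale_field (\<lambda>p. cs p * (ca p ^ j * cs p ^ l)) D3 \<in> Lie"
        using base[OF complete_multiples(2)[of j "Suc l"]] by (simp add: mult_ac)
    qed ((rule hol fields_in_vector_fields base complete_multiples fields_derivs | assumption)+)
    then show "scale_field (monomial i j k l) (scale_field cx D3) \<in> Lie"
      by (simp add: monomial_def[abs_def])
  qed
  moreover have "absorbs (scale_field (\<lambda>p. - (cy p * cy p)) D3)"
  proof (rule absorbs_monomials)
    fix i j k l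
    have "scale_field (\<lambda>p. (cx p ^ i * cy p ^ k) * (ca p ^ j * cs p ^ l)) (scale_field (\<lambda>p. - (cy p * cy p)) D3) \<in> Lie"
    proof (rule compatible_bracket[where V=D2 and h=ca])
      show "scale_field (\<lambda>p. ca p * (ca p ^ j * cs p ^ l)) D3 \<in> Lie"
        using base[OF complete_multiples(2)[of "Suc j" l]] by (simp add: mult_ac)
    qed ((rule hol fields_in_vector_fields base complete_multiples fields_derivs | assumption)+)
    then show "scale_field (monomial i j k l) (scale_field (\<lambda>p. - (cy p * cy p)) D3) \<in> Lie"
      by (simp add: monomial_def[abs_def])
  qed
  \<comment> \<open>The coefficients \<open>a\<close> and \<open>- s\<close> work because
    \<open>a * x + (- s) * (- y^2) = 1\<close> on \<open>X\<close>.\<close>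
  ultimately show ?thesis
  proof (rule absorbs_combination[OF _ _ polys_coords(2) polys_uminus[OF polys_coords(4)]])
    fix p
    show "D3 p = ca p *s scale_field cx D3 p + (- cs p) *s scale_field (\<lambda>p. - (cy p * cy p)) D3 p"
    proof (cases "p \<in> X")
      case True
      have "ca p * cx p + cs p * (cy p * cy p) = 1"
        using X_coords(1)[OF True] by (simp add: power2_eq_square mult.commute)
      then show ?thesis
        by (simp add: scale_field_def vector_smult_assoc vector_sadd_rdistrib[symmetric])
    qed (simp add: scale_field_def D3_def fld_def)
  qed
qed

text \<open>The argument for \<open>D3\<close> with \<open>x\<close> and \<open>a\<close> exchanged,
  so that \<open>D4\<close> takes the place of \<open>D2\<close>.\<close>

lemma absorbs_D1: "absorbs D1"
proof -
  note base = lie_generated.base[of _ "complete_fields X" X]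
  note hol = locally_holomorphic_coords locally_holomorphic_intros
  have "absorbs (scale_field ca D1)"
  proof (rule absorbs_monomials)
    fix i j k l
    have "scale_field (\<lambda>p. (ca p ^ j * cy p ^ k) * (cx p ^ i * cs p ^ l)) (scale_field ca D1) \<in> Lie"
    proof (rule compatible_bracket[where V=D4 and h=cs])
      show "scale_field (\<lambda>p. cs p * (cx p ^ i * cs p ^ l)) D1 \<in> Lie"
        using base[OF complete_multiples(1)[of i "Suc l"]] by (simp add: mult_ac)
    qed ((rule hol fields_in_vector_fields base complete_multiples fields_derivs | assumption)+)
    then show "scale_field (monomial i j k l) (scale_field ca D1) \<in> Lie"
      by (simp add: monomial_def[abs_def] mult_ac)
  qed
  moreover have "absorbs (scale_field (\<lambda>p. - (cy p * cy p)) D1)"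
  proof (rule absorbs_monomials)
    fix i j k l
    have "scale_field (\<lambda>p. (ca p ^ j * cy p ^ k) * (cx p ^ i * cs p ^ l)) (scale_field (\<lambda>p. - (cy p * cy p)) D1) \<in> Lie"
    proof (rule compatible_bracket[where V=D4 and h=cx])
      show "scale_field (\<lambda>p. cx p * (cx p ^ i * cs p ^ l)) D1 \<in> Lie"
        using base[OF complete_multiples(1)[of "Suc i" l]] by (simp add: mult_ac)
    qed ((rule hol fields_in_vector_fields base complete_multiples fields_derivs | assumption)+)
    then show "scale_field (monomial i j k l) (scale_field (\<lambda>p. - (cy p * cy p)) D1) \<in> Lie"
      by (simp add: monomial_def[abs_def] mult_ac)
  qed
  ultimately show ?thesis
  proof (rule absorbs_combination[OF _ _ polys_coords(1) polys_uminus[OF polys_coords(4)]])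
    fix p
    show "D1 p = cx p *s scale_field ca D1 p + (- cs p) *s scale_field (\<lambda>p. - (cy p * cy p)) D1 p"
    proof (cases "p \<in> X")
      case True
      have "cx p * ca p + cs p * (cy p * cy p) = 1"
        using X_coords(1)[OF True] by (simp add: power2_eq_square)
      then show ?thesis
        by (simp add: scale_field_def vector_smult_assoc vector_sadd_rdistrib[symmetric])
    qed (simp add: scale_field_def D1_def fld_def)
  qed
qed

text \<open>The equation \<open>1 = a x + (s y) y\<close> makes \<open>x\<close> and
  \<open>y\<close> generate the unit ideal. A field is thus absorbed as soon as its multiples by
  \<open>x\<close> and \<open>y\<close> are.\<close>

lemma unit_combination:
  assumes "V \<in> vector_fields X"
  shows "V p = ca p *s (cx p *s V p) + (cs p * cy p) *s (cy p *s V p)"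
proof (cases "p \<in> X")
  case True
  have "ca p * cx p + cs p * cy p * cy p = 1"
    using X_coords(1)[OF True] by (simp add: power2_eq_square mult_ac)
  then show ?thesis
    by (simp add: vector_smult_assoc vector_sadd_rdistrib[symmetric])
qed (simp add: vector_fields_outside[OF assms])

text \<open>The brackets of \<open>D3\<close> with \<open>D2\<close> and of \<open>D1\<close> with
  \<open>D4\<close> are two independent combinations of \<open>y E1\<close> and \<open>y E2\<close>.
  Bracketing with \<open>D1\<close> then trades the factor \<open>y\<close> for \<open>x\<close>,
  and the multiples by \<open>x\<close> and \<open>y\<close> together give the field itself.\<close>

lemma absorbs_E1_E2: "absorbs E1" "absorbs E2"
proof -
  note Lie = fields_complete[THEN lie_generated.base]
  have "absorbs (lie_bracket X D3 D2)"
    by (rule absorbs_lie_bracket[OF fields_in_vector_fields(3) absorbs_D3 fields_in_vector_fields(2) Lie(2)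
        poly_derivative_fields(2)])
  then have A: "absorbs (\<lambda>p. (2 * cy p) *s E1 p + cy p *s E2 p)" by (simp add: bracket_D3_D2)
  have "absorbs (lie_bracket X D1 D4)"
    by (rule absorbs_lie_bracket[OF fields_in_vector_fields(1) absorbs_D1 fields_in_vector_fields(4) Lie(4)
        poly_derivative_fields(3)])
  then have B: "absorbs (\<lambda>p. (- 2 * cy p) *s E1 p + cy p *s E2 p)" by (simp add: bracket_D1_D4)
  have yE1: "absorbs (scale_field cy E1)"
    by (rule absorbs_combination[OF A B polys_const[of "1/4"] polys_const[of "-1/4"]])
      (simp add: scale_field_def vec_eq_iff algebra_simps)
  have yE2: "absorbs (scale_field cy E2)"
    by (rule absorbs_combination[OF A B polys_const[of "1/2"] polys_const[of "1/2"]])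
      (simp add: scale_field_def vec_eq_iff algebra_simps)
  have D1cy: "apply_field X D1 cy p = cx p" if "p \<in> X" for p
    using apply_field_derivative[OF fields_in_vector_fields(1) that fields_derivs(3)[OF that]] .
  note hol = locally_holomorphic_coords(2)
  \<comment> \<open>From \<open>[y E, D1] = y [E, D1] - D1(y) E\<close> and \<open>D1(y) = x\<close>
    follows \<open>x E = c y D1 - [y E, D1]\<close> when \<open>D1\<close> is an eigenvector with
    eigenvalue \<open>c\<close>.\<close>
  have xE: "absorbs (scale_field cx E)"
    if E: "E \<in> vector_fields X" "absorbs (scale_field cy E)" "\<And>p. lie_bracket X E D1 p = c *s D1 p" for E c
  proof -
    have "absorbs (lie_bracket X (scale_field cy E) D1)"
      by (rule absorbs_lie_bracket[OF scale_field_in_vector_fields[OF hol E(1)] E(2)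
          fields_in_vector_fields(1) Lie(1) poly_derivative_fields(1)])
    then show ?thesis
    proof (rule absorbs_combination[OF absorbs_D1 _ polys_mult[OF polys_const[of c] polys_coords(3)] polys_const[of "-1"]])
      fix p
      show "scale_field cx E p = (c * cy p) *s D1 p + (-1) *s lie_bracket X (scale_field cy E) D1 p"
      proof (cases "p \<in> X")
        case True
        then show ?thesis
          using lie_bracket_scale_field_left[OF hol E(1) fields_in_vector_fields(1), of p]
          by (simp add: D1cy E(3) scale_field_def vec_eq_iff algebra_simps)
      next
        case False
        then show ?thesis
          using vector_fields_outside[OF E(1) False] vector_fields_outside[OF fields_in_vector_fields(1) False]
          by (simp add: scale_field_def lie_bracket_def apply_field_outside vec_eq_iff)
      qed
    qed
  qed
  have "absorbs E" if "E \<in> vector_fields X" "absorbs (scale_field cy E)" "absorbs (scale_field cx E)" for E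
    by (rule absorbs_combination[OF that(3,2) polys_coords(2) polys_mult[OF polys_coords(4,3)]])
      (use unit_combination[OF that(1)] in \<open>simp add: scale_field_def\<close>)
  moreover have "absorbs (scale_field cx E1)"
    by (rule xE[OF fields_in_vector_fields(5) yE1, of 1]) (simp add: bracket_E1_D1)
  moreover have "absorbs (scale_field cx E2)"
    by (rule xE[OF fields_in_vector_fields(6) yE2, of "-1"]) (simp add: bracket_E2_D1 vec_eq_iff)
  ultimately show "absorbs E1" "absorbs E2"
    using fields_in_vector_fields(5,6) yE1 yE2 by blast+
qed

text \<open>Both fields are eigenvectors of \<open>E2\<close> for the nonzero eigenvalue
  \<open>2\<close>, so they are multiples of brackets with the absorbed field
  \<open>E2\<close>.\<close>

lemma absorbs_D2_D4: "absorbs D2" "absorbs D4"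
proof -
  note Lie = fields_complete[THEN lie_generated.base]
  have "absorbs (lie_bracket X E2 D2)"
    by (rule absorbs_lie_bracket[OF fields_in_vector_fields(6) absorbs_E1_E2(2) fields_in_vector_fields(2) Lie(2)
        poly_derivative_fields(2)])
  then have A: "absorbs (\<lambda>p. 2 *s D2 p)" by (simp add: bracket_E2_D2)
  \<comment> \<open>Division by \<open>2\<close> is a two-term combination whose second coefficient
    is zero.\<close>
  show "absorbs D2"
    by (rule absorbs_combination[OF A A polys_const[of "1/2"] polys_const[of 0]]) (simp add: vec_eq_iff)
  have "absorbs (lie_bracket X E2 D4)"
    by (rule absorbs_lie_bracket[OF fields_in_vector_fields(6) absorbs_E1_E2(2) fields_in_vector_fields(4) Lie(4)
        poly_derivative_fields(3)])
  then have A: "absorbs (\<lambda>p. 2 *s D4 p)" by (simp add: bracket_E2_D4)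
  show "absorbs D4"
    by (rule absorbs_combination[OF A A polys_const[of "1/2"] polys_const[of 0]]) (simp add: vec_eq_iff)
qed

end

section \<open>Polynomials are dense in the holomorphic functions\<close>

context variety_chart
begin

lemma approximation_algebra_polys:
  assumes "compact K" "K \<subseteq> X"
  shows "approximation_algebra K polys"
proof
  show "continuous_on K f" if "f \<in> polys" for f
    using locally_holomorphic_continuous_on[OF polys_locally_holomorphic[OF that]] assms(2)
    by (rule continuous_on_subset)
qed (rule assms(1) polys_const polys.add polys_mult; assumption)+

lemma holomorphic_on_emb:
  assumes "locally_holomorphic X f" "open S"
    and "x holomorphic_on S" "a holomorphic_on S" "y holomorphic_on S" "s holomorphic_on S"
    and rel: "\<And>t. t \<in> S \<Longrightarrow> x t * a t + s t * (y t)^2 = 1"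
  shows "(\<lambda>t. f (emb (x t) (a t) (y t) (s t))) holomorphic_on S"
proof (rule holomorphic_on_curve[OF assms(1,2)])
  show "(\<lambda>t. emb (x t) (a t) (y t) (s t)) ` S \<subseteq> X"
    using emb_in_X[OF rel] by blast
  show "(\<lambda>t. emb (x t) (a t) (y t) (s t) $ i) holomorphic_on S" for i
    by (rule emb_holomorphic[OF assms(3-6)])
qed

text \<open>For \<open>u = x a \<noteq> 0\<close> this is Cauchy's formula for \<open>\<mu> \<mapsto> f (emb \<mu> (u / \<mu>) y s)\<close> on the annulus
  \<open>\<bar>u\<bar> / \<rho> < \<bar>\<mu>\<bar> < \<rho>\<close>, with the inner circle parametrized by \<open>\<mu> = u / \<nu>\<close>; for \<open>u = 0\<close> the fibre is a
  pair of lines meeting in a point, and the formula is that of each line.\<close>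

lemma two_chart_formula:
  fixes \<rho> :: real
  defines "\<nu> \<equiv> circlepath 0 \<rho>"
  assumes f: "locally_holomorphic X f" and p: "p \<in> X"
    and less: "norm (cx p) < \<rho>" "norm (ca p) < \<rho>"
  shows "f p =
    integral {0..1} (\<lambda>t. f (emb (\<nu> t) ((1 - cs p * (cy p)^2) / \<nu> t) (cy p) (cs p)) * (\<nu> t / (\<nu> t - cx p))) +
    integral {0..1} (\<lambda>t. f (emb ((1 - cs p * (cy p)^2) / \<nu> t) (\<nu> t) (cy p) (cs p)) * (ca p / (\<nu> t - ca p)))"
proof -
  define x a y s u where def: "x = cx p" "a = ca p" "y = cy p" "s = cs p" "u = 1 - s * y^2"
  have u: "u = x * a" and us: "u + s * y^2 = 1"
    using X_coords(1)[OF p] by (simp_all add: def algebra_simps)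
  have fp: "f p = f (emb x a y s)" using X_coords(2)[OF p] by (simp add: def)
  have less': "norm x < \<rho>" "norm a < \<rho>" using less by (simp_all add: def)
  have \<rho>: "\<rho> > 0" using less norm_ge_zero le_less_trans by blast
  have \<nu>: "\<nu> t \<noteq> 0" "\<nu> t \<noteq> a" for t
    using circlepath_nonzero[OF \<rho>, of t] norm_circlepath[OF \<rho>, of t] less' by (auto simp: \<nu>_def)
  have "f (emb x a y s) =
    integral {0..1} (\<lambda>t. f (emb (\<nu> t) (u / \<nu> t) y s) * (\<nu> t / (\<nu> t - x))) +
    integral {0..1} (\<lambda>t. f (emb (u / \<nu> t) (\<nu> t) y s) * (a / (\<nu> t - a)))"
  proof (cases "u = 0")
    case False
    then have nz: "x \<noteq> 0" "a \<noteq> 0" using u by auto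
    define F where "F = (\<lambda>\<mu>. f (emb \<mu> (u / \<mu>) y s))"
    have "F holomorphic_on - {0}"
      unfolding F_def using us by (intro holomorphic_on_emb[OF f] holomorphic_intros) auto
    from two_circle_formula[OF this nz less', folded \<nu>_def]
    have "F x = integral {0..1} (\<lambda>t. F (\<nu> t) * (\<nu> t / (\<nu> t - x))) +
      integral {0..1} (\<lambda>t. F (u / \<nu> t) * (a / (\<nu> t - a)))" unfolding u .
    moreover have "F x = f (emb x a y s)" using nz by (simp add: F_def u)
    moreover have "F (u / \<nu> t) = f (emb (u / \<nu> t) (\<nu> t) y s)" for t
      using False \<nu>[of t] by (simp add: F_def)
    ultimately show ?thesis by (simp add: F_def)
  next
    case True
    define F where "F = (\<lambda>\<mu>. f (emb \<mu> 0 y s))"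
    define G where "G = (\<lambda>\<mu>. f (emb 0 \<mu> y s))"
    have hol: "F holomorphic_on UNIV" "G holomorphic_on UNIV"
      unfolding F_def G_def using us True by (intro holomorphic_on_emb[OF f] holomorphic_intros; simp)+
    have 1: "integral {0..1} (\<lambda>t. F (\<nu> t) * (\<nu> t / (\<nu> t - x))) = F x"
      using has_integral_Cauchy_circle[OF hol(1) less'(1)] by (simp add: \<nu>_def integral_unique)
    \<comment> \<open>The kernel is a difference of two Cauchy kernels, so the second integral is
      \<open>G a - G 0\<close>.\<close>
    have "a / (\<nu> t - a) = \<nu> t / (\<nu> t - a) - \<nu> t / (\<nu> t - 0)" for t
      using \<nu>[of t] by (simp add: diff_divide_distrib[symmetric] field_simps)
    then have eq: "G (\<nu> t) * (a / (\<nu> t - a)) = G (\<nu> t) * (\<nu> t / (\<nu> t - a)) - G (\<nu> t) * (\<nu> t / (\<nu> t - 0))" for t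
      by (simp only: right_diff_distrib)
    have "((\<lambda>t. G (\<nu> t) * (a / (\<nu> t - a))) has_integral (G a - G 0)) {0..1}"
      unfolding eq unfolding \<nu>_def
      by (rule has_integral_diff[OF has_integral_Cauchy_circle[OF hol(2) less'(2)] has_integral_Cauchy_circle[OF hol(2)]])
        (simp add: \<rho>)
    then have 2: "integral {0..1} (\<lambda>t. G (\<nu> t) * (a / (\<nu> t - a))) = G a - G 0"
      by (rule integral_unique)
    \<comment> \<open>The point lies on one of the two lines. Since \<open>F 0 = G 0\<close> at
      their intersection, the correction \<open>- G 0\<close> leaves exactly the value of
      \<open>f\<close> in either case.\<close>
    have "x = 0 \<or> a = 0" using True u by simp
    then have "f (emb x a y s) = F x + (G a - G 0)" by (auto simp: F_def G_def)
    then show ?thesis using 1 2 True by (simp add: F_def G_def)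
  qed
  then show ?thesis by (simp add: fp def)
qed

text \<open>In \<open>two_chart_formula\<close> each integrand is, for fixed \<open>t\<close>, an
  entire function of \<open>(y, s)\<close> times a Cauchy kernel in \<open>x\<close> or
  \<open>a\<close>. Both factors are approximable, and integration over \<open>t\<close> preserves
  this.\<close>

lemma approximable_locally_holomorphic:
  assumes K: "compact K" "K \<subseteq> X" and f: "locally_holomorphic X f"
  shows "approximation_algebra.approximable K polys f"
proof -
  interpret A: approximation_algebra K polys
    by (rule approximation_algebra_polys[OF K])
  obtain R1 where R1: "R1 > 0" "\<And>p. p \<in> K \<Longrightarrow> norm (cx p) \<le> R1"
    using polys_coords(1) by (rule A.bounded_member) blast
  obtain R2 where R2: "R2 > 0" "\<And>p. p \<in> K \<Longrightarrow> norm (ca p) \<le> R2"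
    using polys_coords(2) by (rule A.bounded_member) blast
  \<comment> \<open>A common bound lets one circle of radius \<open>2 * R\<close> serve the kernels
    in \<open>x\<close> and in \<open>a\<close>.\<close>
  define R where "R = max R1 R2"
  have R: "R > 0" "\<And>p. p \<in> K \<Longrightarrow> norm (cx p) \<le> R" "\<And>p. p \<in> K \<Longrightarrow> norm (ca p) \<le> R"
    using R1 R2 by (auto simp: R_def intro: le_max_iff_disj[THEN iffD2])
  define \<nu> where "\<nu> = circlepath 0 (2 * R)"
  have \<nu>: "\<nu> t \<noteq> 0" "norm (\<nu> t) = 2 * R" for t
    using circlepath_nonzero[of "2 * R" t] norm_circlepath[of "2 * R" t] R(1) by (simp_all add: \<nu>_def)
  have contf: "continuous_on X f" by (rule locally_holomorphic_continuous_on[OF f])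
  have cont_\<nu>: "continuous_on ({0..1} \<times> K) (\<lambda>q. \<nu> (fst q))"
    unfolding \<nu>_def by (intro continuous_intros)
  have cont_snd: "continuous_on ({0..1::real} \<times> K) (\<lambda>q. g (snd q))" if "g \<in> polys" for g
    by (rule continuous_on_compose2[OF A.cont[OF that] continuous_on_snd[OF continuous_on_id]]) auto
  let ?u = "\<lambda>y s. 1 - s * y^2 :: complex"
  have rel: "z * (?u y s / z) + s * y^2 = 1" "(?u y s / z) * z + s * y^2 = 1" if "z \<noteq> 0" for y s z
    using that by simp_all
  note cont_y = cont_snd[OF polys_coords(3)] and cont_s = cont_snd[OF polys_coords(4)]
  have cont_A: "continuous_on ({0..1} \<times> K) (\<lambda>q. f (emb (\<nu> (fst q)) (?u (cy (snd q)) (cs (snd q)) / \<nu> (fst q)) (cy (snd q)) (cs (snd q))))"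
  proof (rule continuous_on_compose2[OF contf])
    show "continuous_on ({0..1} \<times> K) (\<lambda>q. emb (\<nu> (fst q)) (?u (cy (snd q)) (cs (snd q)) / \<nu> (fst q)) (cy (snd q)) (cs (snd q)))"
      using \<nu>(1) by (intro emb_continuous_on continuous_intros cont_\<nu> cont_y cont_s) auto
  qed (auto intro!: emb_in_X rel \<nu>)
  have cont_B: "continuous_on ({0..1} \<times> K) (\<lambda>q. f (emb (?u (cy (snd q)) (cs (snd q)) / \<nu> (fst q)) (\<nu> (fst q)) (cy (snd q)) (cs (snd q))))"
  proof (rule continuous_on_compose2[OF contf])
    show "continuous_on ({0..1} \<times> K) (\<lambda>q. emb (?u (cy (snd q)) (cs (snd q)) / \<nu> (fst q)) (\<nu> (fst q)) (cy (snd q)) (cs (snd q)))"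
      using \<nu>(1) by (intro emb_continuous_on continuous_intros cont_\<nu> cont_y cont_s) auto
  qed (auto intro!: emb_in_X rel \<nu>)
  \<comment> \<open>With one of \<open>x\<close>, \<open>a\<close> frozen at a nonzero
    \<open>z\<close>, the other is a polynomial in \<open>y\<close> and \<open>s\<close>, so the
    point of \<open>X\<close> depends on \<open>(y, s)\<close> without restriction.\<close>
  have entire: "A.approximable (\<lambda>p. f (emb z (?u (cy p) (cs p) / z) (cy p) (cs p)))"
    "A.approximable (\<lambda>p. f (emb (?u (cy p) (cs p) / z) z (cy p) (cs p)))" if z: "z \<noteq> 0" for z
  proof -
    have c: "continuous_on UNIV (\<lambda>w::complex \<times> complex. emb z (?u (fst w) (snd w) / z) (fst w) (snd w))"
      "continuous_on UNIV (\<lambda>w::complex \<times> complex. emb (?u (fst w) (snd w) / z) z (fst w) (snd w))"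
      using z by (intro emb_continuous_on continuous_intros; simp)+
    have c1: "continuous_on UNIV (\<lambda>w::complex \<times> complex. f (emb z (?u (fst w) (snd w) / z) (fst w) (snd w)))"
      by (rule continuous_on_compose2[OF contf c(1)]) (auto intro!: emb_in_X rel z)
    have c2: "continuous_on UNIV (\<lambda>w::complex \<times> complex. f (emb (?u (fst w) (snd w) / z) z (fst w) (snd w)))"
      by (rule continuous_on_compose2[OF contf c(2)]) (auto intro!: emb_in_X rel z)
    show "A.approximable (\<lambda>p. f (emb z (?u (cy p) (cs p) / z) (cy p) (cs p)))"
    proof (rule A.approximable_entire2[where g = "\<lambda>y s. f (emb z (?u y s / z) y s)"])
      show "continuous_on UNIV (\<lambda>(y, s). f (emb z (?u y s / z) y s))"
        using c1 by (simp add: split_beta)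
      show "(\<lambda>y. f (emb z (?u y s / z) y s)) holomorphic_on UNIV" for s
        using z by (intro holomorphic_on_emb[OF f] holomorphic_intros rel(1)[OF z]) auto
      show "(\<lambda>s. f (emb z (?u y s / z) y s)) holomorphic_on UNIV" for y
        using z by (intro holomorphic_on_emb[OF f] holomorphic_intros rel(1)[OF z]) auto
    qed (rule polys_coords)+
    show "A.approximable (\<lambda>p. f (emb (?u (cy p) (cs p) / z) z (cy p) (cs p)))"
    proof (rule A.approximable_entire2[where g = "\<lambda>y s. f (emb (?u y s / z) z y s)"])
      show "continuous_on UNIV (\<lambda>(y, s). f (emb (?u y s / z) z y s))"
        using c2 by (simp add: split_beta)
      show "(\<lambda>y. f (emb (?u y s / z) z y s)) holomorphic_on UNIV" for s
        using z by (intro holomorphic_on_emb[OF f] holomorphic_intros rel(2)[OF z]) auto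
      show "(\<lambda>s. f (emb (?u y s / z) z y s)) holomorphic_on UNIV" for y
        using z by (intro holomorphic_on_emb[OF f] holomorphic_intros rel(2)[OF z]) auto
    qed (rule polys_coords)+
  qed
  have A: "A.approximable (\<lambda>p. integral {0..1} (\<lambda>t. f (emb (\<nu> t) (?u (cy p) (cs p) / \<nu> t) (cy p) (cs p)) * (\<nu> t / (\<nu> t - cx p))))"
  proof (rule A.approximable_integral)
    show "continuous_on ({0..1} \<times> K) (\<lambda>(t, p). f (emb (\<nu> t) (?u (cy p) (cs p) / \<nu> t) (cy p) (cs p)) * (\<nu> t / (\<nu> t - cx p)))"
      using continuous_on_mult[OF cont_A A.continuous_on_Cauchy_kernel[OF polys_coords(1) R(2,1), folded \<nu>_def, unfolded split_beta]]
      by (simp add: split_beta)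
    show "A.approximable (\<lambda>p. f (emb (\<nu> t) (?u (cy p) (cs p) / \<nu> t) (cy p) (cs p)) * (\<nu> t / (\<nu> t - cx p)))" for t
      by (rule A.approximable_mult[OF entire(1)[OF \<nu>(1)] A.approximable_Cauchy_kernel[OF polys_coords(1) R(2) \<nu>(2) R(1)]])
  qed
  \<comment> \<open>Brings the second kernel to the form treated by the geometric series.\<close>
  have ka: "ca p / (\<nu> t - ca p) = inverse (\<nu> t) * ca p * (\<nu> t / (\<nu> t - ca p))" for t p
    using \<nu>(1)[of t] by (simp add: field_simps)
  have B: "A.approximable (\<lambda>p. integral {0..1} (\<lambda>t. f (emb (?u (cy p) (cs p) / \<nu> t) (\<nu> t) (cy p) (cs p)) * (ca p / (\<nu> t - ca p))))"
  proof (rule A.approximable_integral)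
    have "continuous_on ({0..1} \<times> K) (\<lambda>q. inverse (\<nu> (fst q)) * ca (snd q))"
      using \<nu>(1) by (intro continuous_intros cont_\<nu> cont_snd[OF polys_coords(2)]) auto
    from continuous_on_mult[OF cont_B continuous_on_mult[OF this
        A.continuous_on_Cauchy_kernel[OF polys_coords(2) R(3,1), folded \<nu>_def, unfolded split_beta]]]
    show "continuous_on ({0..1} \<times> K) (\<lambda>(t, p). f (emb (?u (cy p) (cs p) / \<nu> t) (\<nu> t) (cy p) (cs p)) * (ca p / (\<nu> t - ca p)))"
      unfolding ka split_beta by simp
    show "A.approximable (\<lambda>p. f (emb (?u (cy p) (cs p) / \<nu> t) (\<nu> t) (cy p) (cs p)) * (ca p / (\<nu> t - ca p)))" for t
      unfolding ka
      by (rule A.approximable_mult[OF entire(2)[OF \<nu>(1)] A.approximable_mult[OF A.approximable_cmult[OF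
          A.approximable_member[OF polys_coords(2)]] A.approximable_Cauchy_kernel[OF polys_coords(2) R(3) \<nu>(2) R(1)]]])
  qed
  have "f p = integral {0..1} (\<lambda>t. f (emb (\<nu> t) (?u (cy p) (cs p) / \<nu> t) (cy p) (cs p)) * (\<nu> t / (\<nu> t - cx p)))
      + integral {0..1} (\<lambda>t. f (emb (?u (cy p) (cs p) / \<nu> t) (\<nu> t) (cy p) (cs p)) * (ca p / (\<nu> t - ca p)))"
    if "p \<in> K" for p
    unfolding \<nu>_def
  proof (rule two_chart_formula[OF f])
    show "p \<in> X" using that K(2) by blast
    show "norm (cx p) < 2 * R" "norm (ca p) < 2 * R"
      using R(2,3)[OF that] R(1) by linarith+
  qed
  then show ?thesis
    using A.approximable_add[OF A B] unfolding A.approximable_def by simp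
qed

lemma polys_dense:
  assumes "compact K" "K \<subseteq> X" "locally_holomorphic X f" "e > 0"
  obtains g where "g \<in> polys" "\<And>p. p \<in> K \<Longrightarrow> norm (f p - g p) < e"
proof -
  interpret A: approximation_algebra K polys
    by (rule approximation_algebra_polys[OF assms(1,2)])
  show ?thesis
    using approximable_locally_holomorphic[OF assms(1-3)] assms(4) that unfolding A.approximable_def by blast
qed

section \<open>The density property\<close>

lemma vector_fields_coords:
  assumes V: "V \<in> vector_fields X"
  shows "locally_holomorphic X (\<lambda>p. dcx (V p))" "locally_holomorphic X (\<lambda>p. dca (V p))"
    "locally_holomorphic X (\<lambda>p. dcy (V p))" "locally_holomorphic X (\<lambda>p. dcs p (V p))"
proof -
  note R = vector_fields_component[OF V] locally_holomorphic_intros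
  show "locally_holomorphic X (\<lambda>p. dcx (V p))" unfolding dcx_def by (rule R)+
  show "locally_holomorphic X (\<lambda>p. dca (V p))" unfolding dca_def by (rule R)+
  show "locally_holomorphic X (\<lambda>p. dcy (V p))" unfolding dcy_def by (rule R)+
  show "locally_holomorphic X (\<lambda>p. dcs p (V p))" unfolding dcs_def by (rule R)+
qed

text \<open>Tangent vectors are defined by curves, which cannot be added; the sum is tangent because
  \<open>dem\<close> and the tangency equation are linear in the four velocities.\<close>

lemma vector_fields_add:
  assumes V: "V \<in> vector_fields X" and W: "W \<in> vector_fields X"
  shows "(\<lambda>p. V p + W p) \<in> vector_fields X"
  unfolding vector_fields_def
proof (intro CollectI conjI allI ballI)
  fix i
  show "(\<lambda>p. (V p + W p) $ i) \<in> hol_functions X"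
    using locally_holomorphic_add[OF vector_fields_component[OF V, of i] vector_fields_component[OF W, of i]]
      vector_fields_outside[OF V] vector_fields_outside[OF W]
    by (simp add: hol_functions_iff)
next
  fix p assume p: "p \<in> X"
  note v = tangent_vectors_coords[OF p vector_fields_tangent[OF V p]]
  note w = tangent_vectors_coords[OF p vector_fields_tangent[OF W p]]
  have "V p + W p = dem (cx p) (cy p) (cs p) (dcx (V p) + dcx (W p)) (dca (V p) + dca (W p))
      (dcy (V p) + dcy (W p)) (dcs p (V p) + dcs p (W p))"
    unfolding dem_linear(2)[symmetric] using v(1) w(1) by simp
  also have "\<dots> \<in> tangent_vectors X p"
  proof (rule dem_tangent[OF p])
    have "(ca p * dcx (V p) + cx p * dca (V p) + 2 * cs p * cy p * dcy (V p) + (cy p)^2 * dcs p (V p)) +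
        (ca p * dcx (W p) + cx p * dca (W p) + 2 * cs p * cy p * dcy (W p) + (cy p)^2 * dcs p (W p)) = 0"
      unfolding v(2) w(2) by simp
    then show "ca p * (dcx (V p) + dcx (W p)) + cx p * (dca (V p) + dca (W p)) +
        2 * cs p * cy p * (dcy (V p) + dcy (W p)) + (cy p)^2 * (dcs p (V p) + dcs p (W p)) = 0"
      by (simp only: distrib_left add_ac)
  qed
  finally show "V p + W p \<in> tangent_vectors X p" .
qed

text \<open>The coefficients glue the expressions of \<open>xV\<close> in the frame \<open>D1, D2, E1\<close> and of \<open>y\<^sup>2V\<close> in
  the frame \<open>D2, D4, E2\<close> by means of \<open>1 = ax + sy\<^sup>2\<close>.\<close>

lemma vector_fields_decomposition:
  assumes V: "V \<in> vector_fields X"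
  shows "V p = (ca p * dcy (V p)) *s D1 p + ((ca p * dcs p (V p) - cs p * dca (V p)) *s D2 p +
    ((ca p * dcx (V p)) *s E1 p + ((- cs p * dcx (V p)) *s D4 p + (cs p * cy p * dcy (V p)) *s E2 p)))"
proof (cases "p \<in> X")
  case p: True
  define vx va vy vs where v: "vx = dcx (V p)" "va = dca (V p)" "vy = dcy (V p)" "vs = dcs p (V p)"
  define x a y s where xs: "x = cx p" "a = ca p" "y = cy p" "s = cs p"
  note T = tangent_vectors_coords[OF p vector_fields_tangent[OF V p], folded v xs]
  have rel: "x * a + s * y^2 = 1" using X_coords(1)[OF p] by (simp add: xs)
  \<comment> \<open>Each coordinate of the combination is \<open>x a + s y^2\<close> times the
    coordinate of \<open>V\<close>, up to a multiple of the tangency relation \<open>T(2)\<close>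
    for \<open>a\<close> and \<open>s\<close>.\<close>
  have "(- s * vx) * (- (y * y)) + a * vx * x = vx"
  proof -
    have "(- s * vx) * (- (y * y)) + a * vx * x = (x * a + s * y^2) * vx"
      by (simp add: power2_eq_square algebra_simps)
    then show ?thesis using rel by simp
  qed
  moreover have "a * vy * (- 2 * s * y) + (a * vs - s * va) * (- (y * y)) + a * vx * (- a) = va"
  proof -
    have "a * vy * (- 2 * s * y) + (a * vs - s * va) * (- (y * y)) + a * vx * (- a) =
        (x * a + s * y^2) * va - a * (a * vx + x * va + 2 * s * y * vy + y^2 * vs)"
      by (simp add: power2_eq_square algebra_simps)
    then show ?thesis using rel T(2) by simp
  qed
  moreover have "a * vy * x + s * y * vy * y = vy"
  proof -
    have "a * vy * x + s * y * vy * y = (x * a + s * y^2) * vy"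
      by (simp add: power2_eq_square algebra_simps)
    then show ?thesis using rel by simp
  qed
  moreover have "(a * vs - s * va) * x + (- s * vx) * a + s * y * vy * (- 2 * s) = vs"
  proof -
    have "(a * vs - s * va) * x + (- s * vx) * a + s * y * vy * (- 2 * s) =
        (x * a + s * y^2) * vs - s * (a * vx + x * va + 2 * s * y * vy + y^2 * vs)"
      by (simp add: power2_eq_square algebra_simps)
    then show ?thesis using rel T(2) by simp
  qed
  ultimately have "dem x y s vx va vy vs = dem x y s
      ((- s * vx) * (- (y * y)) + a * vx * x)
      (a * vy * (- 2 * s * y) + (a * vs - s * va) * (- (y * y)) + a * vx * (- a))
      (a * vy * x + s * y * vy * y)
      ((a * vs - s * va) * x + (- s * vx) * a + s * y * vy * (- 2 * s))"
    by (simp only:)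
  also have "\<dots> = (a * vy) *s dem x y s 0 (- 2 * s * y) x 0 + ((a * vs - s * va) *s dem x y s 0 (- (y * y)) 0 x +
      ((a * vx) *s dem x y s x (- a) 0 0 + ((- s * vx) *s dem x y s (- (y * y)) 0 0 a +
       (s * y * vy) *s dem x y s 0 0 y (- 2 * s))))"
    unfolding dem_linear by (simp add: algebra_simps)
  finally have eq: "dem x y s vx va vy vs = \<dots>" .
  have fields: "D1 p = dem x y s 0 (- 2 * s * y) x 0" "D2 p = dem x y s 0 (- (y * y)) 0 x"
    "E1 p = dem x y s x (- a) 0 0" "D4 p = dem x y s (- (y * y)) 0 0 a" "E2 p = dem x y s 0 0 y (- 2 * s)"
    using p by (simp_all add: D1_def D2_def D4_def E1_def E2_def fld_def xs)
  show ?thesis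
    unfolding fields v[symmetric] xs[symmetric] by (rule trans[OF T(1) eq])
next
  case False
  then show ?thesis
    using vector_fields_outside[OF V False] by (simp add: D1_def D2_def D4_def E1_def E2_def fld_def)
qed

end

lemma norm_vector_smult: "norm (c *s (v :: complex^'n)) = norm c * norm v"
  by (simp add: norm_vec_def norm_mult L2_set_right_distrib)

lemma vector_fields_continuous_on: "V \<in> vector_fields X \<Longrightarrow> continuous_on X V"
  by (intro continuous_on_components locally_holomorphic_continuous_on vector_fields_component)

context variety_chart
begin

text \<open>The coefficient \<open>g\<close> is replaced by a polynomial \<open>P\<close> within
  \<open>e / B\<close>, where \<open>B\<close> bounds \<open>D\<close> on \<open>K\<close>;
  absorption puts \<open>P D\<close> into the Lie algebra.\<close>

lemma approximate_multiple:
  assumes K: "compact K" "K \<subseteq> X" and g: "locally_holomorphic X g" and D: "D \<in> vector_fields X" "absorbs D"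
    and e: "e > 0"
  obtains W where "W \<in> vector_fields X" "W \<in> Lie" "\<And>p. p \<in> K \<Longrightarrow> norm (W p - g p *s D p) < e"
proof -
  have "bounded (D ` K)"
    using K vector_fields_continuous_on[OF D(1)]
    by (intro compact_imp_bounded compact_continuous_image) (auto intro: continuous_on_subset)
  then obtain B where B: "B > 0" "\<And>p. p \<in> K \<Longrightarrow> norm (D p) \<le> B"
    unfolding bounded_pos by blast
  have "e / B > 0" using e B(1) by simp
  then obtain P where P: "P \<in> polys" "\<And>p. p \<in> K \<Longrightarrow> norm (g p - P p) < e / B"
    using polys_dense[OF K g] by metis
  show ?thesis
  proof
    show "scale_field P D \<in> vector_fields X"
      by (rule scale_field_in_vector_fields[OF polys_locally_holomorphic[OF P(1)] D(1)])
    show "scale_field P D \<in> Lie"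
      using D(2) P(1) unfolding absorbs_def by blast
    fix p assume p: "p \<in> K"
    have diff: "scale_field P D p - g p *s D p = (P p - g p) *s D p"
      by (simp add: scale_field_def vec_eq_iff left_diff_distrib)
    have "norm (scale_field P D p - g p *s D p) = norm (g p - P p) * norm (D p)"
      unfolding diff norm_vector_smult norm_minus_commute[of "P p"] ..
    also have "\<dots> \<le> norm (g p - P p) * B"
      using B(2)[OF p] by (intro mult_left_mono) auto
    also have "\<dots> < e"
      using P(2)[OF p] B(1) by (simp add: pos_less_divide_eq)
    finally show "norm (scale_field P D p - g p *s D p) < e" .
  qed
qed

text \<open>\<open>vector_fields_decomposition\<close> splits a field into five holomorphic
  multiples of absorbed fields, each approximated within \<open>e / 5\<close> on \<open>K\<close>.
  The other inclusion holds because \<open>vector_fields X\<close> is the whole space of the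
  topology.\<close>

theorem density_property_X: "density_property X"
  unfolding density_property_def
proof (rule subset_antisym)
  show "compact_open X (vector_fields X) closure_of Lie \<subseteq> vector_fields X"
    using closure_of_subset_topspace[of "compact_open X (vector_fields X)" Lie]
    by (simp add: topspace_compact_open)
  show "vector_fields X \<subseteq> compact_open X (vector_fields X) closure_of Lie"
  proof
    fix V assume V: "V \<in> vector_fields X"
    show "V \<in> compact_open X (vector_fields X) closure_of Lie"
    proof (rule in_closure_compact_open[OF V vector_fields_continuous_on[OF V]])
      fix K and e :: real assume K: "compact K" "K \<subseteq> X" and "e > 0"
      then have e: "e / 5 > 0" by simp
      note hol = vector_fields_coords[OF V] locally_holomorphic_coords locally_holomorphic_intros
      have hols: "locally_holomorphic X (\<lambda>p. ca p * dcy (V p))"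
        "locally_holomorphic X (\<lambda>p. ca p * dcs p (V p) - cs p * dca (V p))"
        "locally_holomorphic X (\<lambda>p. ca p * dcx (V p))" "locally_holomorphic X (\<lambda>p. - cs p * dcx (V p))"
        "locally_holomorphic X (\<lambda>p. cs p * cy p * dcy (V p))"
        by (rule hol)+
      note F = fields_in_vector_fields
      obtain W1 where W1: "W1 \<in> vector_fields X" "W1 \<in> Lie" "\<And>p. p \<in> K \<Longrightarrow> norm (W1 p - (ca p * dcy (V p)) *s D1 p) < e / 5"
        by (rule approximate_multiple[OF K hols(1) F(1) absorbs_D1 e]) blast
      obtain W2 where W2: "W2 \<in> vector_fields X" "W2 \<in> Lie" "\<And>p. p \<in> K \<Longrightarrow> norm (W2 p - (ca p * dcs p (V p) - cs p * dca (V p)) *s D2 p) < e / 5"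
        by (rule approximate_multiple[OF K hols(2) F(2) absorbs_D2_D4(1) e]) blast
      obtain W3 where W3: "W3 \<in> vector_fields X" "W3 \<in> Lie" "\<And>p. p \<in> K \<Longrightarrow> norm (W3 p - (ca p * dcx (V p)) *s E1 p) < e / 5"
        by (rule approximate_multiple[OF K hols(3) F(5) absorbs_E1_E2(1) e]) blast
      obtain W4 where W4: "W4 \<in> vector_fields X" "W4 \<in> Lie" "\<And>p. p \<in> K \<Longrightarrow> norm (W4 p - (- cs p * dcx (V p)) *s D4 p) < e / 5"
        by (rule approximate_multiple[OF K hols(4) F(4) absorbs_D2_D4(2) e]) blast
      obtain W5 where W5: "W5 \<in> vector_fields X" "W5 \<in> Lie" "\<And>p. p \<in> K \<Longrightarrow> norm (W5 p - (cs p * cy p * dcy (V p)) *s E2 p) < e / 5"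
        by (rule approximate_multiple[OF K hols(5) F(6) absorbs_E1_E2(2) e]) blast
      let ?W = "\<lambda>p. W1 p + (W2 p + (W3 p + (W4 p + W5 p)))"
      have "?W \<in> Lie"
        using W1(2) W2(2) W3(2) W4(2) W5(2) by (intro lie_generated.add)
      moreover have "?W \<in> vector_fields X"
        using W1(1) W2(1) W3(1) W4(1) W5(1) by (intro vector_fields_add)
      moreover have "dist (?W p) (V p) < e" if p: "p \<in> K" for p
      proof -
        have split: "norm (a + b - (c + d)) \<le> norm (a - c) + N" if "norm (b - d) \<le> N"
          for a b c d :: "complex^5" and N
          using norm_diff_triangle_ineq[of a b c d] that by linarith
        have split5: "norm (w1 + (w2 + (w3 + (w4 + w5))) - v) \<le> norm (w1 - v1) + (norm (w2 - v2) +
            (norm (w3 - v3) + (norm (w4 - v4) + norm (w5 - v5))))"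
          if "v = v1 + (v2 + (v3 + (v4 + v5)))" for v v1 v2 v3 v4 v5 w1 w2 w3 w4 w5 :: "complex^5"
          unfolding that by (intro split norm_diff_triangle_ineq)
        have "norm (?W p - V p) < e / 5 + (e / 5 + (e / 5 + (e / 5 + e / 5)))"
          by (rule le_less_trans[OF split5[OF vector_fields_decomposition[OF V]]])
            (intro add_strict_mono W1(3)[OF p] W2(3)[OF p] W3(3)[OF p] W4(3)[OF p] W5(3)[OF p])
        then show ?thesis by (simp add: dist_norm)
      qed
      ultimately show "\<exists>W\<in>Lie \<inter> vector_fields X. \<forall>p\<in>K. dist (W p) (V p) < e"
        by (intro bexI[of _ ?W] IntI ballI)
    qed
  qed
qed

end

section \<open>The compatible triple\<close>

lemma hol_functions_closed:
  assumes "f \<in> hol_functions X" "g \<in> hol_functions X"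
  shows "(\<lambda>p. f p + g p) \<in> hol_functions X" "(\<lambda>p. f p * g p) \<in> hol_functions X"
    "(\<lambda>p. - f p) \<in> hol_functions X"
  using assms by (auto simp: hol_functions_iff
      intro: locally_holomorphic_add locally_holomorphic_mult locally_holomorphic_uminus)

lemma zero_in_hol_functions: "(\<lambda>p. 0) \<in> hol_functions X"
  by (simp add: hol_functions_iff locally_holomorphic_const)

lemma indicator_in_hol_functions: "indicator X \<in> hol_functions X"
  unfolding hol_functions_iff
  by (auto intro: locally_holomorphic_cong[OF locally_holomorphic_const[of X 1]])

text \<open>Makes the whole ring available as the ideal of the compatible tuple. The indicator of
  \<open>X\<close> is a unit element because members vanish off \<open>X\<close>.\<close>

lemma ring_hol_ring: "ring (hol_ring X)"
proof (rule ringI)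
  show "abelian_group (hol_ring X)"
  proof (rule abelian_groupI)
    fix f assume "f \<in> carrier (hol_ring X)"
    then show "\<exists>g\<in>carrier (hol_ring X). g \<oplus>\<^bsub>hol_ring X\<^esub> f = \<zero>\<^bsub>hol_ring X\<^esub>"
      by (intro bexI[of _ "\<lambda>p. - f p"]) (auto simp: hol_ring_def hol_functions_closed)
  qed (auto simp: hol_ring_def hol_functions_closed zero_in_hol_functions add_ac)
  show "Group.monoid (hol_ring X)"
  proof (rule monoidI)
    fix f assume "f \<in> carrier (hol_ring X)"
    then have f: "f p = 0" if "p \<notin> X" for p
      using that by (auto simp: hol_ring_def hol_functions_iff)
    then have "(\<lambda>p. indicator X p * f p) = f"
      by (auto simp: indicator_def fun_eq_iff)
    then show "\<one>\<^bsub>hol_ring X\<^esub> \<otimes>\<^bsub>hol_ring X\<^esub> f = f" "f \<otimes>\<^bsub>hol_ring X\<^esub> \<one>\<^bsub>hol_ring X\<^esub> = f"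
      by (simp_all add: hol_ring_def mult.commute)
  qed (auto simp: hol_ring_def hol_functions_closed indicator_in_hol_functions mult_ac)
qed (auto simp: hol_ring_def algebra_simps)

definition restrict_to :: "(complex^'n) set \<Rightarrow> (complex^'n \<Rightarrow> complex) \<Rightarrow> complex^'n \<Rightarrow> complex" where
  "restrict_to X f = (\<lambda>p. if p \<in> X then f p else 0)"

lemma restrict_to_in_hol_functions:
  "locally_holomorphic X f \<Longrightarrow> restrict_to X f \<in> hol_functions X"
  by (auto simp: hol_functions_iff restrict_to_def intro: locally_holomorphic_cong)

lemma apply_field_restrict_to:
  assumes V: "V \<in> vector_fields X" and D: "\<And>p. p \<in> X \<Longrightarrow> derivative_along X f p (V p) (g p)"
  shows "apply_field X V (restrict_to X f) = restrict_to X g"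
proof
  fix p
  show "apply_field X V (restrict_to X f) p = restrict_to X g p"
  proof (cases "p \<in> X")
    case True
    have "derivative_along X (restrict_to X f) p (V p) (g p)"
      by (rule derivative_along_cong[OF D[OF True]]) (simp add: restrict_to_def)
    from apply_field_eq[where V=V, OF this vector_fields_tangent[OF V True] True]
    show ?thesis using True by (simp add: restrict_to_def)
  qed (simp add: apply_field_outside restrict_to_def)
qed

lemma restrict_to_in_field_kernel:
  assumes "locally_holomorphic X f" "V \<in> vector_fields X" "\<And>p. p \<in> X \<Longrightarrow> derivative_along X f p (V p) 0"
  shows "restrict_to X f \<in> field_kernel X V"
  using restrict_to_in_hol_functions[OF assms(1)] apply_field_restrict_to[OF assms(2,3)]
  by (simp add: field_kernel_def restrict_to_def)

text \<open>Each arc carries the name of its tail, one of the leaves \<open>1\<close> and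
  \<open>2\<close>, and points to the root \<open>0\<close>.\<close>

definition star_tree :: "(nat, nat) pre_digraph" where
  "star_tree = \<lparr>verts = {0, 1, 2}, arcs = {1, 2}, tail = (\<lambda>e. e), head = (\<lambda>e. 0)\<rparr>"

text \<open>No arc leaves the root, so a walk ending there is empty or consists of the single arc at
  a leaf.\<close>

lemma star_tree_rooted: "rooted_in_tree star_tree 0"
proof -
  have cas0: "pre_digraph.cas star_tree 0 p 0 \<longleftrightarrow> p = []" if "set p \<subseteq> {1, 2}" for p
    using that by (cases p) (auto simp: pre_digraph.cas.simps star_tree_def)
  have "pre_digraph.awalk star_tree v p 0 \<longleftrightarrow> p = (if v = 0 then [] else [v])" if "v \<in> {0, 1, 2}" for v p
  proof (cases p)
    case Nil
    then show ?thesis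
      using that by (auto simp: pre_digraph.awalk_def pre_digraph.cas.simps star_tree_def)
  next
    case (Cons e es)
    have "pre_digraph.awalk star_tree v p 0 \<longleftrightarrow>
        e \<in> {1, 2} \<and> set es \<subseteq> {1, 2} \<and> e = v \<and> pre_digraph.cas star_tree 0 es 0"
      using that unfolding Cons by (auto simp: pre_digraph.awalk_def pre_digraph.cas.simps star_tree_def)
    also have "\<dots> \<longleftrightarrow> e \<in> {1, 2} \<and> e = v \<and> es = []"
      using cas0[of es] by auto
    also have "\<dots> \<longleftrightarrow> p = (if v = 0 then [] else [v])"
      using that unfolding Cons by auto
    finally show ?thesis .
  qed
  moreover have "fin_digraph star_tree"
    by unfold_locales (auto simp: star_tree_def)
  ultimately show ?thesis
    unfolding rooted_in_tree_def by (auto simp: star_tree_def)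
qed

context variety_chart
begin

lemma fields_distinct: "distinct [D2, D3, D1]"
proof -
  \<comment> \<open>At the point with \<open>x = y = s = 1\<close> and \<open>a = 0\<close>, the
    derivative of \<open>y\<close> is \<open>1\<close> along \<open>D1\<close> and \<open>0\<close>
    along \<open>D2\<close> and \<open>D3\<close>, while that of \<open>s\<close> separates
    \<open>D2\<close> from \<open>D3\<close>.\<close>
  define q where "q = emb 1 0 1 1"
  have q: "q \<in> X" "cx q = 1" "ca q = 0" "cy q = 1" "cs q = 1"
    unfolding q_def using emb_in_X[of 1 0 1 1] coords_emb[of 1 0 1 1] by simp_all
  note U = derivative_along_unique[OF vector_fields_tangent[OF fields_in_vector_fields(1) q(1)]]
    derivative_along_unique[OF vector_fields_tangent[OF fields_in_vector_fields(2) q(1)]]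
  have "D1 \<noteq> D2"
    using U(1)[OF fields_derivs(3)[OF q(1)], of 0] fields_derivs(7)[OF q(1)] q(2) by auto
  moreover have "D1 \<noteq> D3"
    using U(1)[OF fields_derivs(3)[OF q(1)], of 0] fields_derivs(11)[OF q(1)] q(2,3) by auto
  moreover have "D2 \<noteq> D3"
    using U(2)[OF fields_derivs(8)[OF q(1)], of 0] fields_derivs(12)[OF q(1)] q(2) by auto
  ultimately show ?thesis by auto
qed

text \<open>\<open>D2\<close> annihilates \<open>x\<close> and \<open>y\<close>, \<open>D3\<close>
  annihilates \<open>a\<close> and \<open>s\<close>, and the kernel of \<open>D1\<close> contributes
  the constant \<open>1\<close>.\<close>

lemma monomial_in_kernel_products:
  "restrict_to X (monomial i j k l) \<in> kernel_products X [D2, D3, D1]"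
proof -
  note hol = locally_holomorphic_coords locally_holomorphic_intros
  define f where "f n = (if n = 0 then restrict_to X (\<lambda>p. cx p ^ i * cy p ^ k)
    else if n = 1 then restrict_to X (\<lambda>p. ca p ^ j * cs p ^ l) else restrict_to X (\<lambda>p. 1))" for n :: nat
  have "f 0 \<in> field_kernel X D2" unfolding f_def
  proof (simp, rule restrict_to_in_field_kernel[OF _ fields_in_vector_fields(2)])
    show "locally_holomorphic X (\<lambda>p. cx p ^ i * cy p ^ k)" by (rule hol)+
    show "derivative_along X (\<lambda>p. cx p ^ i * cy p ^ k) p (D2 p) 0" if "p \<in> X" for p
      by (rule derivative_along_eq, (rule fields_derivs derivative_along_intros that)+) simp
  qed
  moreover have "f 1 \<in> field_kernel X D3" unfolding f_def
  proof (simp, rule restrict_to_in_field_kernel[OF _ fields_in_vector_fields(3)])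
    show "locally_holomorphic X (\<lambda>p. ca p ^ j * cs p ^ l)" by (rule hol)+
    show "derivative_along X (\<lambda>p. ca p ^ j * cs p ^ l) p (D3 p) 0" if "p \<in> X" for p
      by (rule derivative_along_eq, (rule fields_derivs derivative_along_intros that)+) simp
  qed
  moreover have "f 2 \<in> field_kernel X D1" unfolding f_def
    by (simp, rule restrict_to_in_field_kernel[OF locally_holomorphic_const fields_in_vector_fields(1) derivative_along_const])
  ultimately have "\<forall>n<length [D2, D3, D1]. f n \<in> field_kernel X ([D2, D3, D1] ! n)"
    by (simp add: less_Suc_eq numeral_2_eq_2)
  moreover have "restrict_to X (monomial i j k l) = (\<lambda>p. \<Prod>n<length [D2, D3, D1]. f n p)"
    by (rule ext) (simp add: f_def restrict_to_def monomial_def)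
  ultimately show ?thesis
    unfolding kernel_products_def by blast
qed

text \<open>The span contains all polynomials restricted to \<open>X\<close>, and these are
  dense.\<close>

lemma hol_functions_subset_closure:
  "hol_functions X \<subseteq> compact_open X (hol_functions X) closure_of
     module.span (\<lambda>(c::complex) f p. c * f p) (kernel_products X [D2, D3, D1])"
proof
  interpret M: module "\<lambda>(c::complex) f (p::complex^5). c * f p"
    by unfold_locales (auto simp: fun_eq_iff algebra_simps)
  have span: "restrict_to X g \<in> M.span (kernel_products X [D2, D3, D1])" if "g \<in> polys" for g
    using that
  proof induction
    case (monomial c i j k l)
    have "(\<lambda>p. c * restrict_to X (monomial i j k l) p) \<in> M.span (kernel_products X [D2, D3, D1])"
      by (rule M.span_scale[OF M.span_base[OF monomial_in_kernel_products]])
    moreover have "(\<lambda>p. c * restrict_to X (monomial i j k l) p) = restrict_to X (\<lambda>p. c * monomial i j k l p)"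
      by (auto simp: restrict_to_def)
    ultimately show ?case by simp
  next
    case (add f g)
    have "restrict_to X (\<lambda>p. f p + g p) = restrict_to X f + restrict_to X g"
      by (auto simp: restrict_to_def)
    then show ?case using M.span_add[OF add.IH] by (simp only:)
  qed
  fix f assume f: "f \<in> hol_functions X"
  then have lh: "locally_holomorphic X f" by (simp add: hol_functions_iff)
  show "f \<in> compact_open X (hol_functions X) closure_of M.span (kernel_products X [D2, D3, D1])"
  proof (rule in_closure_compact_open[OF f locally_holomorphic_continuous_on[OF lh]])
    fix K and e :: real assume K: "compact K" "K \<subseteq> X" and e: "e > 0"
    obtain g where g: "g \<in> polys" "\<And>p. p \<in> K \<Longrightarrow> norm (f p - g p) < e"
      using polys_dense[OF K lh e] by metis
    have "dist (restrict_to X g p) (f p) < e" if "p \<in> K" for p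
      using g(2)[OF that] K(2) that by (auto simp: restrict_to_def dist_norm norm_minus_commute)
    then show "\<exists>W\<in>M.span (kernel_products X [D2, D3, D1]) \<inter> hol_functions X. \<forall>p\<in>K. dist (W p) (f p) < e"
      using span[OF g(1)] restrict_to_in_hol_functions[OF polys_locally_holomorphic[OF g(1)]]
      by (intro bexI[of _ "restrict_to X g"] IntI ballI)
  qed
qed

text \<open>\<open>D2\<close> annihilates \<open>y\<close>, whereas \<open>D3\<close> sends it to
  \<open>a\<close> and \<open>D1\<close> sends it to \<open>x\<close>, which the respective fields
  annihilate in turn. So \<open>y\<close> serves as the function on both edges.\<close>

lemma cy_in_kernels:
  "restrict_to X cy \<in> field_kernel X D2"
  "restrict_to X cy \<in> field_kernel2 X D3 - field_kernel X D3"
  "restrict_to X cy \<in> field_kernel2 X D1 - field_kernel X D1"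
proof -
  note F = fields_in_vector_fields
  show "restrict_to X cy \<in> field_kernel X D2"
    by (rule restrict_to_in_field_kernel[OF locally_holomorphic_coords(2) F(2) fields_derivs(7)])
  \<comment> \<open>A point where neither \<open>x\<close> nor \<open>a\<close> vanishes, which
    shows that \<open>y\<close> is not in the kernel of \<open>D1\<close> or of
    \<open>D3\<close>.\<close>
  have q: "emb 1 1 0 0 \<in> X" "cx (emb 1 1 0 0) = 1" "ca (emb 1 1 0 0) = 1"
    using emb_in_X[of 1 1 0 0] coords_emb[of 1 1 0 0] by simp_all
  have hol: "restrict_to X cy \<in> hol_functions X"
    by (rule restrict_to_in_hol_functions[OF locally_holomorphic_coords(2)])
  have "restrict_to X ca \<noteq> (\<lambda>p. 0)" "restrict_to X cx \<noteq> (\<lambda>p. 0)"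
    using q by (metis restrict_to_def zero_neq_one)+
  moreover have "apply_field X D3 (restrict_to X cy) = restrict_to X ca"
    by (rule apply_field_restrict_to[OF F(3) fields_derivs(11)])
  moreover have "apply_field X D3 (restrict_to X ca) = restrict_to X (\<lambda>p. 0)"
    by (rule apply_field_restrict_to[OF F(3) fields_derivs(10)])
  moreover have "apply_field X D1 (restrict_to X cy) = restrict_to X cx"
    by (rule apply_field_restrict_to[OF F(1) fields_derivs(3)])
  moreover have "apply_field X D1 (restrict_to X cx) = restrict_to X (\<lambda>p. 0)"
    by (rule apply_field_restrict_to[OF F(1) fields_derivs(1)])
  moreover have "restrict_to X (\<lambda>p. 0) = (\<lambda>p. 0)" by (simp add: restrict_to_def)
  ultimately show "restrict_to X cy \<in> field_kernel2 X D3 - field_kernel X D3"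
    "restrict_to X cy \<in> field_kernel2 X D1 - field_kernel X D1"
    using hol by (simp_all add: field_kernel_def field_kernel2_def)
qed

text \<open>The ideal is the whole ring, nonzero as \<open>X\<close> has a point; the tree is the
  star with root \<open>D2\<close> and leaves \<open>D3\<close> and \<open>D1\<close>.\<close>

theorem compatible_tuple_X: "compatible_tuple X [D2, D3, D1]"
  unfolding compatible_tuple_def
proof (intro conjI)
  show "distinct [D2, D3, D1]" by (rule fields_distinct)
  show "set [D2, D3, D1] \<subseteq> complete_fields X" using fields_complete by simp
  have "ideal (hol_functions X) (hol_ring X)"
    using ring.oneideal[OF ring_hol_ring[of X]] by (simp add: hol_ring_def)
  moreover have "hol_functions X \<noteq> {\<lambda>p. 0}"
  proof
    assume "hol_functions X = {\<lambda>p. 0}"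
    then have "indicator X = (\<lambda>p. 0 :: complex)" using indicator_in_hol_functions[of X] by simp
    moreover have "emb 1 1 0 0 \<in> X" by (rule emb_in_X) simp
    ultimately show False by (metis indicator_simps(1) zero_neq_one)
  qed
  ultimately show "\<exists>I. ideal I (hol_ring X) \<and> I \<noteq> {\<lambda>p. 0} \<and> I \<subseteq> compact_open X (hol_functions X) closure_of
      module.span (\<lambda>(c::complex) f p. c * f p) (kernel_products X [D2, D3, D1])"
    using hol_functions_subset_closure by blast
  define \<pi> where "\<pi> v = (if v = 0 then D2 else if v = 1 then D3 else D1)" for v :: nat
  have "bij_betw \<pi> (verts star_tree) (set [D2, D3, D1])"
    using fields_distinct by (auto simp: bij_betw_def inj_on_def \<pi>_def star_tree_def)
  moreover have "\<forall>e\<in>arcs star_tree. restrict_to X cy \<in>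
      (field_kernel2 X (\<pi> (tail star_tree e)) - field_kernel X (\<pi> (tail star_tree e)))
        \<inter> field_kernel X (\<pi> (head star_tree e))"
    using cy_in_kernels by (simp add: star_tree_def \<pi>_def)
  moreover have "\<pi> 0 = [D2, D3, D1] ! 0" by (simp add: \<pi>_def)
  ultimately show "\<exists>(G :: (nat, nat) pre_digraph) r \<pi> \<epsilon>. rooted_in_tree G r \<and>
      bij_betw \<pi> (verts G) (set [D2, D3, D1]) \<and> \<pi> r = [D2, D3, D1] ! 0 \<and>
      (\<forall>e\<in>arcs G. \<epsilon> e \<in> (field_kernel2 X (\<pi> (tail G e)) - field_kernel X (\<pi> (tail G e)))
         \<inter> field_kernel X (\<pi> (head G e)))"
    using star_tree_rooted
    by (intro exI[of _ star_tree] exI[of _ 0] exI[of _ \<pi>] exI[of _ "\<lambda>e. restrict_to X cy"] conjI)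
qed

end

theorem mainTheorem4:
  fixes b\<^sub>1 b\<^sub>2 :: complex
  assumes "(b\<^sub>1, b\<^sub>2) \<noteq> (0, 0)"
  shows "(\<exists>\<theta>\<^sub>1 \<theta>\<^sub>2 \<theta>\<^sub>3. compatible_tuple (variety_G b\<^sub>1 b\<^sub>2) [\<theta>\<^sub>1, \<theta>\<^sub>2, \<theta>\<^sub>3]) \<and>
         density_property (variety_G b\<^sub>1 b\<^sub>2)"
proof -
  \<comment> \<open>Completes \<open>b\<close> to a matrix of determinant one by inverting a nonzero
    entry of \<open>b\<close>.\<close>
  obtain d\<^sub>1 d\<^sub>2 where "b\<^sub>1 * d\<^sub>2 - b\<^sub>2 * d\<^sub>1 = 1"
  proof (cases "b\<^sub>1 = 0")
    case True
    then show ?thesis using assms that[of 0 "- inverse b\<^sub>2"] by simp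
  next
    case False
    then show ?thesis using that[of "inverse b\<^sub>1" 0] by simp
  qed
  then interpret variety_chart b\<^sub>1 b\<^sub>2 d\<^sub>1 d\<^sub>2
    by unfold_locales
  show ?thesis using compatible_tuple_X density_property_X by blast
qed

end
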